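(* Let $T>0$ and let $s\in\mathbb{R}$. Assume that $a\in\mathcal{C}^\alpha([0,T])$ with $0<\alpha<2$ satisfies $a(t)\ge0$ for all $t\in[0,T]$ and that $q\in L^\infty([0,T])$ is real-valued. Let $f\in C([0,T];\gamma^s_{\mathcal{H}})$. If $v_0,v_1\in\gamma^s_{\mathcal{H}}$, then the Cauchy problem $$\partial_t^2 v(t,x)+a(t)\mathcal{H}v(t,x)+q(t)v(t,x)=f(t,x),\quad (t,x)\in[0,T]\times\mathbb{R}^n,$$ $$v(0,x)=v_0(x),\qquad \partial_t v(0,x)=v_1(x),\quad x\in\mathbb{R}^n,$$ has a unique solution $v\in C^2([0,T];\gamma^s_{\mathcal{H}})$ provided that $$1\le s<1+\frac{\alpha}{2}.$$
   Context: The operator $\mathcal{H}$. Let $V$ be a complex potential on $\mathbb{R}^n$ and let $\mathcal{H}_0=-\Delta+V$ be a densely defined Schrödinger operator on $L^2(\mathbb{R}^n)$ with purely discrete spectrum (empty essential spectrum) $\{\lambda_\xi\in\mathbb{C}:\xi\in\mathcal{I}\}$, $\mathcal{I}$ an ordered countable set, whose corresponding eigenfunctions $\{u_\xi\}_{\xi\in\mathcal{I}}$ form a Riesz basis of $L^2(\mathbb{R}^n)$. Let $\{v_\xi\}_{\xi\in\mathcal{I}}$ be the biorthogonal system, $\int_{\mathbb{R}^n}u_\xi\overline{v_\eta}\,dx=\delta_{\xi\eta}$. Then $\mathcal{H}:=|\mathcal{H}_0|$ denotes the operator with $\mathcal{H}u_\xi=|\lambda_\xi|u_\xi$ for every $\xi$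 (this is not the absolute value in the operator-theoretic sense). If some $\lambda_\xi=0$, one instead fixes $c>0$ and lets $\mathcal{H}$ be the operator with eigenvalue $|\lambda_\xi|+c$ on each $u_\xi$. Write $\mu_\xi>0$ for the eigenvalue of $\mathcal{H}$ on $u_\xi$, and $\langle\xi\rangle:=(1+|\lambda_\xi|)^{1/2}$. The $\mathcal{H}$-Fourier transform is $\widehat f(\xi)=\int_{\mathbb{R}^n}f(x)\overline{v_\xi(x)}\,dx$, so that $f=\sum_\xi\widehat f(\xi)u_\xi$. Gevrey spaces. For real $s\ge1$, the (Roumieu) Gevrey space $\gamma^s_{\mathcal{H}}$ consists of all $f$ for which there exists $A>0$ with $\sum_{\xi\in\mathcal{I}}e^{2A\langle\xi\rangle^{1/s}}|\widehat f(\xi)|^2<\infty$. It is the union over $A>0$ of the Hilbert spaces given by this sum, with the inductive limit topology. For $0<\alpha\le1$, $a\in\mathcal{C}^\alpha([0,T])$ means there is $M_a>0$ with $|a(t)-a(t')|\le M_a|t-t'|^\alpha$ for all $t,t'\in[0,T]$; for $1<\alpha<2$ it means that $a$ is continuously differentiable on $[0,T]$ and $a'$ satisfies this inequality with exponent $\alpha-1$. Solutions of the equation are understood after $\mathcal{H}$-Fourier transform in $x$: for every $\xi\in\mathcal{I}$, $\partial_t^2\widehat v+a(t)\mu_\xi\widehat v+q(t)\widehat v=\widehat f$ in $t$ with the transformed initial data.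
   Formalization: For discontinuous q in L^∞ a C^2 solution need not exist (q a step function, a=1, f=0), so v is C^1 in time with Lipschitz ∂_t v and solves the equation for a.e. t; v is C^2 when q has a continuous representative; uniqueness holds in both classes. *)

theory Defs
  imports "HOL-Analysis.Analysis"
begin

section \<open>Square integrable functions\<close>

text \<open>Elements of \<open>L\<^sup>2\<close> are represented by functions; statements about them that
  should concern equivalence classes are made up to equality almost everywhere.\<close>

definition L2 :: "(real^'n \<Rightarrow> complex) set" where
  "L2 = {f. f \<in> borel_measurable lebesgue \<and> integrable lebesgue (\<lambda>x. (cmod (f x))\<^sup>2)}"

definition L2_norm :: "(real^'n \<Rightarrow> complex) \<Rightarrow> real" where
  "L2_norm f = sqrt (LINT x|lebesgue. (cmod (f x))\<^sup>2)"

definition L2_inner :: "(real^'n \<Rightarrow> complex) \<Rightarrow> (real^'n \<Rightarrow> complex) \<Rightarrow> complex" where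
  "L2_inner f g = (LINT x|lebesgue. f x * cnj (g x))"

definition L2_dense :: "(real^'n \<Rightarrow> complex) set \<Rightarrow> bool" where
  "L2_dense D \<longleftrightarrow> (\<forall>g\<in>L2. \<forall>e>0. \<exists>h\<in>D. L2_norm (\<lambda>x. g x - h x) < e)"

definition lin_comb :: "('k \<Rightarrow> real^'n \<Rightarrow> complex) \<Rightarrow> 'k set \<Rightarrow> ('k \<Rightarrow> complex) \<Rightarrow> real^'n \<Rightarrow> complex" where
  "lin_comb u F b = (\<lambda>x. \<Sum>\<xi>\<in>F. b \<xi> * u \<xi> x)"

definition riesz_basis :: "'i set \<Rightarrow> ('i \<Rightarrow> real^'n \<Rightarrow> complex) \<Rightarrow> bool" where
  "riesz_basis I u \<longleftrightarrow> (\<forall>\<xi>\<in>I. u \<xi> \<in> L2) \<and>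
     L2_dense {lin_comb u F b | F b. finite F \<and> F \<subseteq> I} \<and>
     (\<exists>m>0. \<exists>M. \<forall>F b. finite F \<and> F \<subseteq> I \<longrightarrow>
        m * (\<Sum>\<xi>\<in>F. (cmod (b \<xi>))\<^sup>2) \<le> (L2_norm (lin_comb u F b))\<^sup>2 \<and>
        (L2_norm (lin_comb u F b))\<^sup>2 \<le> M * (\<Sum>\<xi>\<in>F. (cmod (b \<xi>))\<^sup>2))"

definition biorthogonal :: "'i set \<Rightarrow> ('i \<Rightarrow> real^'n \<Rightarrow> complex) \<Rightarrow> ('i \<Rightarrow> real^'n \<Rightarrow> complex) \<Rightarrow> bool" where
  "biorthogonal I u w \<longleftrightarrow> (\<forall>\<xi>\<in>I. w \<xi> \<in> L2) \<and>
     (\<forall>\<xi>\<in>I. \<forall>\<eta>\<in>I. L2_inner (u \<xi>) (w \<eta>) = (if \<xi> = \<eta> then 1 else 0))"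


section \<open>Schroedinger operators\<close>

definition partial_deriv :: "'n \<Rightarrow> (real^'n \<Rightarrow> complex) \<Rightarrow> real^'n \<Rightarrow> complex" where
  "partial_deriv i \<phi> = (\<lambda>x. vector_derivative (\<lambda>h. \<phi> (x + h *\<^sub>R axis i 1)) (at 0))"

definition laplacian :: "(real^'n \<Rightarrow> complex) \<Rightarrow> real^'n \<Rightarrow> complex" where
  "laplacian \<phi> = (\<lambda>x. \<Sum>i\<in>UNIV. partial_deriv i (partial_deriv i \<phi>) x)"

definition test_function :: "(real^'n \<Rightarrow> complex) \<Rightarrow> bool" where
  "test_function \<phi> \<longleftrightarrow> (\<forall>js. foldr partial_deriv js \<phi> differentiable_on UNIV) \<and>
     (\<exists>K. compact K \<and> (\<forall>x. x \<notin> K \<longrightarrow> \<phi> x = 0))"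

text \<open>\<open>-\<Delta> u + V u = g\<close> in the sense of distributions.\<close>

definition weak_schrodinger ::
    "(real^'n \<Rightarrow> complex) \<Rightarrow> (real^'n \<Rightarrow> complex) \<Rightarrow> (real^'n \<Rightarrow> complex) \<Rightarrow> bool" where
  "weak_schrodinger V u g \<longleftrightarrow>
     (\<forall>K. compact K \<longrightarrow> set_integrable lebesgue K (\<lambda>x. V x * u x)) \<and>
     (\<forall>\<phi>. test_function \<phi> \<longrightarrow>
        (LINT x|lebesgue. u x * (- laplacian \<phi> x) + V x * u x * \<phi> x) = (LINT x|lebesgue. g x * \<phi> x))"

text \<open>Unbounded operators in \<open>L\<^sup>2\<close> are given by their graphs. A realization of
  \<open>-\<Delta> + V\<close> is determined by its domain \<open>D\<close>.\<close>

definition schrodinger_graph ::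
    "(real^'n \<Rightarrow> complex) \<Rightarrow> (real^'n \<Rightarrow> complex) set \<Rightarrow> ((real^'n \<Rightarrow> complex) \<times> (real^'n \<Rightarrow> complex)) set" where
  "schrodinger_graph V D = {(u, g). u \<in> D \<and> g \<in> L2 \<and> weak_schrodinger V u g}"

definition schrodinger_domain :: "(real^'n \<Rightarrow> complex) \<Rightarrow> (real^'n \<Rightarrow> complex) set \<Rightarrow> bool" where
  "schrodinger_domain V D \<longleftrightarrow>
     V \<in> borel_measurable lebesgue \<and> D \<subseteq> L2 \<and> L2_dense D \<and>
     (\<forall>g\<in>D. \<forall>h\<in>D. \<forall>b c. (\<lambda>x. b * g x + c * h x) \<in> D) \<and>
     (\<forall>g\<in>D. \<forall>h\<in>borel_measurable lebesgue. (AE x in lebesgue. h x = g x) \<longrightarrow> h \<in> D) \<and>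
     (\<forall>u\<in>D. \<exists>g\<in>L2. weak_schrodinger V u g)"

text \<open>The estimate below gives both injectivity and boundedness of the inverse.\<close>

definition resolvent_set :: "((real^'n \<Rightarrow> complex) \<times> (real^'n \<Rightarrow> complex)) set \<Rightarrow> complex set" where
  "resolvent_set G = {z.
     (\<forall>k\<in>L2. \<exists>(u, g)\<in>G. AE x in lebesgue. g x - z * u x = k x) \<and>
     (\<exists>C. \<forall>(u, g)\<in>G. L2_norm u \<le> C * L2_norm (\<lambda>x. g x - z * u x))}"

definition spectrum :: "((real^'n \<Rightarrow> complex) \<times> (real^'n \<Rightarrow> complex)) set \<Rightarrow> complex set" where
  "spectrum G = - resolvent_set G"

text \<open>Fredholm: finite dimensional kernel, closed range of finite codimension.\<close>

definition fredholm_at :: "((real^'n \<Rightarrow> complex) \<times> (real^'n \<Rightarrow> complex)) set \<Rightarrow> complex \<Rightarrow> bool" where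
  "fredholm_at G z \<longleftrightarrow>
     (\<exists>F. finite F \<and> (\<forall>(u, g)\<in>G. (AE x in lebesgue. g x = z * u x) \<longrightarrow>
        (\<exists>b. AE x in lebesgue. u x = lin_comb id F b x))) \<and>
     (\<forall>p k. (\<forall>j::nat. p j \<in> G) \<and> k \<in> L2 \<and>
        (\<lambda>j. L2_norm (\<lambda>x. snd (p j) x - z * fst (p j) x - k x)) \<longlonglongrightarrow> 0 \<longrightarrow>
        (\<exists>(u, g)\<in>G. AE x in lebesgue. g x - z * u x = k x)) \<and>
     (\<exists>F. finite F \<and> F \<subseteq> L2 \<and> (\<forall>k\<in>L2. \<exists>(u, g)\<in>G. \<exists>b.
        AE x in lebesgue. k x = g x - z * u x + lin_comb id F b x))"

definition essential_spectrum :: "((real^'n \<Rightarrow> complex) \<times> (real^'n \<Rightarrow> complex)) set \<Rightarrow> complex set" where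
  "essential_spectrum G = {z. \<not> fredholm_at G z}"

text \<open>\<open>w\<close> is the system biorthogonal to the basis \<open>u\<close> of eigenfunctions.\<close>

definition schrodinger_riesz ::
    "(real^'n \<Rightarrow> complex) \<Rightarrow> (real^'n \<Rightarrow> complex) set \<Rightarrow> 'i::linorder set \<Rightarrow> ('i \<Rightarrow> complex) \<Rightarrow>
     ('i \<Rightarrow> real^'n \<Rightarrow> complex) \<Rightarrow> ('i \<Rightarrow> real^'n \<Rightarrow> complex) \<Rightarrow> bool" where
  "schrodinger_riesz V D I lam u w \<longleftrightarrow>
     schrodinger_domain V D \<and> countable I \<and>
     essential_spectrum (schrodinger_graph V D) = {} \<and>
     spectrum (schrodinger_graph V D) = lam ` I \<and>
     (\<forall>\<xi>\<in>I. (u \<xi>, \<lambda>x. lam \<xi> * u \<xi> x) \<in> schrodinger_graph V D) \<and>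
     riesz_basis I u \<and> biorthogonal I u w"

text \<open>Eigenvalues of the operator \<open>\<H>\<close>; the shift \<open>c\<close> only enters if 0 is an
  eigenvalue of the Schroedinger operator.\<close>

definition H_eigenvalue :: "real \<Rightarrow> 'i set \<Rightarrow> ('i \<Rightarrow> complex) \<Rightarrow> 'i \<Rightarrow> real" where
  "H_eigenvalue c I lam \<xi> = (if \<exists>\<eta>\<in>I. lam \<eta> = 0 then cmod (lam \<xi>) + c else cmod (lam \<xi>))"

definition japanese :: "('i \<Rightarrow> complex) \<Rightarrow> 'i \<Rightarrow> real" where
  "japanese lam \<xi> = (1 + cmod (lam \<xi>)) powr (1/2)"

definition H_fourier :: "('i \<Rightarrow> real^'n \<Rightarrow> complex) \<Rightarrow> (real^'n \<Rightarrow> complex) \<Rightarrow> 'i \<Rightarrow> complex" where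
  "H_fourier w f \<xi> = L2_inner f (w \<xi>)"


section \<open>Gevrey spaces\<close>

definition gevrey_term ::
    "('i \<Rightarrow> complex) \<Rightarrow> ('i \<Rightarrow> real^'n \<Rightarrow> complex) \<Rightarrow> real \<Rightarrow> real \<Rightarrow> (real^'n \<Rightarrow> complex) \<Rightarrow> 'i \<Rightarrow> real" where
  "gevrey_term lam w s A f \<xi> =
     exp (2 * A * japanese lam \<xi> powr (1 / s)) * (cmod (H_fourier w f \<xi>))\<^sup>2"

definition gevrey_step ::
    "'i set \<Rightarrow> ('i \<Rightarrow> complex) \<Rightarrow> ('i \<Rightarrow> real^'n \<Rightarrow> complex) \<Rightarrow> real \<Rightarrow> real \<Rightarrow> (real^'n \<Rightarrow> complex) set" where
  "gevrey_step I lam w s A = {f \<in> L2. gevrey_term lam w s A f summable_on I}"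

definition gevrey_norm ::
    "'i set \<Rightarrow> ('i \<Rightarrow> complex) \<Rightarrow> ('i \<Rightarrow> real^'n \<Rightarrow> complex) \<Rightarrow> real \<Rightarrow> real \<Rightarrow> (real^'n \<Rightarrow> complex) \<Rightarrow> real" where
  "gevrey_norm I lam w s A f = sqrt (infsum (gevrey_term lam w s A f) I)"

definition gevrey ::
    "'i set \<Rightarrow> ('i \<Rightarrow> complex) \<Rightarrow> ('i \<Rightarrow> real^'n \<Rightarrow> complex) \<Rightarrow> real \<Rightarrow> (real^'n \<Rightarrow> complex) set" where
  "gevrey I lam w s = (\<Union>A\<in>{0<..}. gevrey_step I lam w s A)"

text \<open>Absolutely convex sets meeting every step in a neighbourhood of 0: a base of
  neighbourhoods of 0 in the locally convex inductive limit.\<close>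

definition gevrey_nhd ::
    "'i set \<Rightarrow> ('i \<Rightarrow> complex) \<Rightarrow> ('i \<Rightarrow> real^'n \<Rightarrow> complex) \<Rightarrow> real \<Rightarrow> (real^'n \<Rightarrow> complex) set \<Rightarrow> bool" where
  "gevrey_nhd I lam w s U \<longleftrightarrow> U \<subseteq> gevrey I lam w s \<and>
     (\<forall>g\<in>U. \<forall>h\<in>U. \<forall>b c. cmod b + cmod c \<le> 1 \<longrightarrow> (\<lambda>x. b * g x + c * h x) \<in> U) \<and>
     (\<forall>A>0. \<exists>r>0. \<forall>g\<in>gevrey_step I lam w s A. gevrey_norm I lam w s A g < r \<longrightarrow> g \<in> U)"

definition gevrey_topology ::
    "'i set \<Rightarrow> ('i \<Rightarrow> complex) \<Rightarrow> ('i \<Rightarrow> real^'n \<Rightarrow> complex) \<Rightarrow> real \<Rightarrow> (real^'n \<Rightarrow> complex) topology" where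
  "gevrey_topology I lam w s = topology (\<lambda>W. W \<subseteq> gevrey I lam w s \<and>
     (\<forall>f\<in>W. \<exists>U. gevrey_nhd I lam w s U \<and> (\<forall>g\<in>U. (\<lambda>x. f x + g x) \<in> W)))"

lemma gevrey_nhd_Int:
  assumes U: "gevrey_nhd I lam w s U" and U': "gevrey_nhd I lam w s U'"
  shows "gevrey_nhd I lam w s (U \<inter> U')"
proof -
  have "\<exists>r>0. \<forall>g\<in>gevrey_step I lam w s A. gevrey_norm I lam w s A g < r \<longrightarrow> g \<in> U \<inter> U'"
    if A: "A > 0" for A
  proof -
    obtain r where r: "r > 0"
        "\<forall>g\<in>gevrey_step I lam w s A. gevrey_norm I lam w s A g < r \<longrightarrow> g \<in> U"
      using U A unfolding gevrey_nhd_def by blast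
    obtain r' where r': "r' > 0"
        "\<forall>g\<in>gevrey_step I lam w s A. gevrey_norm I lam w s A g < r' \<longrightarrow> g \<in> U'"
      using U' A unfolding gevrey_nhd_def by blast
    show ?thesis
      by (rule exI[of _ "min r r'"]) (use r r' in auto)
  qed
  then show ?thesis
    using U U' unfolding gevrey_nhd_def by blast
qed

lemma openin_gevrey_topology:
  "openin (gevrey_topology I lam w s) W \<longleftrightarrow> W \<subseteq> gevrey I lam w s \<and>
     (\<forall>f\<in>W. \<exists>U. gevrey_nhd I lam w s U \<and> (\<forall>g\<in>U. (\<lambda>x. f x + g x) \<in> W))"
proof -
  have "istopology (\<lambda>W. W \<subseteq> gevrey I lam w s \<and>
     (\<forall>f\<in>W. \<exists>U. gevrey_nhd I lam w s U \<and> (\<forall>g\<in>U. (\<lambda>x. f x + g x) \<in> W)))"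
    unfolding istopology_def
  proof (intro conjI allI impI)
    fix S T
    assume S: "S \<subseteq> gevrey I lam w s \<and>
        (\<forall>f\<in>S. \<exists>U. gevrey_nhd I lam w s U \<and> (\<forall>g\<in>U. (\<lambda>x. f x + g x) \<in> S))"
      and T: "T \<subseteq> gevrey I lam w s \<and>
        (\<forall>f\<in>T. \<exists>U. gevrey_nhd I lam w s U \<and> (\<forall>g\<in>U. (\<lambda>x. f x + g x) \<in> T))"
    show "S \<inter> T \<subseteq> gevrey I lam w s" using S by blast
    show "\<forall>f\<in>S \<inter> T. \<exists>U. gevrey_nhd I lam w s U \<and> (\<forall>g\<in>U. (\<lambda>x. f x + g x) \<in> S \<inter> T)"
    proof
      fix f assume f: "f \<in> S \<inter> T"
      obtain U where U: "gevrey_nhd I lam w s U" "\<forall>g\<in>U. (\<lambda>x. f x + g x) \<in> S"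
        using S f by blast
      obtain U' where U': "gevrey_nhd I lam w s U'" "\<forall>g\<in>U'. (\<lambda>x. f x + g x) \<in> T"
        using T f by blast
      show "\<exists>U. gevrey_nhd I lam w s U \<and> (\<forall>g\<in>U. (\<lambda>x. f x + g x) \<in> S \<inter> T)"
        by (rule exI[of _ "U \<inter> U'"]) (use U U' gevrey_nhd_Int in blast)
    qed
  next
    fix K
    assume K: "\<forall>S\<in>K. S \<subseteq> gevrey I lam w s \<and>
        (\<forall>f\<in>S. \<exists>U. gevrey_nhd I lam w s U \<and> (\<forall>g\<in>U. (\<lambda>x. f x + g x) \<in> S))"
    show "\<Union>K \<subseteq> gevrey I lam w s" using K by blast
    show "\<forall>f\<in>\<Union>K. \<exists>U. gevrey_nhd I lam w s U \<and> (\<forall>g\<in>U. (\<lambda>x. f x + g x) \<in> \<Union>K)"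
      using K by (meson UnionE UnionI)
  qed
  then show ?thesis unfolding gevrey_topology_def by (simp add: topology_inverse')
qed


section \<open>Functions of time with values in a Gevrey space\<close>

text \<open>\<open>C([0,T]; X)\<close> for a topological space \<open>X\<close>.\<close>

definition C0_into :: "real \<Rightarrow> 'b topology \<Rightarrow> (real \<Rightarrow> 'b) \<Rightarrow> bool" where
  "C0_into T X v \<longleftrightarrow> continuous_map (top_of_set {0..T}) X v"

text \<open>\<open>v'\<close> is a derivative of \<open>v\<close> on \<open>[0,T]\<close>, one-sided at the end points: the difference
  quotients converge in \<open>X\<close>.\<close>

definition deriv_into ::
    "real \<Rightarrow> (real^'n \<Rightarrow> complex) topology \<Rightarrow> (real \<Rightarrow> real^'n \<Rightarrow> complex) \<Rightarrow> (real \<Rightarrow> real^'n \<Rightarrow> complex) \<Rightarrow> bool" where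
  "deriv_into T X v v' \<longleftrightarrow> (\<forall>t\<in>{0..T}.
     limitin X (\<lambda>r x. (v r x - v t x) / complex_of_real (r - t)) (v' t) (at t within {0..T}))"

definition C2_into ::
    "real \<Rightarrow> (real^'n \<Rightarrow> complex) topology \<Rightarrow> (real \<Rightarrow> real^'n \<Rightarrow> complex) \<Rightarrow> bool" where
  "C2_into T X v \<longleftrightarrow> (\<exists>v' v''. C0_into T X v \<and> C0_into T X v' \<and> C0_into T X v'' \<and>
     deriv_into T X v v' \<and> deriv_into T X v' v'')"

text \<open>\<open>W\<^sup>2\<^sup>,\<^sup>\<infinity>([0,T]; \<gamma>\<^sup>s)\<close>, that is, \<open>C\<^sup>1\<close> with Lipschitz continuous time derivative. With a
  discontinuous coefficient \<open>q \<in> L\<^sup>\<infinity>\<close> the second time derivative of a solution, being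
  \<open>f - a \<H> v - q v\<close>, exists only almost everywhere and has no continuous representative in
  general, so this is then the regularity one can have.\<close>

definition gevrey_W2inf ::
    "'i set \<Rightarrow> ('i \<Rightarrow> complex) \<Rightarrow> ('i \<Rightarrow> real^'n \<Rightarrow> complex) \<Rightarrow> real \<Rightarrow> real \<Rightarrow> (real \<Rightarrow> real^'n \<Rightarrow> complex) \<Rightarrow> bool" where
  "gevrey_W2inf I lam w s T v \<longleftrightarrow> (\<exists>v'.
     C0_into T (gevrey_topology I lam w s) v \<and> C0_into T (gevrey_topology I lam w s) v' \<and>
     deriv_into T (gevrey_topology I lam w s) v v' \<and>
     (\<exists>A>0. \<exists>L. \<forall>t\<in>{0..T}. \<forall>r\<in>{0..T}.
        (\<lambda>x. v' t x - v' r x) \<in> gevrey_step I lam w s A \<and>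
        gevrey_norm I lam w s A (\<lambda>x. v' t x - v' r x) \<le> L * \<bar>t - r\<bar>))"


section \<open>The Cauchy problem\<close>

definition holder_on :: "real \<Rightarrow> real \<Rightarrow> (real \<Rightarrow> real) \<Rightarrow> bool" where
  "holder_on \<beta> T a \<longleftrightarrow> (\<exists>M>0. \<forall>t\<in>{0..T}. \<forall>t'\<in>{0..T}. \<bar>a t - a t'\<bar> \<le> M * \<bar>t - t'\<bar> powr \<beta>)"

definition C_alpha :: "real \<Rightarrow> real \<Rightarrow> (real \<Rightarrow> real) \<Rightarrow> bool" where
  "C_alpha \<alpha> T a \<longleftrightarrow>
     (if \<alpha> \<le> 1 then holder_on \<alpha> T a
      else (\<exists>a'. (\<forall>t\<in>{0..T}. (a has_real_derivative a' t) (at t within {0..T})) \<and>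
                 continuous_on {0..T} a' \<and> holder_on (\<alpha> - 1) T a'))"

definition L_infinity :: "real \<Rightarrow> (real \<Rightarrow> real) \<Rightarrow> bool" where
  "L_infinity T q \<longleftrightarrow> q \<in> borel_measurable (lebesgue_on {0..T}) \<and>
     (\<exists>M. AE t in lebesgue_on {0..T}. \<bar>q t\<bar> \<le> M)"

definition has_continuous_representative :: "real \<Rightarrow> (real \<Rightarrow> real) \<Rightarrow> bool" where
  "has_continuous_representative T q \<longleftrightarrow>
     (\<exists>p. continuous_on {0..T} p \<and> (AE t in lebesgue_on {0..T}. q t = p t))"

text \<open>The Fourier transformed Cauchy problem. As \<open>q\<close> is only determined almost everywhere,
  the equation is required for almost every \<open>t\<close>; \<open>y1\<close> is the first time derivative of the
  Fourier coefficient.\<close>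

definition solves_cauchy ::
    "'i set \<Rightarrow> ('i \<Rightarrow> real) \<Rightarrow> ('i \<Rightarrow> real^'n \<Rightarrow> complex) \<Rightarrow> real \<Rightarrow> (real \<Rightarrow> real) \<Rightarrow> (real \<Rightarrow> real) \<Rightarrow>
     (real \<Rightarrow> real^'n \<Rightarrow> complex) \<Rightarrow> (real^'n \<Rightarrow> complex) \<Rightarrow> (real^'n \<Rightarrow> complex) \<Rightarrow>
     (real \<Rightarrow> real^'n \<Rightarrow> complex) \<Rightarrow> bool" where
  "solves_cauchy I mu w T a q f v0 v1 v \<longleftrightarrow> (\<forall>\<xi>\<in>I. \<exists>y1.
     (\<forall>t\<in>{0..T}. ((\<lambda>r. H_fourier w (v r) \<xi>) has_vector_derivative y1 t) (at t within {0..T})) \<and>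
     H_fourier w (v 0) \<xi> = H_fourier w v0 \<xi> \<and> y1 0 = H_fourier w v1 \<xi> \<and>
     (AE t in lebesgue_on {0..T}. \<exists>y2. (y1 has_vector_derivative y2) (at t within {0..T}) \<and>
        y2 + complex_of_real (a t * mu \<xi>) * H_fourier w (v t) \<xi>
           + complex_of_real (q t) * H_fourier w (v t) \<xi> = H_fourier w (f t) \<xi>))"

end

theory Submission
  imports Defs
begin

text \<open>Pairing with the biorthogonal system turns the Cauchy problem into one scalar equation
\<open>y'' + a \<mu> y + q y = f\<close> for each Fourier coefficient, where \<open>\<mu>\<close> is at most a multiple of
\<open>J\<^sup>2\<close> with \<open>J = \<langle>\<xi>\<rangle>\<close>. What has to be shown is that solutions of these equations lose at most a
factor \<open>exp (K * J powr \<theta>)\<close> with \<open>\<theta> = 2 / (2 + \<alpha>)\<close>. The hypothesis \<open>s < 1 + \<alpha> / 2\<close> says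
exactly \<open>\<theta> < 1 / s\<close>, so this loss is absorbed by an arbitrarily small decrease of the constant
\<open>A\<close> in the Gevrey weight \<open>exp (2 * A * J powr (1 / s))\<close>.

The growth bound comes from an energy. The natural energy degenerates at the zeros of \<open>a\<close>, so \<open>a\<close> is
replaced in it by a regularization \<open>b\<close> at scale \<open>\<epsilon>\<close> (\<open>regularize_C_alpha\<close>) whose error is
\<open>\<bar>a - b\<bar> \<le> C * \<epsilon> powr (\<alpha> / 2) * sqrt b\<close> while the integral of \<open>\<bar>b'\<bar> / b\<close> is at most a multiple of
\<open>1 / \<epsilon>\<close>. The energy \<open>\<bar>z\<bar>\<^sup>2 + (\<mu> b + 1) \<bar>y\<bar>\<^sup>2\<close> then grows by a factor whose logarithm is of
order \<open>1 / \<epsilon> + \<epsilon> powr (\<alpha> / 2) * sqrt \<mu>\<close> (\<open>energy_estimate\<close>), and \<open>\<epsilon> = J powr (- \<theta>)\<close> balances the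
two terms at \<open>J powr \<theta>\<close> (\<open>coefficient_growth\<close>).

The potential \<open>q\<close> is merely bounded and measurable. With \<open>Q\<close> a primitive of \<open>q\<close>, the quasi-derivative
\<open>z = y' + Q y\<close> turns the equation into the system
\<open>y' = z - Q y\<close>, \<open>z' = f - a \<mu> y + Q z - Q\<^sup>2 y\<close>, which has continuous coefficients and hence
classical solutions. The original equation is recovered where \<open>Q' = q\<close>, that is, almost
everywhere by Lebesgue's differentiation theorem (\<open>bounded_AE_deriv_primitive\<close>), and everywhere if
\<open>q\<close> is continuous. For uniqueness the derivative of a coefficient is Lipschitz continuous, and
a Lipschitz function whose derivative is nonpositive almost everywhere decreases.

The inductive limit topology of the Gevrey space enters through a description by seminorms: it is
generated by the weighted \<open>l\<^sup>2\<close> norms of the coefficients, for the weights that are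
dominated by a multiple of every Gevrey weight (\<open>weighted_ball_nhd\<close> and \<open>nhd_contains_weighted_ball\<close>). This makes continuity and
differentiability in time a matter of weighted sums, and it shows that a continuous function on
\<open>[0,T]\<close> is bounded in a single step of the scale (\<open>C0_into_bounded_in_step\<close>), as the summation of
the energy estimates requires of the right-hand side \<open>f\<close>. Coefficient sequences are turned back
into functions by the Riesz-Fischer theorem for the Riesz basis (\<open>riesz_fischer\<close>).\<close>

section \<open>Mean values, Lipschitz functions and primitives of bounded functions\<close>

lemma mvt_closed_segment:
  fixes F :: "real \<Rightarrow> real"
  assumes d: "\<And>t. t \<in> {a..b} \<Longrightarrow> (F has_real_derivative F' t) (at t within {a..b})"
    and tr: "t \<in> {a..b}" "r \<in> {a..b}"
  shows "\<exists>z \<in> closed_segment t r. F r - F t = F' z * (r - t)"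
proof (cases "t = r")
  case False
  have "\<exists>z\<in>{min t r<..<max t r}. F (max t r) - F (min t r) = F' z * (max t r - min t r)"
  proof (rule mvt_simple)
    show "(F has_derivative (*) (F' x)) (at x within {min t r..max t r})" if "min t r \<le> x" "x \<le> max t r" for x
    proof -
      have "x \<in> {a..b}" "{min t r..max t r} \<subseteq> {a..b}" using that tr by auto
      then show ?thesis using DERIV_subset[OF d[of x], of "{min t r..max t r}"] by (simp add: has_field_derivative_def)
    qed
  qed (use False in auto)
  then obtain z where "z \<in> {min t r<..<max t r}" "F (max t r) - F (min t r) = F' z * (max t r - min t r)" by blast
  then show ?thesis
    by (intro bexI[of _ z]) (auto simp: closed_segment_eq_real_ivl min_def max_def algebra_simps split: if_splits)
qed auto

lemma closed_segment_within:
  fixes z :: real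
  assumes "z \<in> closed_segment t r" "t \<in> {a..b}" "r \<in> {a..b}"
  shows "z \<in> {a..b}" "\<bar>z - t\<bar> \<le> \<bar>r - t\<bar>"
  using assms by (auto simp: closed_segment_eq_real_ivl split: if_splits)

text \<open>A mean value inequality for vectors with a weighted Euclidean norm, at one common intermediate
point: the increment is tested against itself, which leaves a real function, and the inequality
\<open>2 x y \<le> x\<^sup>2 + y\<^sup>2\<close> absorbs half of the left-hand side. Weighted sums of squared increments are
thereby bounded without integrating vector valued functions.\<close>

lemma weighted_mean_value:
  fixes Y Y' :: "'i \<Rightarrow> real \<Rightarrow> complex" and \<omega> :: "'i \<Rightarrow> real"
  assumes \<omega>: "\<And>\<xi>. \<xi> \<in> F \<Longrightarrow> 0 \<le> \<omega> \<xi>"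
    and d: "\<And>\<xi> \<tau>. \<xi> \<in> F \<Longrightarrow> \<tau> \<in> {a..b} \<Longrightarrow> (Y \<xi> has_vector_derivative Y' \<xi> \<tau>) (at \<tau> within {a..b})"
    and tr: "t \<in> {a..b}" "r \<in> {a..b}"
  obtains z where "z \<in> closed_segment t r"
    "(\<Sum>\<xi>\<in>F. \<omega> \<xi> * (cmod (Y \<xi> r - Y \<xi> t))\<^sup>2) \<le> (r - t)\<^sup>2 * (\<Sum>\<xi>\<in>F. \<omega> \<xi> * (cmod (Y' \<xi> z))\<^sup>2)"
proof -
  define E where "E \<xi> = Y \<xi> r - Y \<xi> t" for \<xi>
  define S where "S = (\<Sum>\<xi>\<in>F. \<omega> \<xi> * (cmod (E \<xi>))\<^sup>2)"
  \<comment> \<open>testing against the increment \<open>E\<close> itself reduces the claim to the scalar mean value theorem\<close>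
  define H where "H \<tau> = (\<Sum>\<xi>\<in>F. \<omega> \<xi> * Re (cnj (E \<xi>) * Y \<xi> \<tau>))" for \<tau>
  define H' where "H' \<tau> = (\<Sum>\<xi>\<in>F. \<omega> \<xi> * Re (cnj (E \<xi>) * Y' \<xi> \<tau>))" for \<tau>
  have "(H has_real_derivative H' \<tau>) (at \<tau> within {a..b})" if \<tau>: "\<tau> \<in> {a..b}" for \<tau>
    unfolding H_def H'_def
  proof (intro DERIV_sum DERIV_cmult)
    fix \<xi> assume "\<xi> \<in> F"
    then have "((\<lambda>\<tau>. cnj (E \<xi>) * Y \<xi> \<tau>) has_vector_derivative cnj (E \<xi>) * Y' \<xi> \<tau>) (at \<tau> within {a..b})"
      by (intro has_vector_derivative_mult_right d \<tau>)
    then show "((\<lambda>\<tau>. Re (cnj (E \<xi>) * Y \<xi> \<tau>)) has_real_derivative Re (cnj (E \<xi>) * Y' \<xi> \<tau>)) (at \<tau> within {a..b})"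
      unfolding has_vector_derivative_complex_iff by (rule conjunct1)
  qed
  then obtain z where z: "z \<in> closed_segment t r" "H r - H t = H' z * (r - t)"
    using mvt_closed_segment[of a b H H' t r] tr by auto
  have "H r - H t = S"
    unfolding H_def S_def sum_subtractf[symmetric]
  proof (rule sum.cong[OF refl])
    fix \<xi>
    have "Re (cnj (E \<xi>) * Y \<xi> r) - Re (cnj (E \<xi>) * Y \<xi> t) = Re (cnj (E \<xi>) * E \<xi>)"
      by (simp add: E_def algebra_simps)
    also have "\<dots> = (cmod (E \<xi>))\<^sup>2" unfolding cmod_power2 by (simp add: power2_eq_square)
    finally show "\<omega> \<xi> * Re (cnj (E \<xi>) * Y \<xi> r) - \<omega> \<xi> * Re (cnj (E \<xi>) * Y \<xi> t) = \<omega> \<xi> * (cmod (E \<xi>))\<^sup>2"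
      by (simp add: right_diff_distrib[symmetric])
  qed
  then have "S = H' z * (r - t)" using z(2) by simp
  also have "\<dots> \<le> (\<Sum>\<xi>\<in>F. (\<omega> \<xi> * (cmod (E \<xi>))\<^sup>2 + (r - t)\<^sup>2 * (\<omega> \<xi> * (cmod (Y' \<xi> z))\<^sup>2)) / 2)"
    unfolding H'_def sum_distrib_right
  proof (rule sum_mono)
    fix \<xi> assume "\<xi> \<in> F"
    then have pos: "0 \<le> \<omega> \<xi>" by (rule \<omega>)
    have "Re (cnj (E \<xi>) * Y' \<xi> z) * (r - t) \<le> \<bar>Re (cnj (E \<xi>) * Y' \<xi> z)\<bar> * \<bar>r - t\<bar>" by (metis abs_ge_self abs_mult)
    also have "\<dots> \<le> (cmod (E \<xi>) * cmod (Y' \<xi> z)) * \<bar>r - t\<bar>"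
      by (intro mult_right_mono) (metis abs_Re_le_cmod complex_mod_cnj norm_mult, simp)
    also have "\<dots> \<le> ((cmod (E \<xi>))\<^sup>2 + (r - t)\<^sup>2 * (cmod (Y' \<xi> z))\<^sup>2) / 2"
      using sum_squares_bound[of "cmod (E \<xi>)" "\<bar>r - t\<bar> * cmod (Y' \<xi> z)"] by (simp add: power_mult_distrib mult_ac)
    finally have "\<omega> \<xi> * (Re (cnj (E \<xi>) * Y' \<xi> z) * (r - t)) \<le> \<omega> \<xi> * (((cmod (E \<xi>))\<^sup>2 + (r - t)\<^sup>2 * (cmod (Y' \<xi> z))\<^sup>2) / 2)"
      using pos by (rule mult_left_mono)
    then show "\<omega> \<xi> * Re (cnj (E \<xi>) * Y' \<xi> z) * (r - t) \<le> (\<omega> \<xi> * (cmod (E \<xi>))\<^sup>2 + (r - t)\<^sup>2 * (\<omega> \<xi> * (cmod (Y' \<xi> z))\<^sup>2)) / 2"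
      by (simp add: distrib_left mult_ac)
  qed
  also have "\<dots> = (S + (r - t)\<^sup>2 * (\<Sum>\<xi>\<in>F. \<omega> \<xi> * (cmod (Y' \<xi> z))\<^sup>2)) / 2"
    by (simp add: S_def sum.distrib sum_divide_distrib[symmetric] sum_distrib_left)
  finally show thesis using z(1) by (intro that[of z]) (simp_all add: S_def E_def)
qed

text \<open>If \<open>\<phi>\<close> increased, then after subtracting a small linear function it would still increase, but with
negative derivative off \<open>N\<close>. Each level between the end values is left for the last time at a point
where the derivative cannot be negative, hence at a point of \<open>N\<close>. So the Lipschitz image of the null
set \<open>N\<close> would contain an interval.\<close>

lemma lipschitz_AE_deriv_nonpos_imp_decreasing:
  fixes \<phi> :: "real \<Rightarrow> real"
  assumes lip: "\<And>x y. x \<in> {a..b} \<Longrightarrow> y \<in> {a..b} \<Longrightarrow> \<bar>\<phi> x - \<phi> y\<bar> \<le> L * \<bar>x - y\<bar>"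
    and N: "negligible N"
    and der: "\<And>t. t \<in> {a..b} - N \<Longrightarrow> \<exists>d\<le>0. (\<phi> has_real_derivative d) (at t within {a..b})"
    and ab: "a \<le> b"
  shows "\<phi> b \<le> \<phi> a"
proof (rule ccontr)
  assume "\<not> \<phi> b \<le> \<phi> a"
  then have less: "\<phi> a < \<phi> b" by simp
  then have "a < b" using ab by (cases "a = b") auto
  \<comment> \<open>half of the mean slope, so that the tilted function \<open>\<psi>\<close> still increases\<close>
  define e where "e = (\<phi> b - \<phi> a) / (2 * (b - a))"
  have e: "e > 0" using less \<open>a < b\<close> by (simp add: e_def)
  define \<psi> where "\<psi> t = \<phi> t - e * (t - a)" for t
  have "e * (b - a) = (\<phi> b - \<phi> a) / 2" using \<open>a < b\<close> by (simp add: e_def divide_simps)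
  then have psi: "\<psi> a < \<psi> b" using less by (simp add: \<psi>_def)
  have lip': "\<bar>\<psi> x - \<psi> y\<bar> \<le> (L + e) * \<bar>x - y\<bar>" if "x \<in> {a..b}" "y \<in> {a..b}" for x y
  proof -
    have "\<psi> x - \<psi> y = (\<phi> x - \<phi> y) - e * (x - y)" by (simp add: \<psi>_def algebra_simps)
    then have "\<bar>\<psi> x - \<psi> y\<bar> \<le> \<bar>\<phi> x - \<phi> y\<bar> + \<bar>e * (x - y)\<bar>" by linarith
    also have "\<dots> \<le> L * \<bar>x - y\<bar> + e * \<bar>x - y\<bar>" using lip[OF that] e by (simp add: abs_mult)
    finally show ?thesis by (simp add: algebra_simps)
  qed
  have "negligible (\<psi> ` (N \<inter> {a..b}))"
  proof (rule negligible_locally_Lipschitz_image)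
    show "negligible (N \<inter> {a..b})" using N by (simp add: negligible_Int)
    fix x assume "x \<in> N \<inter> {a..b}"
    then show "\<exists>T B. open T \<and> x \<in> T \<and> (\<forall>y\<in>N \<inter> {a..b} \<inter> T. norm (\<psi> y - \<psi> x) \<le> B * norm (y - x))"
      by (intro exI[of _ UNIV] exI[of _ "L + e"]) (use lip' in auto)
  qed simp
  moreover have "{\<psi> a<..<\<psi> b} \<subseteq> \<psi> ` (N \<inter> {a..b})"
  proof
    fix c assume c: "c \<in> {\<psi> a<..<\<psi> b}"
    have cont: "continuous_on {a..b} \<psi>"
    proof (rule continuous_onI)
      fix x \<epsilon> :: real assume x: "x \<in> {a..b}" and "\<epsilon> > 0"
      have pos: "0 \<le> (L + e)" using lip'[of a b] \<open>a < b\<close> psi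
        by (smt (verit, best) atLeastAtMost_iff mult_nonneg_nonpos2 ab zero_le_mult_iff)
      show "\<exists>d>0. \<forall>x'\<in>{a..b}. dist x' x < d \<longrightarrow> dist (\<psi> x') (\<psi> x) \<le> \<epsilon>"
      proof (intro exI[of _ "\<epsilon> / (L + e + 1)"] conjI ballI impI)
        fix x' assume x': "x' \<in> {a..b}" "dist x' x < \<epsilon> / (L + e + 1)"
        have "dist (\<psi> x') (\<psi> x) \<le> (L + e) * dist x' x" using lip'[OF x'(1) x] by (simp add: dist_real_def)
        also have "\<dots> \<le> (L + e + 1) * dist x' x" by (simp add: algebra_simps)
        also have "\<dots> \<le> (L + e + 1) * (\<epsilon> / (L + e + 1))" using x'(2) pos by (intro mult_left_mono) auto
        also have "\<dots> = \<epsilon>" using pos by simp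
        finally show "dist (\<psi> x') (\<psi> x) \<le> \<epsilon>" .
      qed (use \<open>\<epsilon> > 0\<close> pos in auto)
    qed
    \<comment> \<open>the last time at which the level \<open>c\<close> is not exceeded\<close>
    define S where "S = {x \<in> {a..b}. \<psi> x \<le> c}"
    have "closed S" unfolding S_def
      by (rule continuous_on_closed_Collect_le[OF cont continuous_on_const]) simp
    then have cS: "compact S" unfolding compact_eq_bounded_closed
      using bounded_subset[OF bounded_closed_interval[of a b], of S] by (force simp: S_def)
    have "a \<in> S" using c ab by (auto simp: S_def)
    obtain x where x: "x \<in> S" "\<And>y. y \<in> S \<Longrightarrow> y \<le> x"
      using compact_attains_sup[OF cS] \<open>a \<in> S\<close> by blast
    have xab: "x \<in> {a..b}" "\<psi> x \<le> c" using x by (auto simp: S_def)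
    have xb: "x < b" using xab c by (cases "x = b") auto
    have above: "\<psi> y > c" if "x < y" "y \<le> b" for y
      proof (rule ccontr)
      assume "\<not> \<psi> y > c"
      then have "y \<in> S" using that xab by (auto simp: S_def)
      then show False using x(2)[of y] that by simp
    qed
    have "\<psi> x = c"
    proof (rule ccontr)
      assume "\<psi> x \<noteq> c"
      then have "\<psi> x \<le> c" "c \<le> \<psi> b" "x \<le> b" using xab c xb by auto
      then obtain y where "x \<le> y" "y \<le> b" "\<psi> y = c"
        using IVT'[of \<psi> x c b] continuous_on_subset[OF cont, of "{x..b}"] xab by auto
      then show False using above[of y] \<open>\<psi> x \<noteq> c\<close> by (cases "y = x") auto
    qed
    moreover have "x \<in> N"
    proof (rule ccontr)
      assume "x \<notin> N"
      then obtain d where d: "d \<le> 0" "(\<phi> has_real_derivative d) (at x within {a..b})"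
        using der[of x] xab by auto
      have "(\<psi> has_real_derivative d - e) (at x within {a..b})"
        unfolding \<psi>_def by (auto intro!: derivative_eq_intros d)
      then have "(\<psi> has_real_derivative d - e) (at x within {x..b})"
        by (rule DERIV_subset) (use xab in auto)
      then obtain \<delta> where \<delta>: "\<delta> > 0" "\<And>h. h > 0 \<Longrightarrow> x + h \<in> {x..b} \<Longrightarrow> h < \<delta> \<Longrightarrow> \<psi> (x + h) < \<psi> x"
        using has_real_derivative_neg_dec_right[of \<psi> "d - e" x "{x..b}"] d e by auto
      define h where "h = min (\<delta> / 2) (b - x)"
      have "\<psi> (x + h) < \<psi> x" using \<delta> xb by (intro \<delta>(2)) (auto simp: h_def min_def)
      moreover have "\<psi> (x + h) > c" using \<delta> xb by (intro above) (auto simp: h_def min_def)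
      ultimately show False using \<open>\<psi> x = c\<close> by simp
    qed
    ultimately show "c \<in> \<psi> ` (N \<inter> {a..b})" using xab by auto
  qed
  ultimately have "negligible {\<psi> a<..<\<psi> b}" using negligible_subset by blast
  then show False using psi open_not_negligible[of "{\<psi> a<..<\<psi> b}"] by auto
qed

text \<open>This is the core of Lebesgue's differentiation theorem. Vitali's theorem covers the set, up to a
null set, by disjoint intervals inside an open set that exceeds \<open>{q < \<alpha>}\<close> by little. Over their
union the integral of \<open>q\<close> is at least \<open>\<beta>\<close> times its measure, but at most \<open>\<alpha>\<close> times its measure plus a
small error, so the measure of the union is small.\<close>

lemma negligible_low_value_high_mean:
  fixes q :: "real \<Rightarrow> real"
  assumes q: "integrable lebesgue q" and M: "\<And>x. \<bar>q x\<bar> \<le> M" and ab: "\<alpha> < \<beta>"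
  shows "negligible {x \<in> {-R<..<R}. q x < \<alpha> \<and>
    (\<forall>d>0. \<exists>c r. 0 < r \<and> r < d \<and> x \<in> cball c r \<and> \<beta> * (2 * r) \<le> (LINT y:cball c r|lebesgue. q y))}"
    (is "negligible ?E")
  unfolding negligible_outer_le
proof (intro allI impI)
  fix e :: real assume e: "e > 0"
  have M0: "M \<ge> 0" using M[of 0] by linarith
  \<comment> \<open>the excess of the open set that makes the final bound equal to \<open>e\<close>\<close>
  define \<delta> where "\<delta> = e * (\<beta> - \<alpha>) / (M + \<bar>\<alpha>\<bar> + 1)"
  have \<delta>: "\<delta> > 0" using e ab M0 by (simp add: \<delta>_def)
  have qm: "q \<in> borel_measurable lebesgue" using q by auto
  define A where "A = {x \<in> {-R<..<R}. q x < \<alpha>}"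
  have Am: "A \<in> sets lebesgue"
  proof -
    have "A = {-R<..<R} \<inter> {x \<in> space lebesgue. q x < \<alpha>}" by (auto simp: A_def)
    moreover have "{x \<in> space lebesgue. q x < \<alpha>} \<in> sets lebesgue" using qm by measurable
    ultimately show ?thesis by auto
  qed
  obtain T where T: "open T" "A \<subseteq> T" "T - A \<in> lmeasurable" "emeasure lebesgue (T - A) < ennreal \<delta>"
    using sets_lebesgue_outer_open[OF Am \<delta>] by blast
  have TA: "measure lebesgue (T - A) \<le> \<delta>"
    using T \<delta> by (metis emeasure_eq_measure2 ennreal_le_iff less_imp_le)
  define G where "G = T \<inter> {-R<..<R}"
  have G: "open G" "A \<subseteq> G" "G - A \<subseteq> T - A" using T(1,2) by (auto simp: G_def A_def)
  define K where "K = {(c,r). 0 < r \<and> cball c r \<subseteq> G \<and> \<beta> * (2 * r) \<le> (LINT y:cball c r|lebesgue. q y)}"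
  obtain C where C: "countable C" "C \<subseteq> K"
     "pairwise (\<lambda>i j. disjnt (cball (fst i) (snd i)) (cball (fst j) (snd j))) C"
     "negligible (?E - (\<Union>i \<in> C. cball (fst i) (snd i)))"
  proof (rule Vitali_covering_theorem_cballs[of K snd ?E fst])
    fix x d :: real assume x: "x \<in> ?E" and d: "0 < d"
    then have "x \<in> G" using G by (auto simp: A_def)
    then obtain \<rho> where \<rho>: "\<rho> > 0" "ball x \<rho> \<subseteq> G" using G(1) openE by blast
    obtain c r where cr: "0 < r" "r < min d (\<rho> / 2)" "x \<in> cball c r" "\<beta> * (2 * r) \<le> (LINT y:cball c r|lebesgue. q y)"
    proof -
      have "0 < min d (\<rho> / 2)" using d \<rho>(1) by simp
      have "\<forall>d>0. \<exists>c r. 0 < r \<and> r < d \<and> x \<in> cball c r \<and> \<beta> * (2 * r) \<le> (LINT y:cball c r|lebesgue. q y)"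
        using x unfolding mem_Collect_eq by (elim conjE)
      note this[rule_format, OF \<open>0 < min d (\<rho> / 2)\<close>]
      then show thesis using that by (elim exE conjE)
    qed
    have "cball c r \<subseteq> ball x \<rho>"
    proof
      fix y assume "y \<in> cball c r"
      then have "dist c y \<le> r" "dist c x \<le> r" using cr by auto
      then have "dist x y < \<rho>" using dist_triangle3[of x y c] cr by linarith
      then show "y \<in> ball x \<rho>" by simp
    qed
    then have "cball c r \<subseteq> G" using \<rho>(2) by (rule order_trans)
    then have "(c, r) \<in> K" using cr by (simp add: K_def)
    then show "\<exists>i. i \<in> K \<and> x \<in> cball (fst i) (snd i) \<and> snd i < d"
      using cr by (intro exI[of _ "(c,r)"]) simp
  next
    show "0 < snd i" if "i \<in> K" for i using that by (auto simp: K_def)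
  qed (rule that)
  let ?B = "\<lambda>i::real\<times>real. cball (fst i) (snd i)"
  let ?U = "\<Union>i\<in>C. ?B i"
  have fin: "measure lebesgue (\<Union>(?B ` D)) \<le> e" if D: "D \<subseteq> C" "finite D" for D
  proof -
    let ?V = "\<Union>i\<in>D. ?B i"
    have disj: "disjoint_family_on ?B D"
      using pairwise_subset[OF C(3) D(1)] by (auto simp: disjoint_family_on_def pairwise_def disjnt_def)
    have VG: "?V \<subseteq> G"
    proof (rule UN_least)
      fix i assume "i \<in> D"
      then have "i \<in> K" using D C by auto
      then show "?B i \<subseteq> G" by (cases i) (simp add: K_def)
    qed
    have Vm: "?V \<in> lmeasurable" using D by (intro fmeasurable.finite_UN) auto
    have si: "set_integrable lebesgue X q" if "X \<in> sets lebesgue" for X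
      using integrable_mult_indicator[OF that q] by (simp add: set_integrable_def)
    have sc: "set_integrable lebesgue X (\<lambda>_. k)" if "X \<in> lmeasurable" for X and k :: real
      using that by (simp add: set_integrable_def lmeasurable_iff_integrable)
    have "\<beta> * measure lebesgue ?V = \<beta> * (\<Sum>i\<in>D. measure lebesgue (?B i))"
      using D disj by (subst measure_finite_Union) (use fmeasurableD2[OF lmeasurable_cball] in auto)
    also have "\<dots> = (\<Sum>i\<in>D. \<beta> * measure lebesgue (?B i))" by (simp add: sum_distrib_left)
    also have "\<dots> \<le> (\<Sum>i\<in>D. LINT y:?B i|lebesgue. q y)"
    proof (rule sum_mono)
      fix i assume "i \<in> D"
      then have i: "i \<in> K" using D C by auto
      then have "measure lebesgue (?B i) = 2 * snd i"
        by (cases i) (auto simp: K_def cball_eq_atLeastAtMost)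
      then show "\<beta> * measure lebesgue (?B i) \<le> (LINT y:?B i|lebesgue. q y)"
        using i by (cases i) (auto simp: K_def)
    qed
    also have "\<dots> = (LINT y:?V|lebesgue. q y)"
      using D disj si by (intro set_integral_finite_Union[symmetric]) auto
    also have "\<dots> = (LINT y:(?V \<inter> A)|lebesgue. q y) + (LINT y:(?V - A)|lebesgue. q y)"
    proof -
      have "?V = (?V \<inter> A) \<union> (?V - A)" "(?V \<inter> A) \<inter> (?V - A) = {}" by auto
      moreover have "?V \<inter> A \<in> sets lebesgue" "?V - A \<in> sets lebesgue" using Am fmeasurableD[OF Vm] by auto
      ultimately show ?thesis
        using set_integral_Un[of "?V \<inter> A" "?V - A" lebesgue q] si by simp
    qed
    also have "\<dots> \<le> \<alpha> * measure lebesgue (?V \<inter> A) + M * measure lebesgue (?V - A)"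
    proof (rule add_mono)
      have VA: "?V \<inter> A \<in> lmeasurable" using Vm Am by (simp add: fmeasurable_Int_fmeasurable)
      have "(LINT y:(?V \<inter> A)|lebesgue. q y) \<le> (LINT y:(?V \<inter> A)|lebesgue. \<alpha>)"
        using si sc VA by (intro set_integral_mono) (auto simp: A_def)
      also have "\<dots> = \<alpha> * measure lebesgue (?V \<inter> A)" using VA
        by (simp add: set_lebesgue_integral_def fmeasurableD)
      finally show "(LINT y:(?V \<inter> A)|lebesgue. q y) \<le> \<alpha> * measure lebesgue (?V \<inter> A)" .
      have VA: "?V - A \<in> lmeasurable" using Vm Am by (simp add: fmeasurable_Diff)
      have "(LINT y:(?V - A)|lebesgue. q y) \<le> (LINT y:(?V - A)|lebesgue. M)"
        using si sc VA M by (intro set_integral_mono) (auto simp: abs_le_iff)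
      also have "\<dots> = M * measure lebesgue (?V - A)" using VA
        by (simp add: set_lebesgue_integral_def fmeasurableD)
      finally show "(LINT y:(?V - A)|lebesgue. q y) \<le> M * measure lebesgue (?V - A)" .
    qed
    finally have 1: "\<beta> * measure lebesgue ?V \<le> \<alpha> * measure lebesgue (?V \<inter> A) + M * measure lebesgue (?V - A)" .
    have 2: "measure lebesgue ?V = measure lebesgue (?V \<inter> A) + measure lebesgue (?V - A)"
    proof -
      have "?V \<inter> A \<union> (?V - A) = ?V" "(?V - A) - (?V \<inter> A) = ?V - A" by auto
      then show ?thesis using measure_Un2[of "?V \<inter> A" lebesgue "?V - A"] Vm Am
        by (simp only: fmeasurable_Int_fmeasurable fmeasurable_Diff)
    qed
    have 3: "measure lebesgue (?V - A) \<le> \<delta>"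
    proof -
      have "?V - A \<subseteq> T - A" using VG G by blast
      then have "measure lebesgue (?V - A) \<le> measure lebesgue (T - A)"
        using T(3) Vm Am by (intro measure_mono_fmeasurable) (auto simp: fmeasurableD)
      then show ?thesis using TA by linarith
    qed
    have "(\<beta> - \<alpha>) * measure lebesgue ?V \<le> (M - \<alpha>) * measure lebesgue (?V - A)"
      using 1 unfolding 2 by (simp add: algebra_simps)
    also have "\<dots> \<le> (M + \<bar>\<alpha>\<bar> + 1) * measure lebesgue (?V - A)" by (intro mult_right_mono) auto
    also have "\<dots> \<le> (M + \<bar>\<alpha>\<bar> + 1) * \<delta>" using 3 M0 by (intro mult_left_mono) auto
    also have "\<dots> = (\<beta> - \<alpha>) * e" using M0 by (simp add: \<delta>_def)
    finally show ?thesis using ab by simp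
  qed
  have "?U \<in> lmeasurable \<and> measure lebesgue ?U \<le> e"
    using fmeasurable_UN_bound[of C ?B lebesgue e] measure_UN_bound[of C ?B lebesgue e] C(1) fin by auto
  moreover have "?E - ?U \<in> null_sets lebesgue" using C(4) by (simp add: negligible_iff_null_sets)
  ultimately have "?U \<union> (?E - ?U) \<in> lmeasurable" "measure lebesgue (?U \<union> (?E - ?U)) \<le> e"
    using measure_Un_null_set[of ?U lebesgue "?E - ?U"] fmeasurable.Un[OF _ fmeasurableI_null_sets, of ?U lebesgue "?E - ?U"]
    by (simp_all only: fmeasurableD)
  moreover have "?E \<subseteq> ?U \<union> (?E - ?U)" by (simp only: Un_Diff_cancel Un_upper2)
  ultimately show "\<exists>S. ?E \<subseteq> S \<and> S \<in> lmeasurable \<and> measure lebesgue S \<le> e" by (intro exI conjI)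
qed

definition primitive :: "(real \<Rightarrow> real) \<Rightarrow> real \<Rightarrow> real" where
  "primitive q t = (LINT y:{0..t}|lebesgue. q y)"

lemma primitive_zero: "primitive q 0 = 0"
proof -
  have "AE y in lebesgue. y \<noteq> (0::real)" by (rule AE_completion) (simp add: AE_lborel_singleton)
  then have "AE y in lebesgue. indicat_real {0..0} y *\<^sub>R q y = 0" by eventually_elim (simp split: split_indicator)
  then show ?thesis unfolding primitive_def set_lebesgue_integral_def by (rule integral_eq_zero_AE)
qed

lemma primitive_diff:
  assumes q: "integrable lebesgue q" and yz: "0 \<le> y" "y \<le> z"
  shows "primitive q z - primitive q y = (LINT s:{y..z}|lebesgue. q s)"
proof -
  have si: "set_integrable lebesgue X q" if "X \<in> sets lebesgue" for X
    using integrable_mult_indicator[OF that q] by (simp add: set_integrable_def)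
  have "primitive q z = (LINT s:{0..y} \<union> {y<..z}|lebesgue. q s)" unfolding primitive_def
    using yz by (simp add: ivl_disj_un)
  also have "\<dots> = primitive q y + (LINT s:{y<..z}|lebesgue. q s)"
    unfolding primitive_def by (rule set_integral_Un) (auto intro: si)
  also have "(LINT s:{y<..z}|lebesgue. q s) = (LINT s:{y..z}|lebesgue. q s)"
    unfolding set_lebesgue_integral_def
  proof (rule integral_cong_AE)
    have "AE s in lebesgue. s \<noteq> y" by (rule AE_completion) (simp add: AE_lborel_singleton)
    then show "AE x in lebesgue. indicat_real {y<..z} x *\<^sub>R q x = indicat_real {y..z} x *\<^sub>R q x"
      by eventually_elim (auto split: split_indicator)
  qed (use si[of "{y<..z}"] si[of "{y..z}"] in \<open>simp_all add: set_integrable_def borel_measurable_integrable\<close>)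
  finally show ?thesis by simp
qed

text \<open>The exceptional set consists of the end points and of the null sets of the preceding lemma for
\<open>q\<close> and \<open>- q\<close> and all rational levels \<open>\<alpha> < \<beta>\<close>. Elsewhere the means of \<open>q\<close> over short intervals
containing \<open>t\<close> are squeezed to \<open>q t\<close> from both sides.\<close>

lemma bounded_AE_deriv_primitive:
  fixes q :: "real \<Rightarrow> real"
  assumes q: "integrable lebesgue q" and M: "\<And>x. \<bar>q x\<bar> \<le> M"
  obtains N where "negligible N" "\<And>t. t \<in> {0..T} - N \<Longrightarrow> (primitive q has_real_derivative q t) (at t within {0..T})"
proof -
  have iv: "cball c r = {c - r..c + r}" for c r :: real by (rule cball_eq_atLeastAtMost)
  define E where "E p \<alpha> \<beta> = {x \<in> {-(\<bar>T\<bar> + 1)<..<\<bar>T\<bar> + 1}. p x < \<alpha> \<and>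
    (\<forall>d>0. \<exists>c r. 0 < r \<and> r < d \<and> x \<in> cball c r \<and> \<beta> * (2 * r) \<le> (LINT y:cball c r|lebesgue. p y))}"
    for p :: "real \<Rightarrow> real" and \<alpha> \<beta>
  define N where "N = {0, T} \<union> (\<Union>(\<alpha>,\<beta>)\<in>{(\<alpha>,\<beta>). \<alpha> \<in> \<rat> \<and> \<beta> \<in> \<rat> \<and> \<alpha> < \<beta>}. E q \<alpha> \<beta> \<union> E (\<lambda>x. - q x) \<alpha> \<beta>)"
  define P where "P = {(\<alpha>::real,\<beta>::real). \<alpha> \<in> \<rat> \<and> \<beta> \<in> \<rat> \<and> \<alpha> < \<beta>}"
  have Pc: "countable P"
    by (rule countable_subset[of _ "\<rat> \<times> \<rat>"]) (auto simp: P_def intro: countable_rat)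
  have Eq: "negligible (E q \<alpha> \<beta>)" if "\<alpha> < \<beta>" for \<alpha> \<beta>
    unfolding E_def by (rule negligible_low_value_high_mean[OF q M that])
  have Em: "negligible (E (\<lambda>x. - q x) \<alpha> \<beta>)" if "\<alpha> < \<beta>" for \<alpha> \<beta>
    unfolding E_def by (rule negligible_low_value_high_mean[where M=M, OF _ _ that]) (use q M in simp_all)
  have "negligible (\<Union>((\<lambda>(\<alpha>,\<beta>). E q \<alpha> \<beta> \<union> E (\<lambda>x. - q x) \<alpha> \<beta>) ` P))"
  proof (rule negligible_countable_Union)
    fix S assume "S \<in> (\<lambda>(\<alpha>,\<beta>). E q \<alpha> \<beta> \<union> E (\<lambda>x. - q x) \<alpha> \<beta>) ` P"
    then obtain \<alpha> \<beta> where "S = E q \<alpha> \<beta> \<union> E (\<lambda>x. - q x) \<alpha> \<beta>" "\<alpha> < \<beta>" by (auto simp: P_def)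
    then show "negligible S" using Eq Em by simp
  qed (use Pc in simp)
  moreover have "negligible {0, T}" by simp
  ultimately have N: "negligible N" unfolding N_def P_def[symmetric] by (intro negligible_Un)
  have half: "\<exists>d>0. \<forall>c r. 0 < r \<and> r < d \<and> x \<in> cball c r \<longrightarrow> (LINT y:cball c r|lebesgue. p y) \<le> (p x + e) * (2 * r)"
    if pq: "p = q \<or> p = (\<lambda>x. - q x)" and x: "x \<in> {0..T} - N" and e: "e > 0" for p x e
  proof -
    obtain \<alpha> where \<alpha>: "\<alpha> \<in> \<rat>" "p x < \<alpha>" "\<alpha> < p x + e" using Rats_dense_in_real[of "p x" "p x + e"] e by auto
    obtain \<beta> where \<beta>: "\<beta> \<in> \<rat>" "\<alpha> < \<beta>" "\<beta> < p x + e" using Rats_dense_in_real[OF \<alpha>(3)] by auto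
    have "x \<notin> E p \<alpha> \<beta>" using x pq \<alpha> \<beta> by (auto simp: N_def)
    then obtain d where d: "d > 0" "\<And>c r. 0 < r \<Longrightarrow> r < d \<Longrightarrow> x \<in> cball c r \<Longrightarrow> (LINT y:cball c r|lebesgue. p y) < \<beta> * (2 * r)"
    proof -
      have "x \<in> {-(\<bar>T\<bar> + 1)<..<\<bar>T\<bar> + 1}" using x by auto
      then have "\<not> (\<forall>d>0. \<exists>c r. 0 < r \<and> r < d \<and> x \<in> cball c r \<and> \<beta> * (2 * r) \<le> (LINT y:cball c r|lebesgue. p y))"
        using \<open>x \<notin> E p \<alpha> \<beta>\<close> \<alpha>(2) unfolding E_def mem_Collect_eq by blast
      then show thesis using that by (meson not_le)
    qed
    have "(LINT y:cball c r|lebesgue. p y) \<le> (p x + e) * (2 * r)" if "0 < r" "r < d" "x \<in> cball c r" for c r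
    proof -
      have "\<beta> * (2 * r) \<le> (p x + e) * (2 * r)" using \<beta> that by (intro mult_right_mono) auto
      then show ?thesis using d(2)[OF that] by linarith
    qed
    then show ?thesis using d(1) by blast
  qed
  have si: "set_integrable lebesgue X q" if "X \<in> sets lebesgue" for X
    using integrable_mult_indicator[OF that q] by (simp add: set_integrable_def)
  note diff = primitive_diff[OF q]
  have "(primitive q has_real_derivative q t) (at t within {0..T})" if t: "t \<in> {0..T} - N" for t
  proof -
    have "(primitive q has_derivative (\<lambda>h. q t * h)) (at t within {0..T})"
      unfolding has_derivative_within_alt
    proof (intro conjI allI impI bounded_linear_mult_right)
      fix e :: real assume e: "e > 0"
      obtain d1 where d1: "d1 > 0" "\<And>c r. 0 < r \<and> r < d1 \<and> t \<in> cball c r \<Longrightarrow> (LINT y:cball c r|lebesgue. q y) \<le> (q t + e) * (2 * r)"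
        using half[of q t e] t e by blast
      obtain d2 where d2: "d2 > 0" "\<And>c r. 0 < r \<and> r < d2 \<and> t \<in> cball c r \<Longrightarrow> (LINT y:cball c r|lebesgue. - q y) \<le> (- q t + e) * (2 * r)"
        using half[of "\<lambda>x. - q x" t e] t e by blast
      have key: "\<bar>(LINT s:{y..z}|lebesgue. q s) - q t * (z - y)\<bar> \<le> e * (z - y)"
        if "y < z" "z - y < min d1 d2" "t \<in> {y..z}" for y z
      proof -
        define c r where "c = (y + z) / 2" and "r = (z - y) / 2"
        have cr: "cball c r = {y..z}" "2 * r = z - y" "0 < r" "r < d1" "r < d2" "t \<in> cball c r"
          using that by (auto simp: c_def r_def iv field_simps dist_real_def)
        have "(LINT y:cball c r|lebesgue. - q y) = - (LINT y:cball c r|lebesgue. q y)"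
          by (simp add: set_lebesgue_integral_def)
        then have "(LINT y:cball c r|lebesgue. q y) \<le> (q t + e) * (2 * r)"
            "- (LINT y:cball c r|lebesgue. q y) \<le> (- q t + e) * (2 * r)"
          using d1(2)[of r c] d2(2)[of r c] cr(3-) \<open>(LINT y:cball c r|lebesgue. - q y) = - (LINT y:cball c r|lebesgue. q y)\<close> by linarith+
        then show ?thesis unfolding cr(1,2) abs_le_iff by (simp add: algebra_simps)
      qed
      show "\<exists>d>0. \<forall>y\<in>{0..T}. norm (y - t) < d \<longrightarrow> norm (primitive q y - primitive q t - q t * (y - t)) \<le> e * norm (y - t)"
      proof (intro exI[of _ "min d1 d2"] conjI ballI impI)
        fix y assume y: "y \<in> {0..T}" "norm (y - t) < min d1 d2"
        consider "y = t" | "y < t" | "y > t" by linarith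
        then show "norm (primitive q y - primitive q t - q t * (y - t)) \<le> e * norm (y - t)"
        proof cases
          case 1 then show ?thesis by simp
        next
          case 2
          then have "\<bar>(primitive q t - primitive q y) - q t * (t - y)\<bar> \<le> e * (t - y)"
            using key[of y t] diff[of y t] y t by simp
          then show ?thesis using 2 by (simp add: abs_le_iff algebra_simps)
        next
          case 3
          then show ?thesis using key[of t y] diff[of t y] y t by simp
        qed
      qed (use d1(1) d2(1) in simp)
    qed
    then show ?thesis by (simp add: has_field_derivative_def)
  qed
  then show thesis by (rule that[OF N])
qed

lemma primitive_lipschitz:
  fixes q :: "real \<Rightarrow> real"
  assumes q: "integrable lebesgue q" and M: "\<And>x. \<bar>q x\<bar> \<le> M" and st: "0 \<le> s" "0 \<le> t"
  shows "\<bar>primitive q t - primitive q s\<bar> \<le> M * \<bar>t - s\<bar>"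
proof -
  have *: "\<bar>primitive q z - primitive q y\<bar> \<le> M * (z - y)" if "0 \<le> y" "y \<le> z" for y z
  proof -
    have si: "set_integrable lebesgue {y..z} q"
      using integrable_mult_indicator[OF _ q, of "{y..z}"] by (simp add: set_integrable_def)
    have sc: "set_integrable lebesgue {y..z} (\<lambda>_. k)" for k :: real
      by (simp add: set_integrable_def lmeasurable_iff_integrable[symmetric])
    have "(LINT s:{y..z}|lebesgue. q s) \<le> (LINT s:{y..z}|lebesgue. M)"
      "(LINT s:{y..z}|lebesgue. - M) \<le> (LINT s:{y..z}|lebesgue. q s)"
      using si sc M by (intro set_integral_mono; simp add: abs_le_iff minus_le_iff)+
    then show ?thesis using that
      by (simp add: primitive_diff[OF q that] set_integral_const abs_le_iff mult.commute)
  qed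
  show ?thesis using *[of s t] *[of t s] st by (cases "s \<le> t") (auto simp: abs_minus_commute)
qed

section \<open>Ordinary differential equations with Lipschitz right-hand side\<close>

text \<open>The integral equation is solved on the whole interval at once: in the norm
\<open>sup (exp (- 2 K t) * norm (x t))\<close> the Picard map is a contraction with factor 1/2. The weight is
moved into the unknown, which makes Banach's fixed point theorem applicable to bounded continuous
functions with the usual norm; composing with the projection \<open>cl\<close> onto \<open>[0,T]\<close> makes them functions
on the real line.\<close>

lemma lipschitz_ODE_exists:
  fixes G :: "real \<Rightarrow> 'e::banach \<Rightarrow> 'e"
  assumes T: "T \<ge> 0" and K: "K > 0"
    and lip: "\<And>t x y. t \<in> {0..T} \<Longrightarrow> norm (G t x - G t y) \<le> K * norm (x - y)"
    and cont: "\<And>x. continuous_on {0..T} x \<Longrightarrow> continuous_on {0..T} (\<lambda>t. G t (x t))"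
  obtains x where "x 0 = x0" "\<And>t. t \<in> {0..T} \<Longrightarrow> (x has_vector_derivative G t (x t)) (at t within {0..T})"
proof -
  define cl where "cl t = max 0 (min T t)" for t :: real
  have cl: "cl t \<in> {0..T}" "t \<in> {0..T} \<Longrightarrow> cl t = t" for t using T by (auto simp: cl_def)
  have cl_cont: "continuous_on UNIV cl" unfolding cl_def by (intro continuous_intros)
  \<comment> \<open>twice the Lipschitz constant gives the contraction factor 1/2\<close>
  define L where "L = 2 * K"
  define H where "H X t = x0 + integral {0..t} (\<lambda>s. G s (exp (L * s) *\<^sub>R X s))" for X :: "real \<Rightarrow> 'e" and t
  have Gc: "continuous_on {0..T} (\<lambda>s. G s (exp (L * s) *\<^sub>R X s))" if "continuous_on {0..T} X" for X
    by (intro cont continuous_intros that)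
  have Hd: "(H X has_vector_derivative G t (exp (L * t) *\<^sub>R X t)) (at t within {0..T})"
    if "continuous_on {0..T} X" "t \<in> {0..T}" for X t
    unfolding H_def using integral_has_vector_derivative[OF Gc[OF that(1)] that(2)]
    by (auto intro!: derivative_eq_intros)
  define F where "F X = Bcontfun (\<lambda>t. exp (- L * cl t) *\<^sub>R H (apply_bcontfun X) (cl t))" for X :: "real \<Rightarrow>\<^sub>C 'e"
  have F: "apply_bcontfun (F X) t = exp (- L * cl t) *\<^sub>R H (apply_bcontfun X) (cl t)" for X t
  proof -
    have "continuous_on {0..T} (H (apply_bcontfun X))"
      by (rule continuous_on_vector_derivative[OF Hd]) auto
    then have c: "continuous_on {0..T} (\<lambda>t. exp (- L * t) *\<^sub>R H (apply_bcontfun X) t)"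
      by (intro continuous_intros)
    have "continuous_on UNIV (\<lambda>t. exp (- L * cl t) *\<^sub>R H (apply_bcontfun X) (cl t))"
      by (rule continuous_on_compose2[OF c cl_cont]) (use cl in auto)
    moreover have "bounded (range (\<lambda>t. exp (- L * cl t) *\<^sub>R H (apply_bcontfun X) (cl t)))"
      by (rule bounded_subset[OF compact_imp_bounded[OF compact_continuous_image[OF c compact_Icc]]]) (use cl in auto)
    ultimately have "(\<lambda>t. exp (- L * cl t) *\<^sub>R H (apply_bcontfun X) (cl t)) \<in> bcontfun"
      by (simp add: bcontfun_def)
    then show ?thesis unfolding F_def by (simp add: Bcontfun_inverse)
  qed
  have contr: "dist (F X) (F Y) \<le> (1/2) * dist X Y" for X Y
  proof (rule dist_bound)
    fix t
    define s where "s = cl t"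
    have s: "s \<in> {0..T}" using cl by (simp add: s_def)
    have sub: "{0..s} \<subseteq> {0..T}" using s by auto
    have gi: "(\<lambda>r. G r (exp (L * r) *\<^sub>R apply_bcontfun X r)) integrable_on {0..s}" for X
      by (rule integrable_continuous_interval[OF continuous_on_subset[OF Gc sub]]) auto
    define g where "g r = (dist X Y / 2) * exp (L * r)" for r
    have "norm (H (apply_bcontfun X) s - H (apply_bcontfun Y) s) = norm (integral {0..s} (\<lambda>r. G r (exp (L * r) *\<^sub>R apply_bcontfun X r) - G r (exp (L * r) *\<^sub>R apply_bcontfun Y r)))"
      by (simp add: H_def integral_diff[OF gi gi])
    also have "\<dots> \<le> integral {0..s} (\<lambda>r. L * g r)"
    proof (rule integral_norm_bound_integral)
      show "(\<lambda>r. G r (exp (L * r) *\<^sub>R apply_bcontfun X r) - G r (exp (L * r) *\<^sub>R apply_bcontfun Y r)) integrable_on {0..s}"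
        by (intro integrable_diff gi)
      show "(\<lambda>r. L * g r) integrable_on {0..s}"
        unfolding g_def by (intro integrable_continuous_interval continuous_intros)
      fix r assume "r \<in> {0..s}"
      then have r: "r \<in> {0..T}" using sub by auto
      have "norm (G r (exp (L * r) *\<^sub>R apply_bcontfun X r) - G r (exp (L * r) *\<^sub>R apply_bcontfun Y r))
          \<le> K * norm (exp (L * r) *\<^sub>R apply_bcontfun X r - exp (L * r) *\<^sub>R apply_bcontfun Y r)" by (rule lip[OF r])
      also have "\<dots> = K * (exp (L * r) * dist (apply_bcontfun X r) (apply_bcontfun Y r))"
        by (simp add: scaleR_diff_right[symmetric] dist_norm)
      also have "\<dots> \<le> K * (exp (L * r) * dist X Y)" using K dist_bounded[of X r Y] by (intro mult_left_mono) auto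
      also have "\<dots> = L * g r" by (simp add: L_def g_def)
      finally show "norm (G r (exp (L * r) *\<^sub>R apply_bcontfun X r) - G r (exp (L * r) *\<^sub>R apply_bcontfun Y r)) \<le> L * g r" .
    qed
    also have "integral {0..s} (\<lambda>r. L * g r) = g s - g 0"
    proof (rule integral_unique, rule fundamental_theorem_of_calculus)
      show "(g has_vector_derivative L * g r) (at r within {0..s})" for r
        unfolding g_def by (auto intro!: derivative_eq_intros simp: has_real_derivative_iff_has_vector_derivative[symmetric])
    qed (use s in auto)
    also have "\<dots> \<le> g s" by (simp add: g_def)
    finally have "norm (H (apply_bcontfun X) s - H (apply_bcontfun Y) s) \<le> g s" .
    then have "exp (- L * s) * norm (H (apply_bcontfun X) s - H (apply_bcontfun Y) s) \<le> exp (- L * s) * g s"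
      by (intro mult_left_mono) auto
    also have "\<dots> = (1/2) * dist X Y" by (simp add: g_def exp_minus field_simps)
    finally show "dist (apply_bcontfun (F X) t) (apply_bcontfun (F Y) t) \<le> (1/2) * dist X Y"
      unfolding F s_def[symmetric] by (simp add: dist_norm scaleR_diff_right[symmetric])
  qed
  obtain X where X: "F X = X" using banach_fix_type[of "1/2" F] contr by auto
  define x where "x t = exp (L * t) *\<^sub>R apply_bcontfun X t" for t
  have xH: "x t = H (apply_bcontfun X) t" if "t \<in> {0..T}" for t
  proof -
    have "apply_bcontfun X t = exp (- L * t) *\<^sub>R H (apply_bcontfun X) t"
      using F[of X t] X cl(2)[OF that] by simp
    then show ?thesis by (simp add: x_def exp_minus)
  qed
  show thesis
  proof
    show "x 0 = x0" using xH[of 0] T by (simp add: H_def)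
    show "(x has_vector_derivative G t (x t)) (at t within {0..T})" if t: "t \<in> {0..T}" for t
    proof (rule has_vector_derivative_transform[OF t xH])
      show "(H (apply_bcontfun X) has_vector_derivative G t (x t)) (at t within {0..T})"
        using Hd[of "apply_bcontfun X" t] t by (simp add: x_def)
    qed
  qed
qed

section \<open>Regularization of a nonnegative Hoelder continuous coefficient\<close>


text \<open>The data of a regularization \<open>b\<close> of \<open>a\<close> at scale \<open>\<epsilon>\<close>: \<open>g\<close> bounds the logarithmic derivative of \<open>b\<close>,
and \<open>\<Gamma>\<close> is a primitive of \<open>g\<close>, so that \<open>\<Lambda> / \<epsilon>\<close> bounds the total growth it causes. The error is
measured relative to \<open>sqrt b\<close>, since this is what the energy controls.\<close>

definition regularized :: "real \<Rightarrow> real \<Rightarrow> (real \<Rightarrow> real) \<Rightarrow> real \<Rightarrow> real \<Rightarrow> real \<Rightarrow> (real \<Rightarrow> real) \<Rightarrow> (real \<Rightarrow> real) \<Rightarrow> (real \<Rightarrow> real) \<Rightarrow> (real \<Rightarrow> real) \<Rightarrow> bool" where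
  "regularized \<alpha> T a C \<epsilon> \<Lambda> b b' \<Gamma> g \<longleftrightarrow> (\<forall>t\<in>{0..T}.
     0 \<le> b t \<and> b t \<le> C \<and> \<bar>a t - b t\<bar> \<le> C * \<epsilon> powr (\<alpha>/2) * sqrt (b t) \<and>
     (b has_real_derivative b' t) (at t within {0..T}) \<and> \<bar>b' t\<bar> \<le> g t * b t \<and> 0 \<le> g t \<and>
     (\<Gamma> has_real_derivative g t) (at t within {0..T}) \<and> 0 \<le> \<Gamma> t \<and> \<Gamma> t \<le> \<Lambda> / \<epsilon>)"

lemma powr_half_square: "(\<epsilon>::real) powr (\<alpha>/2) * \<epsilon> powr (\<alpha>/2) = \<epsilon> powr \<alpha>"
  by (simp add: powr_add[symmetric])

lemma sqrt_powr: "sqrt ((\<epsilon>::real) powr \<alpha>) = \<epsilon> powr (\<alpha>/2)"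
  by (rule real_sqrt_unique) (simp_all add: power2_eq_square powr_half_square)

lemma holder_nonneg_const:
  assumes "holder_on \<beta> T a"
  obtains M where "M \<ge> 1" "\<And>t t'. t \<in> {0..T} \<Longrightarrow> t' \<in> {0..T} \<Longrightarrow> \<bar>a t - a t'\<bar> \<le> M * \<bar>t - t'\<bar> powr \<beta>"
proof -
  obtain M where M: "M > 0" "\<forall>t\<in>{0..T}. \<forall>t'\<in>{0..T}. \<bar>a t - a t'\<bar> \<le> M * \<bar>t - t'\<bar> powr \<beta>"
    using assms unfolding holder_on_def by blast
  have "M * \<bar>t - t'\<bar> powr \<beta> \<le> (M + 1) * \<bar>t - t'\<bar> powr \<beta>" for t t' by (intro mult_right_mono) auto
  then have "\<bar>a t - a t'\<bar> \<le> (M + 1) * \<bar>t - t'\<bar> powr \<beta>" if "t \<in> {0..T}" "t' \<in> {0..T}" for t t'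
    using M(2) that order_trans by blast
  then show thesis using M(1) by (intro that[of "M + 1"]) auto
qed

lemma holder_modulus_continuous:
  fixes a :: "real \<Rightarrow> real"
  assumes "\<alpha> > 0" and M: "\<And>t t'. t \<in> S \<Longrightarrow> t' \<in> S \<Longrightarrow> \<bar>a t - a t'\<bar> \<le> M * \<bar>t - t'\<bar> powr \<alpha>"
  shows "continuous_on S a"
  unfolding continuous_on_def
proof
  fix t assume t: "t \<in> S"
  have "((\<lambda>s. M * \<bar>s - t\<bar> powr \<alpha>) \<longlongrightarrow> M * 0) (at t within S)"
    using assms(1) by (intro tendsto_mult tendsto_const tendsto_zero_powrI[of _ _ _ \<alpha>]) (auto intro!: tendsto_eq_intros)
  then have "((\<lambda>s. a s - a t) \<longlongrightarrow> 0) (at t within S)"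
    by (intro Lim_null_comparison[of "\<lambda>s. a s - a t" "\<lambda>s. M * \<bar>s - t\<bar> powr \<alpha>"]) (use t M in \<open>auto simp: eventually_at_filter\<close>)
  then show "(a \<longlongrightarrow> a t) (at t within S)" by (simp add: LIM_zero_iff)
qed

text \<open>For exponents up to 1 the mean of \<open>a\<close> over \<open>[t, t + \<epsilon>]\<close>, lifted by \<open>M * \<epsilon> powr \<alpha>\<close>, will do: both
the error and \<open>\<epsilon>\<close> times the derivative of \<open>b\<close> are of order \<open>M * \<epsilon> powr \<alpha>\<close>, which is at most \<open>b\<close>.\<close>

lemma regularize_holder:
  assumes T: "T > 0" and al: "0 < \<alpha>" "\<alpha> \<le> 1" and h: "holder_on \<alpha> T a" and pos: "\<forall>t\<in>{0..T}. a t \<ge> 0"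
  shows "\<exists>C>0. \<exists>\<Lambda>>0. \<forall>\<epsilon>\<in>{0<..1}. \<exists>b b' \<Gamma> g. regularized \<alpha> T a C \<epsilon> \<Lambda> b b' \<Gamma> g"
proof -
  obtain M where M: "M \<ge> 1" "\<And>t t'. t \<in> {0..T} \<Longrightarrow> t' \<in> {0..T} \<Longrightarrow> \<bar>a t - a t'\<bar> \<le> M * \<bar>t - t'\<bar> powr \<alpha>"
    using holder_nonneg_const[OF h] by blast
  \<comment> \<open>constant continuation, as the mean looks beyond the end point \<open>T\<close>\<close>
  define e where "e t = a (max 0 (min T t))" for t
  have cl: "max 0 (min T t) \<in> {0..T}" for t using T by auto
  have e_eq: "e t = a t" if "t \<in> {0..T}" for t using that by (simp add: e_def)
  have e_pos: "e t \<ge> 0" for t using pos cl by (simp add: e_def)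
  have e_hol: "\<bar>e t - e t'\<bar> \<le> M * \<bar>t - t'\<bar> powr \<alpha>" for t t'
  proof -
    have "\<bar>e t - e t'\<bar> \<le> M * \<bar>max 0 (min T t) - max 0 (min T t')\<bar> powr \<alpha>"
      unfolding e_def by (rule M(2)[OF cl cl])
    also have "\<dots> \<le> M * \<bar>t - t'\<bar> powr \<alpha>"
      using M(1) al by (intro mult_left_mono powr_mono2) auto
    finally show ?thesis .
  qed
  have e_cont: "continuous_on S e" for S by (rule holder_modulus_continuous[OF al(1) e_hol])
  define B where "B = a 0 + M * T powr \<alpha> + 2 * M"
  have eB: "e t \<le> a 0 + M * T powr \<alpha>" for t
  proof -
    have "\<bar>e t - a 0\<bar> \<le> M * \<bar>max 0 (min T t) - 0\<bar> powr \<alpha>" unfolding e_def using T by (intro M(2) cl) auto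
    also have "\<dots> \<le> M * T powr \<alpha>" using M(1) al T by (intro mult_left_mono powr_mono2) auto
    finally show ?thesis by linarith
  qed
  have a0: "a 0 \<ge> 0" using pos T by auto
  have B0: "B \<ge> 2 * M" using a0 M T by (simp add: B_def)
  have "\<exists>b b' \<Gamma> g. regularized \<alpha> T a (B + 1) \<epsilon> (T + 1) b b' \<Gamma> g" if \<epsilon>: "\<epsilon> \<in> {0<..1}" for \<epsilon>
  proof -
    define E where "E t = integral {0..t} e" for t
    define b where "b t = (E (t + \<epsilon>) - E t) / \<epsilon> + M * \<epsilon> powr \<alpha>" for t
    have Ed: "(E has_real_derivative e t) (at t within {0..T+1})" if "t \<in> {0..T+1}" for t
      unfolding E_def using integral_has_real_derivative[OF e_cont that] .
    have d1: "((\<lambda>t. E (t + \<epsilon>)) has_real_derivative e (t + \<epsilon>)) (at t within {0..T})" if "t \<in> {0..T}" for t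
    proof -
      have "(E has_real_derivative e (t + \<epsilon>)) (at (t + \<epsilon>) within (\<lambda>t. t + \<epsilon>) ` {0..T})"
        by (rule DERIV_subset[OF Ed]) (use that \<epsilon> in auto)
      then show ?thesis
        by (rule DERIV_image_chain[of E _ "\<lambda>t. t + \<epsilon>", unfolded o_def, where Db=1, simplified]) (auto intro!: derivative_eq_intros)
    qed
    have d2: "(E has_real_derivative e t) (at t within {0..T})" if "t \<in> {0..T}" for t
      by (rule DERIV_subset[OF Ed]) (use that in auto)
    have mean: "\<bar>(E (t + \<epsilon>) - E t) - e t * \<epsilon>\<bar> \<le> M * \<epsilon> powr \<alpha> * \<epsilon>" if t: "t \<in> {0..T}" for t
    proof -
      obtain z where z: "z \<in> {t..t+\<epsilon>}" "E (t + \<epsilon>) - E t = e z * \<epsilon>"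
      proof -
        have "\<exists>z\<in>{t<..<t+\<epsilon>}. E (t+\<epsilon>) - E t = (\<lambda>h. e z * h) (t + \<epsilon> - t)"
        proof (rule mvt_simple)
          show "(E has_derivative (*) (e x)) (at x within {t..t+\<epsilon>})" if "t \<le> x" "x \<le> t + \<epsilon>" for x
            using DERIV_subset[OF Ed[of x], of "{t..t+\<epsilon>}"] that t \<epsilon> by (auto simp: has_field_derivative_def)
        qed (use \<epsilon> in auto)
        then obtain z where "z \<in> {t<..<t+\<epsilon>}" "E (t+\<epsilon>) - E t = e z * (t + \<epsilon> - t)" by blast
        then show thesis using that[of z] by simp
      qed
      have "\<bar>e z - e t\<bar> \<le> M * \<bar>z - t\<bar> powr \<alpha>" by (rule e_hol)
      also have "\<dots> \<le> M * \<epsilon> powr \<alpha>" using z M al by (intro mult_left_mono powr_mono2) auto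
      finally have "\<bar>e z - e t\<bar> * \<epsilon> \<le> M * \<epsilon> powr \<alpha> * \<epsilon>" using \<epsilon> by (intro mult_right_mono) auto
      moreover have "(E (t + \<epsilon>) - E t) - e t * \<epsilon> = (e z - e t) * \<epsilon>" using z(2) by (simp add: algebra_simps)
      ultimately show ?thesis using \<epsilon> by (simp add: abs_mult)
    qed
    have dev: "\<bar>(E (t + \<epsilon>) - E t) / \<epsilon> - e t\<bar> \<le> M * \<epsilon> powr \<alpha>" if "t \<in> {0..T}" for t
    proof -
      have "(E (t + \<epsilon>) - E t) / \<epsilon> - e t = ((E (t + \<epsilon>) - E t) - e t * \<epsilon>) / \<epsilon>" using \<epsilon> by (simp add: field_simps)
      then show ?thesis using mean[OF that] \<epsilon> by (simp add: field_simps)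
    qed
    have Emono: "E t \<le> E (t + \<epsilon>)" if "t \<in> {0..T}" for t
      unfolding E_def using that \<epsilon> e_pos
      by (intro integral_subset_le integrable_continuous_interval e_cont) auto
    have "regularized \<alpha> T a (B + 1) \<epsilon> (T + 1) b (\<lambda>t. (e (t + \<epsilon>) - e t) / \<epsilon>) (\<lambda>t. t / \<epsilon>) (\<lambda>t. 1 / \<epsilon>)"
      unfolding regularized_def
    proof (intro ballI conjI)
      fix t assume t: "t \<in> {0..T}"
      have p: "0 < \<epsilon> powr \<alpha>" "\<epsilon> powr \<alpha> \<le> 1" using \<epsilon> al by (auto simp: powr_le1)
      have lb: "M * \<epsilon> powr \<alpha> \<le> b t" using Emono[OF t] \<epsilon> by (simp add: b_def)
      then show "0 \<le> b t" using p M by (smt (verit) mult_nonneg_nonneg)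
      have "M * \<epsilon> powr \<alpha> \<le> M" using p M by simp
      then show "b t \<le> B + 1" using dev[OF t] eB[of t] by (simp add: b_def B_def)
      have "\<bar>a t - b t\<bar> \<le> 2 * (M * \<epsilon> powr \<alpha>)" using dev[OF t] p M e_eq[OF t] by (simp add: b_def)
      also have "\<dots> = 2 * sqrt M * \<epsilon> powr (\<alpha>/2) * (sqrt M * \<epsilon> powr (\<alpha>/2))"
      proof -
        have "2 * sqrt M * \<epsilon> powr (\<alpha>/2) * (sqrt M * \<epsilon> powr (\<alpha>/2)) = 2 * ((sqrt M * sqrt M) * (\<epsilon> powr (\<alpha>/2) * \<epsilon> powr (\<alpha>/2)))"
          by (simp only: ac_simps)
        then show ?thesis using M by (simp only: powr_half_square) simp
      qed
      also have "sqrt M * \<epsilon> powr (\<alpha>/2) = sqrt (M * \<epsilon> powr \<alpha>)"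
        by (simp add: real_sqrt_mult sqrt_powr)
      also have "2 * sqrt M * \<epsilon> powr (\<alpha>/2) * sqrt (M * \<epsilon> powr \<alpha>) \<le> (B + 1) * \<epsilon> powr (\<alpha>/2) * sqrt (b t)"
      proof (intro mult_mono)
        have "sqrt M \<le> M" using M by (simp add: real_le_lsqrt power2_eq_square sqrt_le_D)
        then show "2 * sqrt M \<le> B + 1" using B0 by linarith
      qed (use lb B0 M in auto)
      finally show "\<bar>a t - b t\<bar> \<le> (B + 1) * \<epsilon> powr (\<alpha>/2) * sqrt (b t)" .
      show "(b has_real_derivative (e (t + \<epsilon>) - e t) / \<epsilon>) (at t within {0..T})"

      proof -
        have "\<epsilon> \<noteq> 0" using \<epsilon> by auto
        then show ?thesis unfolding b_def by (auto intro!: derivative_eq_intros d1[OF t] d2[OF t] simp: field_simps)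
      qed
      have "\<bar>e (t + \<epsilon>) - e t\<bar> \<le> M * \<epsilon> powr \<alpha>" using e_hol[of "t + \<epsilon>" t] \<epsilon> by simp
      then have "\<bar>e (t + \<epsilon>) - e t\<bar> \<le> b t" using lb by linarith
      then show "\<bar>(e (t + \<epsilon>) - e t) / \<epsilon>\<bar> \<le> 1 / \<epsilon> * b t" using \<epsilon> by (simp add: divide_right_mono)
      show "((\<lambda>t. t / \<epsilon>) has_real_derivative 1 / \<epsilon>) (at t within {0..T})" using \<epsilon> by (auto intro!: derivative_eq_intros)
      show "t / \<epsilon> \<le> (T + 1) / \<epsilon>" "0 \<le> t / \<epsilon>" "0 \<le> 1 / \<epsilon>" using t \<epsilon> by (auto simp: divide_right_mono)
    qed
    then show ?thesis by blast
  qed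
  moreover have "B + 1 > 0" "T + 1 > 0" using B0 M T by auto
  ultimately show ?thesis by blast
qed

lemma ln_one_plus_le_sqrt:
  assumes "0 \<le> (z::real)" shows "ln (1 + z) \<le> 2 * sqrt z"
proof -
  have "sqrt (1 + z) \<le> 1 + sqrt z" using assms by (intro real_le_lsqrt) (auto simp: power2_eq_square algebra_simps)
  moreover have "ln (1 + z) = 2 * ln (sqrt (1 + z))" using assms by (simp add: ln_sqrt)
  moreover have "ln (sqrt (1 + z)) \<le> sqrt (1 + z) - 1" using assms by (intro ln_le_minus_one) auto
  ultimately show ?thesis by linarith
qed

lemma nonneg_of_log_increments: "0 \<le> v + 2 * (x - e) + 2 * (X - w)" if "e \<le> x" "w \<le> X" "0 \<le> v" for v x e X w :: real
  using that by (simp add: right_diff_distrib)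

lemma le_of_log_increments: "v + 2 * (x - e) + 2 * (X - w) \<le> L"
  if "x \<le> X" "e \<le> w" "v \<le> V" "X - e \<le> S" "L = V + 4 * S + r" "0 \<le> r" for v x e X w V S L r :: real
  using that by (simp add: right_diff_distrib)

text \<open>For exponents above 1 the function \<open>a\<close> itself is differentiable, and only a lift by
\<open>M * \<epsilon> powr \<alpha>\<close> is needed. Since \<open>a\<close> is nonnegative at distance \<open>h\<close> from \<open>t\<close> in the direction of
descent, Taylor's formula gives \<open>\<bar>a' t\<bar> * h \<le> a t + M * h powr \<alpha>\<close>; the choice \<open>h = \<epsilon>\<close> bounds
\<open>\<bar>a'\<bar>\<close> by \<open>b / \<epsilon>\<close>. Closer than \<open>\<epsilon>\<close> to an end point of \<open>[0,T]\<close> the step \<open>h\<close> is limited by the distance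
to it. There one combines \<open>h\<close> equal to this distance with the boundedness of \<open>a'\<close>, which costs
a logarithm of \<open>1 / \<epsilon>\<close> in the primitive, and this is dominated by \<open>1 / \<epsilon>\<close>.\<close>

lemma regularize_C1_holder:
  assumes T: "T > 0" and al: "1 < \<alpha>" "\<alpha> < 2"
    and da: "\<And>t. t \<in> {0..T} \<Longrightarrow> (a has_real_derivative a' t) (at t within {0..T})"
    and ca: "continuous_on {0..T} a'" and h: "holder_on (\<alpha> - 1) T a'" and pos: "\<forall>t\<in>{0..T}. a t \<ge> 0"
  shows "\<exists>C>0. \<exists>\<Lambda>>0. \<forall>\<epsilon>\<in>{0<..1}. \<exists>b b' \<Gamma> g. regularized \<alpha> T a C \<epsilon> \<Lambda> b b' \<Gamma> g"
proof -
  obtain M1 where M1: "M1 \<ge> 1" "\<And>t t'. t \<in> {0..T} \<Longrightarrow> t' \<in> {0..T} \<Longrightarrow> \<bar>a' t - a' t'\<bar> \<le> M1 * \<bar>t - t'\<bar> powr (\<alpha> - 1)"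
    using holder_nonneg_const[OF h] by blast
  obtain M2 where "\<forall>x\<in>a' ` {0..T}. norm x \<le> M2"
    using compact_imp_bounded[OF compact_continuous_image[OF ca compact_Icc]] unfolding bounded_iff by blast
  then have M2: "\<bar>a' t\<bar> \<le> M2" if "t \<in> {0..T}" for t using that by auto
  have ac: "continuous_on {0..T} a" by (rule DERIV_continuous_on[OF da])
  obtain M3 where "\<forall>x\<in>a ` {0..T}. norm x \<le> M3"
    using compact_imp_bounded[OF compact_continuous_image[OF ac compact_Icc]] unfolding bounded_iff by blast
  then have M3: "\<bar>a t\<bar> \<le> M3" if "t \<in> {0..T}" for t using that by auto
  define M where "M = max M1 M2"
  have M: "M \<ge> 1" using M1 by (simp add: M_def)
  have hol: "\<bar>a' t - a' t'\<bar> \<le> M * \<bar>t - t'\<bar> powr (\<alpha> - 1)" if "t \<in> {0..T}" "t' \<in> {0..T}" for t t'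
    by (rule order_trans[OF M1(2)[OF that]]) (auto simp: M_def intro: mult_right_mono)
  have sup: "\<bar>a' t\<bar> \<le> M" if "t \<in> {0..T}" for t using M2[OF that] by (simp add: M_def)
  \<comment> \<open>Taylor at first order; nonnegativity at \<open>r\<close> bounds the slope at \<open>t\<close>\<close>
  have taylor: "0 \<le> a t + a' t * (r - t) + M * \<bar>r - t\<bar> powr \<alpha>" if t: "t \<in> {0..T}" and r: "r \<in> {0..T}" for t r
  proof -
    obtain z where z: "z \<in> closed_segment t r" "a r - a t = a' z * (r - t)"
      using mvt_closed_segment[OF da t r] by blast
    have zT: "z \<in> {0..T}" and zt: "\<bar>z - t\<bar> \<le> \<bar>r - t\<bar>" using closed_segment_within[OF z(1) t r] by auto
    have "\<bar>a' z - a' t\<bar> \<le> M * \<bar>z - t\<bar> powr (\<alpha> - 1)" by (rule hol[OF zT t])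
    also have "\<dots> \<le> M * \<bar>r - t\<bar> powr (\<alpha> - 1)"
      using zt M al by (intro mult_left_mono powr_mono2) auto
    finally have "\<bar>a' z - a' t\<bar> * \<bar>r - t\<bar> \<le> M * \<bar>r - t\<bar> powr (\<alpha> - 1) * \<bar>r - t\<bar>" by (intro mult_right_mono) auto
    also have "\<dots> = M * \<bar>r - t\<bar> powr \<alpha>"
      by (cases "r = t") (auto simp: powr_diff)
    finally have "(a' z - a' t) * (r - t) \<le> M * \<bar>r - t\<bar> powr \<alpha>" by (simp add: abs_mult[symmetric])
    moreover have "a r \<ge> 0" using pos r by auto
    ultimately show ?thesis using z(2) by (simp add: algebra_simps)
  qed
  define C where "C = M3 + M + 1"
  have M3: "M3 \<ge> 0" "\<And>t. t \<in> {0..T} \<Longrightarrow> a t \<le> M3" using M3 T by (force simp: abs_le_iff, simp add: abs_le_iff)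
  define \<Lambda> where "\<Lambda> = T + 8 * sqrt T + 1"
  have "C > 0" using M3 M by (simp add: C_def)
  moreover have "\<Lambda> > 0" using T by (simp add: \<Lambda>_def add_pos_nonneg)
  moreover have "\<exists>b b' \<Gamma> g. regularized \<alpha> T a C \<epsilon> \<Lambda> b b' \<Gamma> g" if \<epsilon>: "\<epsilon> \<in> {0<..1}" for \<epsilon>
  proof -
    define \<eta> where "\<eta> = \<epsilon> powr \<alpha>"
    have \<eta>: "0 < \<eta>" "\<eta> \<le> 1" using \<epsilon> al by (auto simp: \<eta>_def powr_le1)
    define b where "b t = a t + M * \<eta>" for t
    define g where "g t = 1 / \<epsilon> + 2 / (t + \<eta>) + 2 / (T - t + \<eta>)" for t
    define \<Gamma> where "\<Gamma> t = t / \<epsilon> + 2 * (ln (t + \<eta>) - ln \<eta>) + 2 * (ln (T + \<eta>) - ln (T - t + \<eta>))" for t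
    have gpos: "0 \<le> g t" if "t \<in> {0..T}" for t using that \<epsilon> \<eta> by (simp add: g_def)
    have slope: "\<bar>a' t\<bar> \<le> g t * b t" if t: "t \<in> {0..T}" for t
    proof -
      have bpos: "b t \<ge> M * \<eta>" "b t \<ge> 0" using pos t M \<eta> by (auto simp: b_def)
      have key: "\<bar>a' t\<bar> \<le> 1 / \<epsilon> * b t + 2 / (l + \<eta>) * b t"
        if l: "l \<ge> 0" and dir: "\<And>k. 0 \<le> k \<Longrightarrow> k \<le> l \<Longrightarrow> 0 \<le> a t - \<bar>a' t\<bar> * k + M * k powr \<alpha>" for l
      proof (cases "\<epsilon> \<le> l")
        case True
        then have "\<bar>a' t\<bar> * \<epsilon> \<le> b t" using dir[of \<epsilon>] \<epsilon> by (simp add: b_def \<eta>_def)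
        then have "\<bar>a' t\<bar> \<le> 1 / \<epsilon> * b t" using \<epsilon> by (simp add: field_simps)
        moreover have "0 \<le> 2 / (l + \<eta>) * b t" using l \<eta> bpos by simp
        ultimately show ?thesis by linarith
      next
        case False
        have "M * l powr \<alpha> \<le> M * \<eta>" using False l al M unfolding \<eta>_def by (intro mult_left_mono powr_mono2) auto
        then have "\<bar>a' t\<bar> * l \<le> b t" using dir[of l] l by (simp add: b_def)
        moreover have "\<bar>a' t\<bar> * \<eta> \<le> b t"
          using mult_right_mono[OF sup[OF t], of \<eta>] \<eta> bpos by linarith
        ultimately have "\<bar>a' t\<bar> * (l + \<eta>) \<le> 2 * b t" by (simp add: algebra_simps)
        then have "\<bar>a' t\<bar> \<le> 2 / (l + \<eta>) * b t" using l \<eta> by (simp add: field_simps)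
        moreover have "0 \<le> 1 / \<epsilon> * b t" using \<epsilon> bpos by simp
        ultimately show ?thesis by linarith
      qed
      have nn: "0 \<le> 2 / (t + \<eta>) * b t" "0 \<le> 2 / (T - t + \<eta>) * b t" using t \<eta> bpos by auto
      show ?thesis
      proof (cases "a' t \<ge> 0")
        case True
        have "\<bar>a' t\<bar> \<le> 1 / \<epsilon> * b t + 2 / (t + \<eta>) * b t"
        proof (rule key)
          show "0 \<le> a t - \<bar>a' t\<bar> * k + M * k powr \<alpha>" if "0 \<le> k" "k \<le> t" for k
            using taylor[of t "t - k"] t that True by simp
        qed (use t in simp)
        then show ?thesis using nn by (simp add: g_def algebra_simps)
      next
        case False
        have "\<bar>a' t\<bar> \<le> 1 / \<epsilon> * b t + 2 / (T - t + \<eta>) * b t"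
        proof (rule key)
          show "0 \<le> a t - \<bar>a' t\<bar> * k + M * k powr \<alpha>" if "0 \<le> k" "k \<le> T - t" for k
            using taylor[of t "t + k"] t that False by simp
        qed (use t in simp)
        then show ?thesis using nn by (simp add: g_def algebra_simps)
      qed
    qed
    have \<Gamma>d: "(\<Gamma> has_real_derivative g t) (at t within {0..T})" if t: "t \<in> {0..T}" for t
    proof -
      have p: "t + \<eta> > 0" "T - t + \<eta> > 0" using t \<eta> by auto
      have 1: "((\<lambda>t. ln (t + \<eta>)) has_real_derivative 1 / (t + \<eta>)) (at t within {0..T})"
        using p by (auto intro!: derivative_eq_intros)
      have 2: "((\<lambda>t. ln (T - t + \<eta>)) has_real_derivative - (1 / (T - t + \<eta>))) (at t within {0..T})"
        using p by (auto intro!: derivative_eq_intros)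
      have 3: "((\<lambda>t. t / \<epsilon>) has_real_derivative 1 / \<epsilon>) (at t within {0..T})"
        using \<epsilon> by (auto intro!: derivative_eq_intros)
      show ?thesis unfolding \<Gamma>_def g_def
        by (rule derivative_eq_intros 1 2 3 refl)+ simp
    qed
    have lnb: "ln (T + \<eta>) - ln \<eta> \<le> 2 * sqrt T / \<epsilon>"
    proof -
      have "ln (T + \<eta>) - ln \<eta> = ln (1 + T / \<eta>)"
      proof -
        have "1 + T / \<eta> = (T + \<eta>) / \<eta>" using \<eta> by (simp add: field_simps)
        then show ?thesis using T \<eta> by (simp add: ln_div)
      qed
      also have "\<dots> \<le> 2 * sqrt (T / \<eta>)" using T \<eta> by (intro ln_one_plus_le_sqrt) auto
      also have "\<dots> = 2 * sqrt T / sqrt \<eta>" by (simp add: real_sqrt_divide)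
      also have "\<dots> \<le> 2 * sqrt T / \<epsilon>"
      proof (rule divide_left_mono)
        have "\<epsilon> powr 2 \<le> \<epsilon> powr \<alpha>" using \<epsilon> al by (intro powr_mono') auto
        then have "\<epsilon>\<^sup>2 \<le> \<eta>" using \<epsilon> by (simp add: \<eta>_def powr_numeral)
        then show "\<epsilon> \<le> sqrt \<eta>" by (rule real_le_rsqrt)
      qed (use T \<epsilon> \<eta> in auto)
      finally show ?thesis .
    qed
    have "regularized \<alpha> T a C \<epsilon> \<Lambda> b a' \<Gamma> g"
      unfolding regularized_def
    proof (intro ballI conjI)
      fix t assume t: "t \<in> {0..T}"
      have at0: "a t \<ge> 0" using pos t by auto
      show b0: "0 \<le> b t" using at0 M \<eta> by (simp add: b_def)
      have "M * \<eta> \<le> M" using M \<eta> by simp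
      then show "b t \<le> C" using M3(2)[OF t] by (simp add: b_def C_def)
      have "M * \<eta> = sqrt M * \<epsilon> powr (\<alpha>/2) * sqrt (M * \<eta>)"
      proof -
        have "sqrt M * \<epsilon> powr (\<alpha>/2) * sqrt (M * \<eta>) = (sqrt M * sqrt M) * (\<epsilon> powr (\<alpha>/2) * \<epsilon> powr (\<alpha>/2))"
          unfolding \<eta>_def real_sqrt_mult sqrt_powr by (simp only: ac_simps)
        then show ?thesis using M by (simp only: powr_half_square \<eta>_def) simp
      qed
      also have "\<dots> \<le> C * \<epsilon> powr (\<alpha>/2) * sqrt (b t)"
      proof (intro mult_mono)
        have "sqrt M \<le> M" using M by (simp add: real_le_lsqrt power2_eq_square sqrt_le_D)
        then show "sqrt M \<le> C" using M3 by (simp add: C_def)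
      qed (use at0 M3 M \<eta> in \<open>auto simp: b_def C_def\<close>)
      finally show "\<bar>a t - b t\<bar> \<le> C * \<epsilon> powr (\<alpha>/2) * sqrt (b t)" using M \<eta> by (simp add: b_def)
      show "(b has_real_derivative a' t) (at t within {0..T})"
        unfolding b_def by (auto intro!: derivative_eq_intros da[OF t])
      show "\<bar>a' t\<bar> \<le> g t * b t" by (rule slope[OF t])
      show "0 \<le> g t" by (rule gpos[OF t])
      show "(\<Gamma> has_real_derivative g t) (at t within {0..T})" by (rule \<Gamma>d[OF t])
      have *: "ln \<eta> \<le> ln (t + \<eta>)" "ln (t + \<eta>) \<le> ln (T + \<eta>)" "ln (T - t + \<eta>) \<le> ln (T + \<eta>)" "ln \<eta> \<le> ln (T - t + \<eta>)"
        using t \<eta> by auto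
      have **: "0 \<le> t / \<epsilon>" "t / \<epsilon> \<le> T / \<epsilon>" using t \<epsilon> by (auto simp: divide_right_mono)
      show "0 \<le> \<Gamma> t" unfolding \<Gamma>_def by (rule nonneg_of_log_increments[OF *(1,3) **(1)])
      have "\<Lambda> / \<epsilon> = T / \<epsilon> + 4 * (2 * sqrt T / \<epsilon>) + 1 / \<epsilon>" by (simp add: \<Lambda>_def add_divide_distrib)
      moreover have "1 / \<epsilon> \<ge> 0" using \<epsilon> by simp
      ultimately show "\<Gamma> t \<le> \<Lambda> / \<epsilon>" unfolding \<Gamma>_def by (intro le_of_log_increments[OF *(2,4) **(2) lnb])
    qed
    then show ?thesis by blast
  qed
  ultimately show ?thesis by blast
qed

lemma regularize_C_alpha:
  assumes "T > 0" "0 < \<alpha>" "\<alpha> < 2" "C_alpha \<alpha> T a" "\<forall>t\<in>{0..T}. a t \<ge> 0"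
  shows "\<exists>C>0. \<exists>\<Lambda>>0. \<forall>\<epsilon>\<in>{0<..1}. \<exists>b b' \<Gamma> g. regularized \<alpha> T a C \<epsilon> \<Lambda> b b' \<Gamma> g"
proof (cases "\<alpha> \<le> 1")
  case True
  then show ?thesis using assms regularize_holder[of T \<alpha> a] by (simp add: C_alpha_def)
next
  case False
  then obtain a' where "\<And>t. t \<in> {0..T} \<Longrightarrow> (a has_real_derivative a' t) (at t within {0..T})"
      "continuous_on {0..T} a'" "holder_on (\<alpha> - 1) T a'"
    using assms(4) unfolding C_alpha_def by (auto simp only: if_False)
  then show ?thesis using regularize_C1_holder[of T \<alpha> a a'] assms False by simp
qed

section \<open>Energy estimate and uniqueness for the scalar equation\<close>

lemma DERIV_nonpos_within_imp_le:
  fixes F :: "real \<Rightarrow> real"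
  assumes ab: "a \<le> b" and d: "\<And>t. t \<in> {a..b} \<Longrightarrow> (F has_real_derivative F' t) (at t within {a..b})"
    and le: "\<And>t. t \<in> {a..b} \<Longrightarrow> F' t \<le> 0"
  shows "F b \<le> F a"
proof (cases "a < b")
  case True
  have "\<exists>z\<in>{a<..<b}. F b - F a = F' z * (b - a)"
    by (rule mvt_simple[OF True]) (use d in \<open>auto simp: has_field_derivative_def\<close>)
  then obtain z where "z \<in> {a<..<b}" "F b - F a = F' z * (b - a)" by blast
  then show ?thesis using le[of z] True mult_nonpos_nonneg[of "F' z" "b - a"] by auto
qed (use ab in auto)

lemma has_vector_derivative_cmod_square:
  fixes y :: "real \<Rightarrow> complex"
  assumes "(y has_vector_derivative y') (at t within S)"
  shows "((\<lambda>t. (cmod (y t))\<^sup>2) has_real_derivative 2 * Re (y' * cnj (y t))) (at t within S)"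
proof -
  have "((\<lambda>t. Re (y t)) has_real_derivative Re y') (at t within S)"
    "((\<lambda>t. Im (y t)) has_real_derivative Im y') (at t within S)"
    by (metis has_vector_derivative_complex_iff assms)+
  then have "((\<lambda>t. (Re (y t))\<^sup>2 + (Im (y t))\<^sup>2) has_real_derivative 2 * Re (y' * cnj (y t))) (at t within S)"
    by (intro DERIV_cong[OF DERIV_add[OF DERIV_power DERIV_power]]) (auto simp: algebra_simps)
  then show ?thesis by (simp add: cmod_power2)
qed

text \<open>The left-hand side is the derivative of the energy \<open>E\<close> along the system. The products
\<open>\<mu> * Re (y * cnj z)\<close> with coefficients \<open>a\<close> and \<open>b\<close> cancel up to \<open>b - a\<close>, and this remainder is
controlled because \<open>\<mu> * sqrt b * \<bar>y\<bar> * \<bar>z\<bar>\<close> is at most \<open>sqrt \<mu> * E\<close>.\<close>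

lemma energy_derivative_bound:
  fixes y z f :: complex and a b b' g Q \<mu> \<kappa> B :: real
  assumes mu: "\<mu> \<ge> 0" and b: "b \<ge> 0" and ab: "\<bar>a - b\<bar> \<le> \<kappa> * sqrt b" and b': "\<bar>b'\<bar> \<le> g * b" and g: "g \<ge> 0"
    and kap: "\<kappa> \<ge> 0" and Q: "\<bar>Q\<bar> \<le> B"
  defines "E \<equiv> (cmod z)\<^sup>2 + (\<mu> * b + 1) * (cmod y)\<^sup>2"
  shows "2 * Re ((f - of_real (a * \<mu>) * y + of_real Q * z - of_real (Q\<^sup>2) * y) * cnj z)
      + (\<mu> * b' * (cmod y)\<^sup>2 + (\<mu> * b + 1) * (2 * Re ((z - of_real Q * y) * cnj y)))
    \<le> (g + \<kappa> * sqrt \<mu> + (2 + 2 * B + B\<^sup>2)) * E + (cmod f)\<^sup>2"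
proof -
  have B: "B \<ge> 0" using Q by linarith
  have reyz: "\<bar>Re (y * cnj z)\<bar> \<le> cmod y * cmod z" by (metis abs_Re_le_cmod complex_mod_cnj norm_mult)
  have "Re (f * cnj z) \<le> cmod f * cmod z" by (metis complex_Re_le_cmod complex_mod_cnj norm_mult)
  then have t1: "2 * Re (f * cnj z) \<le> (cmod f)\<^sup>2 + (cmod z)\<^sup>2" using sum_squares_bound[of "cmod f" "cmod z"] by linarith
  have comm: "Re (z * cnj y) = Re (y * cnj z)" by simp
  have lhs: "2 * Re ((f - of_real (a * \<mu>) * y + of_real Q * z - of_real (Q\<^sup>2) * y) * cnj z)
      + (\<mu> * b' * (cmod y)\<^sup>2 + (\<mu> * b + 1) * (2 * Re ((z - of_real Q * y) * cnj y)))
    = 2 * Re (f * cnj z) + 2 * \<mu> * (b - a) * Re (y * cnj z) + 2 * (1 - Q\<^sup>2) * Re (y * cnj z) + 2 * Q * (cmod z)\<^sup>2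
      + \<mu> * b' * (cmod y)\<^sup>2 - 2 * Q * ((\<mu> * b + 1) * (cmod y)\<^sup>2)"
    unfolding cmod_power2 by (simp add: algebra_simps power2_eq_square)
  have Ey: "\<mu> * b * (cmod y)\<^sup>2 \<ge> 0" using mu b by simp
  have t2: "2 * \<mu> * (b - a) * Re (y * cnj z) \<le> \<kappa> * sqrt \<mu> * E"
  proof -
    have "2 * \<mu> * (b - a) * Re (y * cnj z) \<le> \<bar>2 * \<mu> * (b - a) * Re (y * cnj z)\<bar>" by simp
    also have "\<dots> = 2 * \<mu> * \<bar>a - b\<bar> * \<bar>Re (y * cnj z)\<bar>" using mu by (simp add: abs_mult abs_minus_commute)
    also have "\<dots> \<le> 2 * \<mu> * (\<kappa> * sqrt b) * (cmod y * cmod z)"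
      using mu ab reyz kap b by (intro mult_mono) auto
    also have "\<dots> = \<kappa> * sqrt \<mu> * (2 * (sqrt \<mu> * sqrt b * cmod y) * cmod z)"
      using real_sqrt_mult_self[of \<mu>] mu by (simp add: algebra_simps)
    also have "\<dots> \<le> \<kappa> * sqrt \<mu> * ((sqrt \<mu> * sqrt b * cmod y)\<^sup>2 + (cmod z)\<^sup>2)"
      using kap mu by (intro mult_left_mono sum_squares_bound) auto
    also have "\<dots> \<le> \<kappa> * sqrt \<mu> * E"
      using kap mu b by (intro mult_left_mono) (auto simp: E_def power_mult_distrib algebra_simps)
    finally show ?thesis .
  qed
  have t3: "2 * (1 - Q\<^sup>2) * Re (y * cnj z) \<le> (1 + B\<^sup>2) * E"
  proof -
    have Q2: "\<bar>1 - Q\<^sup>2\<bar> \<le> 1 + B\<^sup>2" using abs_le_square_iff[of Q B] Q B by (auto simp: abs_le_iff)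
    have "2 * (1 - Q\<^sup>2) * Re (y * cnj z) \<le> \<bar>2 * (1 - Q\<^sup>2) * Re (y * cnj z)\<bar>" by simp
    also have "\<dots> = \<bar>1 - Q\<^sup>2\<bar> * (2 * \<bar>Re (y * cnj z)\<bar>)" by (simp only: abs_mult abs_numeral ac_simps)
    also have "\<dots> \<le> (1 + B\<^sup>2) * (2 * (cmod y * cmod z))" using Q2 reyz by (intro mult_mono) auto
    also have "\<dots> \<le> (1 + B\<^sup>2) * ((cmod y)\<^sup>2 + (cmod z)\<^sup>2)"
      using sum_squares_bound[of "cmod y" "cmod z"] by (intro mult_left_mono) (auto simp: mult.assoc)
    also have "\<dots> \<le> (1 + B\<^sup>2) * E" using Ey by (intro mult_left_mono) (auto simp: E_def algebra_simps)
    finally show ?thesis .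
  qed
  have t4: "2 * Q * (cmod z)\<^sup>2 - 2 * Q * ((\<mu> * b + 1) * (cmod y)\<^sup>2) \<le> 2 * B * E"
  proof -
    have "2 * Q * (cmod z)\<^sup>2 \<le> 2 * B * (cmod z)\<^sup>2" using Q by (intro mult_right_mono) auto
    moreover have "- 2 * Q * ((\<mu> * b + 1) * (cmod y)\<^sup>2) \<le> 2 * B * ((\<mu> * b + 1) * (cmod y)\<^sup>2)"
      using Q mu b by (intro mult_right_mono) auto
    ultimately show ?thesis by (simp add: E_def algebra_simps)
  qed
  have t5: "\<mu> * b' * (cmod y)\<^sup>2 \<le> g * E"
  proof -
    have "\<mu> * b' * (cmod y)\<^sup>2 \<le> \<mu> * (g * b) * (cmod y)\<^sup>2" using mu b' by (intro mult_right_mono mult_left_mono) auto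
    also have "\<dots> = g * (\<mu> * b * (cmod y)\<^sup>2)" by simp
    also have "\<dots> \<le> g * E" using g by (intro mult_left_mono) (auto simp: E_def algebra_simps)
    finally show ?thesis .
  qed
  have "(cmod z)\<^sup>2 \<le> E" using Ey by (simp add: E_def algebra_simps)
  then show ?thesis unfolding lhs using t1 t2 t3 t4 t5 by (simp add: algebra_simps)
qed

text \<open>Gronwall's argument for the energy. The forcing term is kept as an integral of \<open>\<bar>f\<bar>\<^sup>2\<close>, not as a
supremum: the estimates of all coefficients are to be summed, and only integrals commute with
this summation.\<close>

lemma energy_estimate:
  fixes y z f :: "real \<Rightarrow> complex" and a b b' g \<Gamma> Q :: "real \<Rightarrow> real"
  assumes T: "T \<ge> 0" and mu: "\<mu> \<ge> 0" and kap: "\<kappa> \<ge> 0"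
    and dy: "\<And>t. t \<in> {0..T} \<Longrightarrow> (y has_vector_derivative z t - of_real (Q t) * y t) (at t within {0..T})"
    and dz: "\<And>t. t \<in> {0..T} \<Longrightarrow> (z has_vector_derivative
        f t - of_real (a t * \<mu>) * y t + of_real (Q t) * z t - of_real ((Q t)\<^sup>2) * y t) (at t within {0..T})"
    and f: "continuous_on {0..T} f"
    and Q: "\<And>t. t \<in> {0..T} \<Longrightarrow> \<bar>Q t\<bar> \<le> B"
    and b: "\<And>t. t \<in> {0..T} \<Longrightarrow> b t \<ge> 0" and ab: "\<And>t. t \<in> {0..T} \<Longrightarrow> \<bar>a t - b t\<bar> \<le> \<kappa> * sqrt (b t)"
    and db: "\<And>t. t \<in> {0..T} \<Longrightarrow> (b has_real_derivative b' t) (at t within {0..T})"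
    and b': "\<And>t. t \<in> {0..T} \<Longrightarrow> \<bar>b' t\<bar> \<le> g t * b t" and g: "\<And>t. t \<in> {0..T} \<Longrightarrow> 0 \<le> g t"
    and dG: "\<And>t. t \<in> {0..T} \<Longrightarrow> (\<Gamma> has_real_derivative g t) (at t within {0..T})"
    and G: "\<And>t. t \<in> {0..T} \<Longrightarrow> 0 \<le> \<Gamma> t \<and> \<Gamma> t \<le> G"
    and t: "t \<in> {0..T}"
  shows "(cmod (z t))\<^sup>2 + (cmod (y t))\<^sup>2 \<le> exp (G + (\<kappa> * sqrt \<mu> + (2 + 2 * B + B\<^sup>2)) * T) *
     ((cmod (z 0))\<^sup>2 + (\<mu> * b 0 + 1) * (cmod (y 0))\<^sup>2 + integral {0..T} (\<lambda>r. (cmod (f r))\<^sup>2))"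
proof -
  define c where "c = \<kappa> * sqrt \<mu> + (2 + 2 * B + B\<^sup>2)"
  have "B \<ge> 0" using Q[of 0] T by force
  then have c0: "c \<ge> 0" using kap mu by (simp add: c_def)
  define E where "E t = (cmod (z t))\<^sup>2 + (\<mu> * b t + 1) * (cmod (y t))\<^sup>2" for t
  define W where "W t = exp (- (\<Gamma> t + c * t))" for t
  define J where "J t = integral {0..t} (\<lambda>r. (cmod (f r))\<^sup>2)" for t
  have fc: "continuous_on {0..T} (\<lambda>r. (cmod (f r))\<^sup>2)" by (intro continuous_intros f)
  define F where "F t = W t * E t - J t" for t
  define E' where "E' t = 2 * Re ((f t - of_real (a t * \<mu>) * y t + of_real (Q t) * z t - of_real ((Q t)\<^sup>2) * y t) * cnj (z t))
      + (\<mu> * b' t * (cmod (y t))\<^sup>2 + (\<mu> * b t + 1) * (2 * Re ((z t - of_real (Q t) * y t) * cnj (y t))))" for t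
  have E0: "E t \<ge> 0" if "t \<in> {0..T}" for t using mu b[OF that] by (simp add: E_def)
  have EE: "E' t \<le> (g t + c) * E t + (cmod (f t))\<^sup>2" if "t \<in> {0..T}" for t
    unfolding E'_def E_def c_def
    using energy_derivative_bound[OF mu b[OF that] ab[OF that] b'[OF that] g[OF that] kap Q[OF that], of "f t" "y t" "z t"]
    by (simp add: algebra_simps)
  have dE: "(E has_real_derivative E' t) (at t within {0..T})" if "t \<in> {0..T}" for t
    unfolding E_def E'_def
    by (rule DERIV_cong[OF DERIV_add[OF has_vector_derivative_cmod_square[OF dz[OF that]]
            DERIV_mult[OF DERIV_add[OF DERIV_cmult[OF db[OF that]] DERIV_const] has_vector_derivative_cmod_square[OF dy[OF that]]]]]) simp
  have dW: "(W has_real_derivative - (g t + c) * W t) (at t within {0..T})" if "t \<in> {0..T}" for t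
    unfolding W_def using dG[OF that] by (auto intro!: derivative_eq_intros)
  have dJ: "(J has_real_derivative (cmod (f t))\<^sup>2) (at t within {0..T})" if "t \<in> {0..T}" for t
    unfolding J_def by (rule integral_has_real_derivative[OF fc that])
  have dF: "(F has_real_derivative - (g t + c) * W t * E t + W t * E' t - (cmod (f t))\<^sup>2) (at t within {0..T})"
    if "t \<in> {0..T}" for t
    unfolding F_def using dE[OF that] dW[OF that] dJ[OF that]
    by (auto intro!: derivative_eq_intros simp: algebra_simps)
  have "F t \<le> F 0"
  proof (rule DERIV_nonpos_within_imp_le[where F = F and a = 0 and b = t and F' = "\<lambda>t. - (g t + c) * W t * E t + W t * E' t - (cmod (f t))\<^sup>2"])
    fix r assume "r \<in> {0..t}"
    then have r: "r \<in> {0..T}" using t by auto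
    show "(F has_real_derivative - (g r + c) * W r * E r + W r * E' r - (cmod (f r))\<^sup>2) (at r within {0..t})"
      by (rule DERIV_subset[OF dF[OF r]]) (use t in auto)
    have W: "0 \<le> W r" "W r \<le> 1" using G[OF r] mult_nonneg_nonneg[OF c0, of r] r by (auto simp: W_def)
    have "W r * E' r \<le> W r * ((g r + c) * E r + (cmod (f r))\<^sup>2)" by (intro mult_left_mono EE r W)
    moreover have "W r * (cmod (f r))\<^sup>2 \<le> 1 * (cmod (f r))\<^sup>2" by (intro mult_right_mono W) auto
    ultimately show "- (g r + c) * W r * E r + W r * E' r - (cmod (f r))\<^sup>2 \<le> 0" by (simp add: algebra_simps)
  qed (use t in auto)
  then have "W t * E t \<le> W 0 * E 0 + J t" by (simp add: F_def J_def)
  also have "\<dots> \<le> E 0 + J T"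
  proof -
    have "W 0 * E 0 \<le> 1 * E 0" using G[of 0] T E0[of 0] by (intro mult_right_mono) (auto simp: W_def)
    moreover have "J t \<le> J T" unfolding J_def using t
      by (intro integral_subset_le integrable_continuous_interval continuous_on_subset[OF fc]) auto
    ultimately show ?thesis by simp
  qed
  finally have WE: "W t * E t \<le> E 0 + J T" .
  have rhs0: "0 \<le> E 0 + J T" using E0[of 0] T unfolding J_def
    by (intro add_nonneg_nonneg integral_nonneg integrable_continuous_interval fc) auto
  have "(cmod (z t))\<^sup>2 + (cmod (y t))\<^sup>2 \<le> E t" using mu b[OF t] by (simp add: E_def algebra_simps)
  also have "E t = exp (\<Gamma> t + c * t) * (W t * E t)"
    using exp_minus_inverse[of "\<Gamma> t + c * t"] by (simp add: W_def mult.assoc[symmetric])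
  also have "\<dots> \<le> exp (\<Gamma> t + c * t) * (E 0 + J T)" using WE by (intro mult_left_mono) auto
  also have "\<dots> \<le> exp (G + c * T) * (E 0 + J T)"
    using G[OF t] t c0 rhs0 by (intro mult_right_mono) (auto intro!: add_mono mult_left_mono)
  finally show ?thesis by (simp add: E_def J_def c_def)
qed

lemma lipschitz_on_compact_bounded:
  fixes y :: "real \<Rightarrow> complex"
  assumes "\<And>s t. s \<in> {0..T} \<Longrightarrow> t \<in> {0..T} \<Longrightarrow> cmod (y s - y t) \<le> L * \<bar>s - t\<bar>" "t \<in> {0..T}"
  shows "cmod (y t) \<le> cmod (y 0) + L * T"
proof -
  have "0 \<le> L * \<bar>t - 0\<bar>" using order_trans[OF norm_ge_zero assms(1)[of t 0]] assms(2) by auto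
  have "cmod (y t) \<le> cmod (y 0) + cmod (y t - y 0)" by (metis add.commute diff_add_cancel norm_triangle_ineq)
  also have "cmod (y t - y 0) \<le> L * \<bar>t - 0\<bar>" using assms by (intro assms(1)) auto
  also have "L * \<bar>t - 0\<bar> \<le> L * T"
  proof (cases "t = 0")
    case True
    have "0 \<le> L * \<bar>T - 0\<bar>" using order_trans[OF norm_ge_zero assms(1)[of T 0]] assms(2) by auto
    then show ?thesis using True assms(2) by auto
  next
    case False
    then have "L \<ge> 0" using \<open>0 \<le> L * \<bar>t - 0\<bar>\<close> assms(2) by (auto simp: zero_le_mult_iff)
    then show ?thesis using assms(2) by (intro mult_left_mono) auto
  qed
  finally show ?thesis by simp
qed

lemma vector_derivative_bound_imp_lipschitz:
  fixes d :: "real \<Rightarrow> 'a::real_normed_vector"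
  assumes S: "convex S" and d: "\<And>t. t \<in> S \<Longrightarrow> (d has_vector_derivative d1 t) (at t within S)"
    and R: "\<And>t. t \<in> S \<Longrightarrow> norm (d1 t) \<le> R" and sr: "s \<in> S" "r \<in> S"
  shows "norm (d s - d r) \<le> R * \<bar>s - r\<bar>"
proof -
  have "norm (d s - d r) \<le> R * norm (s - r)"
  proof (rule differentiable_bound[OF S _ _ sr])
    show "(d has_derivative (\<lambda>h. h *\<^sub>R d1 t)) (at t within S)" if "t \<in> S" for t
      using d[OF that] by (simp add: has_vector_derivative_def)
    show "onorm (\<lambda>h. h *\<^sub>R d1 t) \<le> R" if "t \<in> S" for t
      by (rule onorm_le) (simp add: mult.commute[of R] mult_left_mono[OF R[OF that]])
  qed
  then show ?thesis by simp
qed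

lemma cmod_square_lipschitz:
  assumes "cmod x \<le> R" "cmod y \<le> R"
  shows "\<bar>(cmod x)\<^sup>2 - (cmod y)\<^sup>2\<bar> \<le> 2 * R * cmod (x - y)"
proof -
  have "\<bar>(cmod x)\<^sup>2 - (cmod y)\<^sup>2\<bar> = (cmod x + cmod y) * \<bar>cmod x - cmod y\<bar>"
    by (simp add: power2_eq_square square_diff_square_factored abs_mult)
  also have "\<dots> \<le> (2 * R) * cmod (x - y)" using assms norm_triangle_ineq3[of x y] order_trans[OF norm_ge_zero assms(1)] by (intro mult_mono) auto
  finally show ?thesis .
qed

text \<open>As \<open>d1\<close> is differentiable only almost everywhere, the usual argument that
\<open>exp (- K * t) * (\<bar>d\<bar>\<^sup>2 + \<bar>d1\<bar>\<^sup>2)\<close> decreases rests on the Lipschitz continuity of this function.\<close>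

lemma second_order_uniqueness:
  fixes d d1 :: "real \<Rightarrow> complex" and p :: "real \<Rightarrow> real"
  assumes T: "T > 0"
    and dd: "\<And>t. t \<in> {0..T} \<Longrightarrow> (d has_vector_derivative d1 t) (at t within {0..T})"
    and lip: "\<And>s t. s \<in> {0..T} \<Longrightarrow> t \<in> {0..T} \<Longrightarrow> cmod (d1 s - d1 t) \<le> L * \<bar>s - t\<bar>"
    and N: "negligible N"
    and eq: "\<And>t. t \<in> {0..T} - N \<Longrightarrow> (d1 has_vector_derivative - of_real (p t) * d t) (at t within {0..T}) \<and> \<bar>p t\<bar> \<le> P"
    and init: "d 0 = 0" "d1 0 = 0" and t: "t \<in> {0..T}"
  shows "d t = 0"
proof -
  define R1 where "R1 = cmod (d1 0) + L * T"
  have R1: "cmod (d1 s) \<le> R1" if "s \<in> {0..T}" for s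
    unfolding R1_def by (rule lipschitz_on_compact_bounded[OF lip that])
  have L: "L \<ge> 0" using order_trans[OF norm_ge_zero lip[of 0 T]] T by (simp add: zero_le_mult_iff)
  have lipd: "cmod (d s - d r) \<le> R1 * \<bar>s - r\<bar>" if "s \<in> {0..T}" "r \<in> {0..T}" for s r
  proof -
    show ?thesis using vector_derivative_bound_imp_lipschitz[of "{0..T}" d d1 R1 s r] dd R1 that by simp
  qed
  define R0 where "R0 = cmod (d 0) + R1 * T"
  have R0: "cmod (d s) \<le> R0" if "s \<in> {0..T}" for s
    unfolding R0_def by (rule lipschitz_on_compact_bounded[OF lipd that])
  have R01: "R0 \<ge> 0" "R1 \<ge> 0" using order_trans[OF norm_ge_zero R0[of 0]] order_trans[OF norm_ge_zero R1[of 0]] T by auto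
  define K where "K = 1 + \<bar>P\<bar>"
  define E where "E s = (cmod (d s))\<^sup>2 + (cmod (d1 s))\<^sup>2" for s
  define F where "F s = exp (- K * s) * E s" for s
  have Elip: "\<bar>E s - E r\<bar> \<le> (2 * R0 * R1 + 2 * R1 * L) * \<bar>s - r\<bar>" if "s \<in> {0..T}" "r \<in> {0..T}" for s r
  proof -
    have "\<bar>(cmod (d s))\<^sup>2 - (cmod (d r))\<^sup>2\<bar> \<le> 2 * R0 * (R1 * \<bar>s - r\<bar>)"
      by (rule order_trans[OF cmod_square_lipschitz[OF R0[OF that(1)] R0[OF that(2)]]])
        (use lipd[OF that] R01 in \<open>intro mult_left_mono, auto\<close>)
    moreover have "\<bar>(cmod (d1 s))\<^sup>2 - (cmod (d1 r))\<^sup>2\<bar> \<le> 2 * R1 * (L * \<bar>s - r\<bar>)"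
      by (rule order_trans[OF cmod_square_lipschitz[OF R1[OF that(1)] R1[OF that(2)]]])
        (use lip[OF that] R01 in \<open>intro mult_left_mono, auto\<close>)
    ultimately show ?thesis by (simp add: E_def algebra_simps)
  qed
  have Ebd: "\<bar>E s\<bar> \<le> R0\<^sup>2 + R1\<^sup>2" if "s \<in> {0..T}" for s
    using R0[OF that] R1[OF that] by (simp add: E_def add_mono power_mono)
  have ex1: "exp (- K * z) \<le> 1" if "z \<in> {0..T}" for z
  proof -
    have "0 \<le> K * z" using that by (simp add: K_def)
    then show ?thesis by simp
  qed
  have exlip: "\<bar>exp (- K * s) - exp (- K * r)\<bar> \<le> K * \<bar>s - r\<bar>" if "s \<in> {0..T}" "r \<in> {0..T}" for s r
  proof -
    have "norm (exp (- K * s) - exp (- K * r)) \<le> K * norm (s - r)"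
    proof (rule field_differentiable_bound[of "{0..T}" "\<lambda>s. exp (- K * s)" "\<lambda>s. exp (- K * s) * (- K)"])
      show "((\<lambda>s. exp (- K * s)) has_field_derivative exp (- K * z) * (- K)) (at z within {0..T})" for z
        by (auto intro!: derivative_eq_intros)
      show "norm (exp (- K * z) * (- K)) \<le> K" if "z \<in> {0..T}" for z
        using mult_right_mono[OF ex1[OF that], of K] by (simp add: abs_mult K_def add.commute)
    qed (use that in auto)
    then show ?thesis by simp
  qed
  have "F t \<le> F 0"
  proof (rule lipschitz_AE_deriv_nonpos_imp_decreasing[where \<phi> = F and a = 0 and b = t and N = N and L = "K * (R0\<^sup>2 + R1\<^sup>2) + (2 * R0 * R1 + 2 * R1 * L)"])
    fix s r assume "s \<in> {0..t}" "r \<in> {0..t}"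
    then have sr: "s \<in> {0..T}" "r \<in> {0..T}" using t by auto
    have "F s - F r = (exp (- K * s) - exp (- K * r)) * E s + exp (- K * r) * (E s - E r)"
      by (simp add: F_def algebra_simps)
    then have "\<bar>F s - F r\<bar> \<le> \<bar>exp (- K * s) - exp (- K * r)\<bar> * \<bar>E s\<bar> + exp (- K * r) * \<bar>E s - E r\<bar>"
      by (metis abs_exp_cancel abs_mult abs_triangle_ineq)
    also have "\<dots> \<le> (K * \<bar>s - r\<bar>) * (R0\<^sup>2 + R1\<^sup>2) + 1 * ((2 * R0 * R1 + 2 * R1 * L) * \<bar>s - r\<bar>)"
      using exlip[OF sr] Ebd[OF sr(1)] Elip[OF sr] ex1[OF sr(2)]
      by (intro add_mono mult_mono) (auto simp: K_def)
    finally show "\<bar>F s - F r\<bar> \<le> (K * (R0\<^sup>2 + R1\<^sup>2) + (2 * R0 * R1 + 2 * R1 * L)) * \<bar>s - r\<bar>"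
      by (simp add: algebra_simps)
  next
    fix s assume s: "s \<in> {0..t} - N"
    then have sT: "s \<in> {0..T}" "s \<in> {0..T} - N" using t by auto
    define E' where "E' = 2 * Re (d1 s * cnj (d s)) + 2 * Re ((- of_real (p s) * d s) * cnj (d1 s))"
    have dE: "(E has_real_derivative E') (at s within {0..T})"
      unfolding E_def E'_def
      using eq[OF sT(2)] by (intro DERIV_add has_vector_derivative_cmod_square dd sT) auto
    have dex: "((\<lambda>s. exp (- K * s)) has_real_derivative exp (- K * s) * (- K)) (at s within {0..T})"
      by (auto intro!: derivative_eq_intros)
    have dF: "(F has_real_derivative exp (- K * s) * (- K) * E s + E' * exp (- K * s)) (at s within {0..T})"
      unfolding F_def by (rule DERIV_mult[OF dex dE])
    have "E' = 2 * (1 - p s) * Re (d s * cnj (d1 s))" by (simp add: E'_def algebra_simps)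
    also have "\<dots> \<le> \<bar>1 - p s\<bar> * (2 * \<bar>Re (d s * cnj (d1 s))\<bar>)"
    proof -
      have "2 * (1 - p s) * Re (d s * cnj (d1 s)) \<le> \<bar>2 * (1 - p s) * Re (d s * cnj (d1 s))\<bar>" by (rule abs_ge_self)
      also have "\<dots> = \<bar>1 - p s\<bar> * (2 * \<bar>Re (d s * cnj (d1 s))\<bar>)" by (simp only: abs_mult abs_numeral ac_simps)
      finally show ?thesis .
    qed
    also have "\<dots> \<le> K * (2 * (cmod (d s) * cmod (d1 s)))"
    proof (intro mult_mono)
      show "\<bar>1 - p s\<bar> \<le> K" using eq[OF sT(2)] by (auto simp: K_def)
      show "\<bar>Re (d s * cnj (d1 s))\<bar> \<le> cmod (d s) * cmod (d1 s)" by (metis abs_Re_le_cmod complex_mod_cnj norm_mult)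
    qed (auto simp: K_def)
    also have "\<dots> \<le> K * E s"
      using sum_squares_bound[of "cmod (d s)" "cmod (d1 s)"]
      by (intro mult_left_mono) (auto simp: E_def K_def mult.assoc)
    finally have "exp (- K * s) * E' \<le> exp (- K * s) * (K * E s)" by (intro mult_left_mono) auto
    then have "exp (- K * s) * (- K) * E s + E' * exp (- K * s) \<le> 0" by (simp add: algebra_simps)
    then show "\<exists>v\<le>0. (F has_real_derivative v) (at s within {0..t})"
      using DERIV_subset[OF dF, of "{0..t}"] t by (intro exI conjI) auto
  qed (use N t in auto)
  then have "E t \<le> 0" using init by (simp add: F_def E_def mult_le_0_iff)
  moreover have "(cmod (d t))\<^sup>2 \<ge> 0" "(cmod (d1 t))\<^sup>2 \<ge> 0" by auto
  ultimately have "(cmod (d t))\<^sup>2 = 0" unfolding E_def by linarith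
  then show ?thesis by simp
qed

section \<open>The coefficient equation in terms of the quasi-derivative\<close>

lemma AE_lebesgue_on_negligible:
  assumes "S \<in> sets lebesgue"
  shows "(AE t in lebesgue_on S. P t) \<longleftrightarrow> (\<exists>N. negligible N \<and> (\<forall>t\<in>S - N. P t))"
proof -
  have "(AE t in lebesgue_on S. P t) \<longleftrightarrow> (AE t in lebesgue. t \<in> S \<longrightarrow> P t)"
    using assms by (simp add: AE_restrict_space_iff)
  also have "\<dots> \<longleftrightarrow> (\<exists>N. negligible N \<and> (\<forall>t\<in>S - N. P t))"
    unfolding eventually_ae_filter_negligible by (intro ex_cong1 conj_cong refl) blast
  finally show ?thesis .
qed

lemma L_infinity_bounded_representative:
  assumes "L_infinity T q"
  obtains p M N where "integrable lebesgue p" "\<And>t. \<bar>p t\<bar> \<le> M" "negligible N" "\<And>t. t \<in> {0..T} - N \<Longrightarrow> p t = q t"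
proof -
  have q: "q \<in> borel_measurable (lebesgue_on {0..T})" using assms by (simp add: L_infinity_def)
  obtain M where "AE t in lebesgue_on {0..T}. \<bar>q t\<bar> \<le> M" using assms by (auto simp: L_infinity_def)
  then obtain N where N: "negligible N" "\<And>t. t \<in> {0..T} - N \<Longrightarrow> \<bar>q t\<bar> \<le> M"
    by (subst (asm) AE_lebesgue_on_negligible) auto
  define p where "p t = (if t \<in> {0..T} then (if \<bar>q t\<bar> \<le> M then q t else 0) else 0)" for t
  have "(\<lambda>t. if \<bar>q t\<bar> \<le> M then q t else 0) \<in> borel_measurable (lebesgue_on {0..T})" using q by measurable
  then have pm: "p \<in> borel_measurable lebesgue" unfolding p_def by (subst borel_measurable_if) auto
  have pb: "\<bar>p t\<bar> \<le> \<bar>M\<bar>" for t by (auto simp: p_def)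
  have "integrable lebesgue p"
  proof (rule Bochner_Integration.integrable_bound[OF _ pm])
    show "integrable lebesgue (\<lambda>t. \<bar>M\<bar> * indicator {0..T} t)"
      by (intro integrable_mult_right) (simp add: lmeasurable_iff_integrable[symmetric])
    show "AE t in lebesgue. norm (p t) \<le> norm (\<bar>M\<bar> * indicator {0..T} t)" by (auto simp: p_def)
  qed
  then show thesis using pb N by (intro that[of p "\<bar>M\<bar>" N]) (auto simp: p_def)
qed

lemma continuous_on_Icc_bounded:
  fixes f :: "real \<Rightarrow> real"
  assumes "continuous_on {0..T} f"
  obtains B where "B \<ge> 0" "\<And>t. t \<in> {0..T} \<Longrightarrow> \<bar>f t\<bar> \<le> B"
proof -
  obtain B where "\<forall>x\<in>f ` {0..T}. norm x \<le> B"
    using compact_imp_bounded[OF compact_continuous_image[OF assms compact_Icc]] unfolding bounded_iff by blast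
  then show thesis by (intro that[of "\<bar>B\<bar>"]) (auto intro: order_trans[OF _ abs_ge_self])
qed

text \<open>The system for \<open>y\<close> and its quasi-derivative \<open>z = y' + Q y\<close>; with \<open>Q' = q\<close> it is equivalent to
\<open>y'' + a \<mu> y + q y = f\<close>.\<close>

definition quasi_solution ::
    "real \<Rightarrow> (real \<Rightarrow> real) \<Rightarrow> (real \<Rightarrow> real) \<Rightarrow> real \<Rightarrow> (real \<Rightarrow> complex) \<Rightarrow> (real \<Rightarrow> complex) \<Rightarrow> (real \<Rightarrow> complex) \<Rightarrow> bool" where
  "quasi_solution T a Q \<mu> f y z \<longleftrightarrow> (\<forall>t\<in>{0..T}.
     (y has_vector_derivative z t - of_real (Q t) * y t) (at t within {0..T}) \<and>
     (z has_vector_derivative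
        f t - of_real (a t * \<mu>) * y t + of_real (Q t) * z t - of_real ((Q t)\<^sup>2) * y t) (at t within {0..T}))"

lemma quasi_derivative_system_exists:
  fixes a Q :: "real \<Rightarrow> real" and f :: "real \<Rightarrow> complex"
  assumes T: "T \<ge> 0" and a: "continuous_on {0..T} a" and Q: "continuous_on {0..T} Q" and f: "continuous_on {0..T} f"
  shows "\<exists>y z. y 0 = y0 \<and> z 0 = z0 \<and> quasi_solution T a Q \<mu> f y z"
proof -
  define G where "G t x = (snd x - of_real (Q t) * fst x,
     f t - of_real (a t * \<mu>) * fst x + of_real (Q t) * snd x - of_real ((Q t)\<^sup>2) * fst x)" for t and x :: "complex \<times> complex"
  obtain Ba where Ba: "Ba \<ge> 0" "\<And>t. t \<in> {0..T} \<Longrightarrow> \<bar>a t\<bar> \<le> Ba" using continuous_on_Icc_bounded[OF a] by blast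
  obtain B where B: "B \<ge> 0" "\<And>t. t \<in> {0..T} \<Longrightarrow> \<bar>Q t\<bar> \<le> B" using continuous_on_Icc_bounded[OF Q] by blast
  define K where "K = 1 + B + Ba * \<bar>\<mu>\<bar> + B + B\<^sup>2"
  have lip: "norm (G t x - G t y) \<le> K * norm (x - y)" if t: "t \<in> {0..T}" for t x y
  proof -
    define d where "d = x - y"
    have "G t x - G t y = (snd d - of_real (Q t) * fst d, - of_real (a t * \<mu>) * fst d + of_real (Q t) * snd d - of_real ((Q t)\<^sup>2) * fst d)"
      by (simp add: G_def d_def algebra_simps)
    also have "norm \<dots> \<le> norm (snd d - of_real (Q t) * fst d) + norm (- of_real (a t * \<mu>) * fst d + of_real (Q t) * snd d - of_real ((Q t)\<^sup>2) * fst d)"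
      by (rule norm_Pair_le)
    also have "\<dots> \<le> (norm (snd d) + norm (of_real (Q t) * fst d)) + (norm (- of_real (a t * \<mu>) * fst d) + norm (of_real (Q t) * snd d) + norm (of_real ((Q t)\<^sup>2) * fst d))"
      by (intro add_mono norm_triangle_ineq4 order_trans[OF norm_triangle_ineq4 add_right_mono[OF norm_triangle_ineq]])
    also have "\<dots> = norm (snd d) + \<bar>Q t\<bar> * norm (fst d) + \<bar>a t\<bar> * \<bar>\<mu>\<bar> * norm (fst d) + \<bar>Q t\<bar> * norm (snd d) + \<bar>Q t\<bar>\<^sup>2 * norm (fst d)"
      by (simp add: norm_mult norm_power abs_mult)
    also have "\<dots> \<le> 1 * norm d + B * norm d + Ba * \<bar>\<mu>\<bar> * norm d + B * norm d + B\<^sup>2 * norm d"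
    proof -
      have "norm (fst d) \<le> norm d" "norm (snd d) \<le> norm d" using norm_fst_le[of "fst d" "snd d"] norm_snd_le[of "snd d" "fst d"] by simp_all
      then show ?thesis using B Ba t by (intro add_mono mult_mono power_mono) auto
    qed
    also have "\<dots> = K * norm (x - y)" by (simp add: K_def d_def algebra_simps)
    finally show ?thesis .
  qed
  have cont: "continuous_on {0..T} (\<lambda>t. G t (x t))" if "continuous_on {0..T} x" for x
    unfolding G_def by (intro continuous_intros that a Q f)
  have "K > 0" unfolding K_def using Ba(1) B(1) by (intro add_pos_nonneg) auto
  then obtain x where x: "x 0 = (y0, z0)" "\<And>t. t \<in> {0..T} \<Longrightarrow> (x has_vector_derivative G t (x t)) (at t within {0..T})"
    using lipschitz_ODE_exists[OF T _ lip cont, of "(y0, z0)"] by blast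
  have "quasi_solution T a Q \<mu> f (\<lambda>t. fst (x t)) (\<lambda>t. snd (x t))"
    unfolding quasi_solution_def
  proof (intro ballI conjI)
    fix t assume t: "t \<in> {0..T}"
    have "((\<lambda>t. fst (x t)) has_vector_derivative fst (G t (x t))) (at t within {0..T})"
      by (rule bounded_linear.has_vector_derivative[OF bounded_linear_fst x(2)[OF t]])
    then show "((\<lambda>t. fst (x t)) has_vector_derivative snd (x t) - of_real (Q t) * fst (x t)) (at t within {0..T})" by (simp add: G_def)
    have "((\<lambda>t. snd (x t)) has_vector_derivative snd (G t (x t))) (at t within {0..T})"
      by (rule bounded_linear.has_vector_derivative[OF bounded_linear_snd x(2)[OF t]])
    then show "((\<lambda>t. snd (x t)) has_vector_derivative f t - of_real (a t * \<mu>) * fst (x t) + of_real (Q t) * snd (x t) - of_real ((Q t)\<^sup>2) * fst (x t)) (at t within {0..T})"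
      by (simp add: G_def)
  qed
  then show ?thesis using x(1) by (intro exI[of _ "\<lambda>t. fst (x t)"] exI[of _ "\<lambda>t. snd (x t)"]) simp
qed

text \<open>Leibniz's rule cancels both terms with \<open>Q\<close>; only \<open>Q'\<close> survives.\<close>

lemma quasi_derivative_gives_second_derivative:
  fixes y z f :: "real \<Rightarrow> complex" and Q :: "real \<Rightarrow> real"
  assumes dy: "(y has_vector_derivative z t - of_real (Q t) * y t) (at t within S)"
    and dz: "(z has_vector_derivative F + of_real (Q t) * z t - of_real ((Q t)\<^sup>2) * y t) (at t within S)"
    and dQ: "(Q has_real_derivative q) (at t within S)"
  shows "((\<lambda>t. z t - of_real (Q t) * y t) has_vector_derivative F - of_real q * y t) (at t within S)"
proof -
  have "((\<lambda>t. of_real (Q t)) has_vector_derivative complex_of_real q) (at t within S)"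
    using dQ by (intro has_vector_derivative_of_real) (simp add: has_real_derivative_iff_has_vector_derivative)
  then have "((\<lambda>t. z t - of_real (Q t) * y t) has_vector_derivative
     (F + of_real (Q t) * z t - of_real ((Q t)\<^sup>2) * y t) - (of_real (Q t) * (z t - of_real (Q t) * y t) + of_real q * y t)) (at t within S)"
    by (intro has_vector_derivative_diff has_vector_derivative_mult dy dz)
  then show ?thesis by (rule has_vector_derivative_eq_rhs) (simp add: algebra_simps power2_eq_square)
qed

text \<open>A power of \<open>J\<close> costs a logarithm in the exponent, hence at most a multiple of \<open>J powr \<theta>\<close>. The
resulting multiple of \<open>J powr \<theta>\<close> is below \<open>A * J powr p\<close> for large \<open>J\<close> and bounded for the others.\<close>

lemma exp_powr_absorb:
  assumes th: "0 < \<theta>" "\<theta> < p" and A: "A > 0" and K: "K \<ge> 0"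
  obtains C where "C > 0" "\<And>J::real. J \<ge> 1 \<Longrightarrow> J ^ n * exp (K * J powr \<theta>) \<le> C * exp (A * J powr p)"
proof -
  \<comment> \<open>the first summand pays for \<open>J ^ n\<close> through \<open>ln J \<le> J powr \<theta> / \<theta>\<close>\<close>
  define K' where "K' = real n / \<theta> + K"
  define \<rho> where "\<rho> = (K' / A) powr (\<theta> / (p - \<theta>))"
  have K': "K' \<ge> 0" using th K by (simp add: K'_def)
  show thesis
  proof (rule that[of "exp (K' * \<rho>)"])
    fix J :: real assume J: "J \<ge> 1"
    have "ln J \<le> J powr \<theta> / \<theta>" using J th by (intro ln_powr_bound) auto
    then have "real n * ln J \<le> real n / \<theta> * J powr \<theta>" using th mult_left_mono[of "ln J" "J powr \<theta> / \<theta>" "real n"] by simp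
    then have "exp (real n * ln J) \<le> exp (real n / \<theta> * J powr \<theta>)" by simp
    moreover have "exp (real n * ln J) = J ^ n" using J by (simp add: exp_of_nat_mult)
    ultimately have "J ^ n * exp (K * J powr \<theta>) \<le> exp (real n / \<theta> * J powr \<theta>) * exp (K * J powr \<theta>)" by (intro mult_right_mono) auto
    also have "\<dots> = exp (K' * J powr \<theta>)" by (simp add: K'_def exp_add[symmetric] distrib_right)
    also have "\<dots> \<le> exp (K' * \<rho> + A * J powr p)"
    proof (cases "K' \<le> A * J powr (p - \<theta>)")
      case True
      then have "K' * J powr \<theta> \<le> A * J powr (p - \<theta>) * J powr \<theta>" by (intro mult_right_mono) auto
      also have "\<dots> = A * J powr p" by (simp add: powr_add[symmetric] mult.assoc)
      also have "\<dots> \<le> K' * \<rho> + A * J powr p" using K' by (simp add: \<rho>_def)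
      finally show ?thesis by simp
    next
      case False
      then have "J powr (p - \<theta>) \<le> K' / A" using A by (simp add: field_simps)
      then have "(J powr (p - \<theta>)) powr (\<theta> / (p - \<theta>)) \<le> \<rho>" unfolding \<rho>_def using th by (intro powr_mono2) auto
      then have "J powr \<theta> \<le> \<rho>" using th by (simp add: powr_powr)
      then have "K' * J powr \<theta> \<le> K' * \<rho>" using K' by (rule mult_left_mono)
      moreover have "0 \<le> A * J powr p" using A by simp
      ultimately show ?thesis by simp
    qed
    also have "\<dots> = exp (K' * \<rho>) * exp (A * J powr p)" by (rule exp_add)
    finally show "J ^ n * exp (K * J powr \<theta>) \<le> exp (K' * \<rho>) * exp (A * J powr p)" .
  qed simp
qed

text \<open>The constants \<open>C\<close> and \<open>K\<close> must not depend on the frequency, which enters only through \<open>J\<close>. The scale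
of the regularization, on the other hand, is chosen according to \<open>J\<close>.\<close>

lemma coefficient_growth:
  assumes T: "T > 0" and al: "0 < \<alpha>" "\<alpha> < 2" and a: "C_alpha \<alpha> T a" and pos: "\<forall>t\<in>{0..T}. a t \<ge> 0"
    and Q: "\<And>t. t \<in> {0..T} \<Longrightarrow> \<bar>Q t\<bar> \<le> B" and c: "c \<ge> 0"
  shows "\<exists>C>0. \<exists>K\<ge>0. \<forall>J\<ge>1. \<forall>\<mu>. \<forall>y z f. 0 \<le> \<mu> \<and> \<mu> \<le> c * J\<^sup>2 \<and> continuous_on {0..T} f \<and> quasi_solution T a Q \<mu> f y z \<longrightarrow>
      (\<forall>t\<in>{0..T}. (cmod (z t))\<^sup>2 + (cmod (y t))\<^sup>2 \<le> C * J\<^sup>2 * exp (K * J powr (2 / (2 + \<alpha>))) *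
        ((cmod (z 0))\<^sup>2 + (cmod (y 0))\<^sup>2 + integral {0..T} (\<lambda>r. (cmod (f r))\<^sup>2)))"
proof -
  obtain C0 \<Lambda> where C0: "C0 > 0" "\<Lambda> > 0" "\<forall>\<epsilon>\<in>{0<..1}. \<exists>b b' \<Gamma> g. regularized \<alpha> T a C0 \<epsilon> \<Lambda> b b' \<Gamma> g"
    using regularize_C_alpha[OF T al a pos] by blast
  define \<theta> where "\<theta> = 2 / (2 + \<alpha>)"
  have B: "B \<ge> 0" using Q[of 0] T by force
  define D where "D = 2 + 2 * B + B\<^sup>2"
  define K where "K = \<Lambda> + C0 * sqrt c * T"
  define C where "C = exp (D * T) * (C0 * c + 1)"
  have CK: "C > 0" "K \<ge> 0" using C0 c T by (auto simp: C_def K_def add_nonneg_pos)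
  have "(cmod (z t))\<^sup>2 + (cmod (y t))\<^sup>2 \<le> C * J\<^sup>2 * exp (K * J powr (2 / (2 + \<alpha>))) *
        ((cmod (z 0))\<^sup>2 + (cmod (y 0))\<^sup>2 + integral {0..T} (\<lambda>r. (cmod (f r))\<^sup>2))"
    if J: "J \<ge> 1" and mu: "0 \<le> \<mu>" "\<mu> \<le> c * J\<^sup>2" and f: "continuous_on {0..T} f"
      and qs: "quasi_solution T a Q \<mu> f y z" and t: "t \<in> {0..T}" for y z f :: "real \<Rightarrow> complex" and \<mu> J t :: real
  proof -
    have dy: "(y has_vector_derivative z t - of_real (Q t) * y t) (at t within {0..T})"
      and dz: "(z has_vector_derivative
        f t - of_real (a t * \<mu>) * y t + of_real (Q t) * z t - of_real ((Q t)\<^sup>2) * y t) (at t within {0..T})"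
      if "t \<in> {0..T}" for t using qs that unfolding quasi_solution_def by blast+
    \<comment> \<open>the choice of \<open>\<epsilon>\<close> that balances \<open>1/\<epsilon>\<close> against \<open>sqrt \<mu> * \<epsilon> powr (\<alpha>/2)\<close>\<close>
    define \<epsilon> where "\<epsilon> = J powr (- \<theta>)"
    have th: "0 < \<theta>" using al by (simp add: \<theta>_def)
    have \<epsilon>: "\<epsilon> \<in> {0<..1}" using J th by (auto simp: \<epsilon>_def powr_minus_divide ge_one_powr_ge_zero)
    obtain b b' \<Gamma> g where R: "regularized \<alpha> T a C0 \<epsilon> \<Lambda> b b' \<Gamma> g" using C0(3) \<epsilon> by blast
    have \<epsilon>inv: "1 / \<epsilon> = J powr \<theta>" using J by (simp add: \<epsilon>_def powr_minus_divide)
    define \<kappa> where "\<kappa> = C0 * \<epsilon> powr (\<alpha>/2)"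
    have \<kappa>: "\<kappa> \<ge> 0" using C0 by (simp add: \<kappa>_def)
    have I0: "0 \<le> integral {0..T} (\<lambda>r. (cmod (f r))\<^sup>2)"
      by (intro integral_nonneg integrable_continuous_interval continuous_intros f) auto
    have e: "(cmod (z t))\<^sup>2 + (cmod (y t))\<^sup>2 \<le> exp (\<Lambda> / \<epsilon> + (\<kappa> * sqrt \<mu> + (2 + 2 * B + B\<^sup>2)) * T) *
     ((cmod (z 0))\<^sup>2 + (\<mu> * b 0 + 1) * (cmod (y 0))\<^sup>2 + integral {0..T} (\<lambda>r. (cmod (f r))\<^sup>2))"
      by (rule energy_estimate[where a = a and b = b and b' = b' and g = g and \<Gamma> = \<Gamma> and Q = Q, OF _ mu(1) \<kappa> dy dz f Q])
        (use R T t in \<open>auto simp: regularized_def \<kappa>_def\<close>)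
    have s\<mu>: "sqrt \<mu> \<le> sqrt c * J"
      using real_sqrt_le_mono[OF mu(2)] J by (simp add: real_sqrt_mult)
    have "\<kappa> * sqrt \<mu> \<le> (C0 * \<epsilon> powr (\<alpha>/2)) * (sqrt c * J)"
      unfolding \<kappa>_def using s\<mu> C0 by (intro mult_left_mono) auto
    also have "\<dots> = C0 * sqrt c * (J powr (- \<theta> * (\<alpha>/2)) * J powr 1)" using J by (simp add: \<epsilon>_def powr_powr)
    also have "J powr (- \<theta> * (\<alpha>/2)) * J powr 1 = J powr (- \<theta> * (\<alpha>/2) + 1)" by (rule powr_add[symmetric])
    also have "- \<theta> * (\<alpha>/2) + 1 = \<theta>" using al by (simp add: \<theta>_def field_simps)
    finally have ks: "\<kappa> * sqrt \<mu> \<le> C0 * sqrt c * J powr \<theta>" .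
    have "\<Lambda> / \<epsilon> + (\<kappa> * sqrt \<mu> + D) * T \<le> \<Lambda> * J powr \<theta> + (C0 * sqrt c * J powr \<theta> + D) * T"
      using ks T \<epsilon>inv by (intro add_mono mult_right_mono) (auto simp: divide_inverse)
    also have "\<dots> = K * J powr \<theta> + D * T" by (simp add: K_def algebra_simps)
    finally have ex: "exp (\<Lambda> / \<epsilon> + (\<kappa> * sqrt \<mu> + (2 + 2 * B + B\<^sup>2)) * T) \<le> exp (D * T) * exp (K * J powr \<theta>)"
      by (simp add: D_def exp_add[symmetric] add.commute)
    have "0 \<le> b 0" "b 0 \<le> C0" using R T by (auto simp: regularized_def)
    then have "\<mu> * b 0 \<le> (c * J\<^sup>2) * C0" using mu c by (intro mult_mono) auto
    moreover have J2: "1 \<le> J\<^sup>2" using J by (simp add: one_le_power)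
    ultimately have mb: "\<mu> * b 0 + 1 \<le> (C0 * c + 1) * J\<^sup>2" by (simp add: algebra_simps)
    have J2': "1 \<le> (C0 * c + 1) * J\<^sup>2"
    proof -
      have "1 * 1 \<le> (C0 * c + 1) * J\<^sup>2" using J2 C0 c by (intro mult_mono) auto
      then show ?thesis by simp
    qed
    have "(cmod (z 0))\<^sup>2 + (\<mu> * b 0 + 1) * (cmod (y 0))\<^sup>2 + integral {0..T} (\<lambda>r. (cmod (f r))\<^sup>2)
      \<le> (C0 * c + 1) * J\<^sup>2 * (cmod (z 0))\<^sup>2 + (C0 * c + 1) * J\<^sup>2 * (cmod (y 0))\<^sup>2 + (C0 * c + 1) * J\<^sup>2 * integral {0..T} (\<lambda>r. (cmod (f r))\<^sup>2)"
      using mult_right_mono[OF J2', of "(cmod (z 0))\<^sup>2"] mult_right_mono[OF mb, of "(cmod (y 0))\<^sup>2"] mult_right_mono[OF J2' I0]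
      by (intro add_mono) auto
    also have "\<dots> = (C0 * c + 1) * J\<^sup>2 * ((cmod (z 0))\<^sup>2 + (cmod (y 0))\<^sup>2 + integral {0..T} (\<lambda>r. (cmod (f r))\<^sup>2))"
      by (simp only: distrib_left)
    finally have da: "(cmod (z 0))\<^sup>2 + (\<mu> * b 0 + 1) * (cmod (y 0))\<^sup>2 + integral {0..T} (\<lambda>r. (cmod (f r))\<^sup>2) \<le> \<dots>" .
    have "0 \<le> \<mu> * b 0 + 1" using mu \<open>0 \<le> b 0\<close> by simp
    note e
    also have "exp (\<Lambda> / \<epsilon> + (\<kappa> * sqrt \<mu> + (2 + 2 * B + B\<^sup>2)) * T) *
       ((cmod (z 0))\<^sup>2 + (\<mu> * b 0 + 1) * (cmod (y 0))\<^sup>2 + integral {0..T} (\<lambda>r. (cmod (f r))\<^sup>2))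
      \<le> (exp (D * T) * exp (K * J powr \<theta>)) * ((C0 * c + 1) * J\<^sup>2 * ((cmod (z 0))\<^sup>2 + (cmod (y 0))\<^sup>2 + integral {0..T} (\<lambda>r. (cmod (f r))\<^sup>2)))"
      using ex da I0 \<open>0 \<le> \<mu> * b 0 + 1\<close> by (intro mult_mono) (auto intro!: add_nonneg_nonneg)
    also have "\<dots> = C * J\<^sup>2 * exp (K * J powr \<theta>) * ((cmod (z 0))\<^sup>2 + (cmod (y 0))\<^sup>2 + integral {0..T} (\<lambda>r. (cmod (f r))\<^sup>2))"
      by (simp add: C_def mult_ac)
    finally show ?thesis by (simp add: \<theta>_def)
  qed
  then show ?thesis using CK by blast
qed

section \<open>Square integrable functions and Riesz bases\<close>

lemma L2_measurable: "f \<in> L2 \<Longrightarrow> f \<in> borel_measurable lebesgue" by (simp add: L2_def)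

lemma L2_zero: "(\<lambda>x. 0) \<in> L2" by (simp add: L2_def)

lemma cmod_add_square_le: "(cmod (x + y))\<^sup>2 \<le> 2 * (cmod x)\<^sup>2 + 2 * (cmod y)\<^sup>2"
proof -
  have "(cmod (x + y))\<^sup>2 \<le> (cmod x + cmod y)\<^sup>2" by (intro power_mono norm_triangle_ineq) auto
  also have "\<dots> \<le> 2 * (cmod x)\<^sup>2 + 2 * (cmod y)\<^sup>2"
    using sum_squares_bound[of "cmod x" "cmod y"] by (simp add: power2_sum)
  finally show ?thesis .
qed

lemma L2_add:
  assumes "f \<in> L2" "g \<in> L2" shows "(\<lambda>x. f x + g x) \<in> L2"
proof -
  have "integrable lebesgue (\<lambda>x. (cmod (f x + g x))\<^sup>2)"
  proof (rule Bochner_Integration.integrable_bound[of _ "\<lambda>x. 2 * (cmod (f x))\<^sup>2 + 2 * (cmod (g x))\<^sup>2"])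
    show "AE x in lebesgue. norm ((cmod (f x + g x))\<^sup>2) \<le> norm (2 * (cmod (f x))\<^sup>2 + 2 * (cmod (g x))\<^sup>2)"
      using cmod_add_square_le by auto
  qed (use assms in \<open>auto simp: L2_def intro!: borel_measurable_power\<close>)
  then show ?thesis using assms by (auto simp: L2_def)
qed

lemma L2_mult:
  assumes "f \<in> L2" shows "(\<lambda>x. c * f x) \<in> L2"
  using assms by (auto simp: L2_def norm_mult power_mult_distrib)

lemma L2_lin: "f \<in> L2 \<Longrightarrow> g \<in> L2 \<Longrightarrow> (\<lambda>x. b * f x + c * g x) \<in> L2"
  by (intro L2_add L2_mult)

lemma L2_diff: "f \<in> L2 \<Longrightarrow> g \<in> L2 \<Longrightarrow> (\<lambda>x. f x - g x) \<in> L2"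
  using L2_lin[of f g 1 "-1"] by simp

lemma L2_sum: "finite F \<Longrightarrow> (\<And>\<xi>. \<xi> \<in> F \<Longrightarrow> u \<xi> \<in> L2) \<Longrightarrow> lin_comb u F b \<in> L2"
  unfolding lin_comb_def
proof (induction F rule: finite_induct)
  case (insert \<xi> F)
  then have "(\<lambda>x. b \<xi> * u \<xi> x + (\<Sum>\<xi>\<in>F. b \<xi> * u \<xi> x)) \<in> L2"
    by (intro L2_add L2_mult) auto
  then show ?case using insert by simp
qed (simp add: L2_zero)

definition L2_sq :: "(real^'n \<Rightarrow> complex) \<Rightarrow> real" where
  "L2_sq f = (LINT x|lebesgue. (cmod (f x))\<^sup>2)"

lemma L2_norm_square: "(L2_norm f)\<^sup>2 = L2_sq f"
  by (simp add: L2_norm_def L2_sq_def)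

lemma L2_sq_nonneg: "L2_sq f \<ge> 0" by (simp add: L2_sq_def)

lemma L2_integrable_product:
  assumes "f \<in> L2" "g \<in> L2"
  shows "integrable lebesgue (\<lambda>x. f x * cnj (g x))"
proof (rule Bochner_Integration.integrable_bound[of _ "\<lambda>x. (cmod (f x))\<^sup>2 + (cmod (g x))\<^sup>2"])
  show "(\<lambda>x. f x * cnj (g x)) \<in> borel_measurable lebesgue"
  proof (rule borel_measurable_times[OF L2_measurable[OF assms(1)]])
    show "(\<lambda>x. cnj (g x)) \<in> borel_measurable lebesgue"
      by (rule borel_measurable_continuous_on[OF _ L2_measurable[OF assms(2)]]) (intro continuous_intros)
  qed
  show "AE x in lebesgue. norm (f x * cnj (g x)) \<le> norm ((cmod (f x))\<^sup>2 + (cmod (g x))\<^sup>2)"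
  proof (intro AE_I2)
    fix x show "norm (f x * cnj (g x)) \<le> norm ((cmod (f x))\<^sup>2 + (cmod (g x))\<^sup>2)"
    proof -
      have "0 \<le> cmod (f x) * cmod (g x)" "2 * (cmod (f x) * cmod (g x)) \<le> (cmod (f x))\<^sup>2 + (cmod (g x))\<^sup>2"
        using sum_squares_bound[of "cmod (f x)" "cmod (g x)"] by (auto simp: mult.assoc)
      then have "cmod (f x) * cmod (g x) \<le> (cmod (f x))\<^sup>2 + (cmod (g x))\<^sup>2" by linarith
      then show ?thesis by (simp add: norm_mult)
    qed
  qed
qed (use assms in \<open>auto simp: L2_def\<close>)

lemma H_fourier_lin:
  assumes "f \<in> L2" "g \<in> L2" "w \<xi> \<in> L2"
  shows "H_fourier w (\<lambda>x. b * f x + c * g x) \<xi> = b * H_fourier w f \<xi> + c * H_fourier w g \<xi>"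
  unfolding H_fourier_def L2_inner_def
  using L2_integrable_product[OF assms(1,3)] L2_integrable_product[OF assms(2,3)]
  by (simp add: algebra_simps)

lemma H_fourier_diff:
  assumes "f \<in> L2" "g \<in> L2" "w \<xi> \<in> L2"
  shows "H_fourier w (\<lambda>x. f x - g x) \<xi> = H_fourier w f \<xi> - H_fourier w g \<xi>"
  using H_fourier_lin[where f=f and g=g and w=w and \<xi>=\<xi> and b=1 and c="-1"] assms by simp

lemma H_fourier_add:
  assumes "f \<in> L2" "g \<in> L2" "w \<xi> \<in> L2"
  shows "H_fourier w (\<lambda>x. f x + g x) \<xi> = H_fourier w f \<xi> + H_fourier w g \<xi>"
  using H_fourier_lin[where f=f and g=g and w=w and \<xi>=\<xi> and b=1 and c=1] assms by simp

lemma H_fourier_lin_comb: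
  assumes bi: "biorthogonal I u w" and u: "\<And>\<xi>. \<xi> \<in> I \<Longrightarrow> u \<xi> \<in> L2" and F: "finite F" "F \<subseteq> I" and \<eta>: "\<eta> \<in> I"
  shows "H_fourier w (lin_comb u F b) \<eta> = (if \<eta> \<in> F then b \<eta> else 0)"
proof -
  have w: "w \<eta> \<in> L2" using bi \<eta> by (simp add: biorthogonal_def)
  have "H_fourier w (lin_comb u F b) \<eta> = (LINT x|lebesgue. (\<Sum>\<xi>\<in>F. b \<xi> * (u \<xi> x * cnj (w \<eta> x))))"
    by (simp add: H_fourier_def L2_inner_def lin_comb_def sum_distrib_right mult.assoc)
  also have "\<dots> = (\<Sum>\<xi>\<in>F. LINT x|lebesgue. b \<xi> * (u \<xi> x * cnj (w \<eta> x)))"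
    using F u w by (intro Bochner_Integration.integral_sum integrable_mult_right L2_integrable_product) auto
  also have "\<dots> = (\<Sum>\<xi>\<in>F. b \<xi> * L2_inner (u \<xi>) (w \<eta>))" by (simp add: L2_inner_def)
  also have "\<dots> = (\<Sum>\<xi>\<in>F. if \<xi> = \<eta> then b \<xi> else 0)"
    using bi F \<eta> by (intro sum.cong) (auto simp: biorthogonal_def subset_iff)
  also have "\<dots> = (if \<eta> \<in> F then b \<eta> else 0)" using F by simp
  finally show ?thesis .
qed

text \<open>The inequality of Cauchy and Schwarz in the additive form that follows from the pointwise
inequality by integration; optimizing over \<open>\<tau>\<close> gives the usual form.\<close>

lemma L2_inner_bound:
  assumes "f \<in> L2" "g \<in> L2" "\<tau> > 0"
  shows "cmod (L2_inner f g) \<le> (\<tau> * L2_sq g + L2_sq f / \<tau>) / 2"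
proof -
  have "cmod (L2_inner f g) \<le> (LINT x|lebesgue. cmod (f x * cnj (g x)))"
    unfolding L2_inner_def by (rule integral_norm_bound)
  also have "\<dots> \<le> (LINT x|lebesgue. (\<tau> * (cmod (g x))\<^sup>2 + (cmod (f x))\<^sup>2 / \<tau>) / 2)"
  proof (rule integral_mono)
    fix x
    have "2 * (sqrt \<tau> * cmod (g x)) * (cmod (f x) / sqrt \<tau>) \<le> (sqrt \<tau> * cmod (g x))\<^sup>2 + (cmod (f x) / sqrt \<tau>)\<^sup>2"
      by (rule sum_squares_bound)
    then show "cmod (f x * cnj (g x)) \<le> (\<tau> * (cmod (g x))\<^sup>2 + (cmod (f x))\<^sup>2 / \<tau>) / 2"
      using assms(3) by (simp add: norm_mult power_mult_distrib power_divide mult.commute)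
  qed (use assms L2_integrable_product[OF assms(1,2)] in \<open>auto simp: L2_def\<close>)
  also have "\<dots> = (\<tau> * L2_sq g + L2_sq f / \<tau>) / 2"
    unfolding L2_sq_def using assms by (simp add: L2_def)
  finally show ?thesis .
qed

lemma L2_inner_tendsto_zero:
  assumes f: "\<And>n::nat. f n \<in> L2" and g: "g \<in> L2" and lim: "(\<lambda>n. L2_sq (f n)) \<longlonglongrightarrow> 0"
  shows "(\<lambda>n. L2_inner (f n) g) \<longlonglongrightarrow> 0"
proof (rule tendstoI)
  fix e :: real assume e: "e > 0"
  define \<tau> where "\<tau> = e / (L2_sq g + 1)"
  have \<tau>: "\<tau> > 0" using e L2_sq_nonneg[of g] by (simp add: \<tau>_def)
  have tg: "\<tau> * L2_sq g \<le> e" using e L2_sq_nonneg[of g] by (simp add: \<tau>_def field_simps)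
  have "eventually (\<lambda>n. L2_sq (f n) < e * \<tau>) sequentially"
    using lim \<tau> e by (intro order_tendstoD(2)[OF lim]) auto
  then show "eventually (\<lambda>n. dist (L2_inner (f n) g) 0 < e) sequentially"
  proof eventually_elim
    case (elim n)
    have "L2_sq (f n) / \<tau> < e" using elim \<tau> by (simp add: field_simps)
    then show ?case using L2_inner_bound[OF f[of n] g \<tau>] tg by simp
  qed
qed

lemma L2_sq_diff_le:
  assumes "f \<in> L2" "g \<in> L2" "h \<in> L2"
  shows "L2_sq (\<lambda>x. f x - g x) \<le> 2 * L2_sq (\<lambda>x. h x - f x) + 2 * L2_sq (\<lambda>x. h x - g x)"
proof -
  have "L2_sq (\<lambda>x. f x - g x) \<le> (LINT x|lebesgue. 2 * (cmod (h x - f x))\<^sup>2 + 2 * (cmod (h x - g x))\<^sup>2)"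
    unfolding L2_sq_def
  proof (rule integral_mono)
    fix x show "(cmod (f x - g x))\<^sup>2 \<le> 2 * (cmod (h x - f x))\<^sup>2 + 2 * (cmod (h x - g x))\<^sup>2"
      using cmod_add_square_le[of "f x - h x" "h x - g x"] by (simp add: norm_minus_commute)
  qed (use L2_diff[OF assms(1,2)] L2_diff[OF assms(3,1)] L2_diff[OF assms(3,2)] in \<open>auto simp: L2_def\<close>)
  also have "\<dots> = 2 * L2_sq (\<lambda>x. h x - f x) + 2 * L2_sq (\<lambda>x. h x - g x)"
    unfolding L2_sq_def using L2_diff[OF assms(3,1)] L2_diff[OF assms(3,2)] by (simp add: L2_def)
  finally show ?thesis .
qed

lemma riesz_basis_bounds:
  assumes rb: "riesz_basis I u"
  obtains m M where "m > 0" "\<And>F b. finite F \<Longrightarrow> F \<subseteq> I \<Longrightarrow>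
        m * (\<Sum>\<xi>\<in>F. (cmod (b \<xi>))\<^sup>2) \<le> L2_sq (lin_comb u F b) \<and>
        L2_sq (lin_comb u F b) \<le> M * (\<Sum>\<xi>\<in>F. (cmod (b \<xi>))\<^sup>2)"
proof -
  have "\<exists>m>0. \<exists>M. \<forall>F b. finite F \<and> F \<subseteq> I \<longrightarrow>
        m * (\<Sum>\<xi>\<in>F. (cmod (b \<xi>))\<^sup>2) \<le> L2_sq (lin_comb u F b) \<and>
        L2_sq (lin_comb u F b) \<le> M * (\<Sum>\<xi>\<in>F. (cmod (b \<xi>))\<^sup>2)"
    using rb unfolding riesz_basis_def L2_norm_square by (elim conjE)
  then obtain m M where m: "m > 0" and *: "\<forall>F b. finite F \<and> F \<subseteq> I \<longrightarrow>
        m * (\<Sum>\<xi>\<in>F. (cmod (b \<xi>))\<^sup>2) \<le> L2_sq (lin_comb u F b) \<and>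
        L2_sq (lin_comb u F b) \<le> M * (\<Sum>\<xi>\<in>F. (cmod (b \<xi>))\<^sup>2)" by (elim exE conjE)
  show thesis by (rule that[OF m, of M]) (use * in simp)
qed

text \<open>Density supplies finite linear combinations \<open>h n\<close> tending to \<open>g\<close>. By the lower Riesz bound their
coefficients form a Cauchy sequence in \<open>l\<^sup>2\<close>. Each single coefficient tends to that of \<open>g\<close>, which is 0,
so the coefficients tend to 0 in \<open>l\<^sup>2\<close>, and the upper Riesz bound gives that \<open>h n\<close> tends to 0.\<close>

lemma L2_zero_coefficients_AE:
  assumes rb: "riesz_basis I u" and bi: "biorthogonal I u w" and g: "g \<in> L2"
    and zero: "\<And>\<xi>. \<xi> \<in> I \<Longrightarrow> H_fourier w g \<xi> = 0"
  shows "AE x in lebesgue. g x = 0"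
proof -
  have u: "u \<xi> \<in> L2" if "\<xi> \<in> I" for \<xi> using rb that by (simp add: riesz_basis_def)
  have w: "w \<xi> \<in> L2" if "\<xi> \<in> I" for \<xi> using bi that by (simp add: biorthogonal_def)
  obtain m M where m: "m > 0" and mM: "\<And>F b. finite F \<Longrightarrow> F \<subseteq> I \<Longrightarrow>
        m * (\<Sum>\<xi>\<in>F. (cmod (b \<xi>))\<^sup>2) \<le> L2_sq (lin_comb u F b) \<and>
        L2_sq (lin_comb u F b) \<le> M * (\<Sum>\<xi>\<in>F. (cmod (b \<xi>))\<^sup>2)"
    using riesz_basis_bounds[OF rb] by blast
  have "\<exists>F b. finite F \<and> F \<subseteq> I \<and> L2_sq (\<lambda>x. g x - lin_comb u F b x) < e" if "e > 0" for e
  proof -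
    have "\<exists>h\<in>{lin_comb u F b |F b. finite F \<and> F \<subseteq> I}. L2_norm (\<lambda>x. g x - h x) < sqrt e"
      using rb g that unfolding riesz_basis_def L2_dense_def by simp
    then obtain F b where "finite F" "F \<subseteq> I" "L2_norm (\<lambda>x. g x - lin_comb u F b x) < sqrt e" by blast
    then show ?thesis by (auto simp: L2_norm_def L2_sq_def)
  qed
  then have "\<exists>F b. finite F \<and> F \<subseteq> I \<and> L2_sq (\<lambda>x. g x - lin_comb u F b x) < 1 / real (Suc n)" for n by simp
  then obtain F b where Fb: "\<And>n. finite (F n)" "\<And>n. F n \<subseteq> I" "\<And>n. L2_sq (\<lambda>x. g x - lin_comb u (F n) (b n) x) < 1 / real (Suc n)"
    by metis
  define h where "h n = lin_comb u (F n) (b n)" for n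
  have h: "h n \<in> L2" for n unfolding h_def by (intro L2_sum Fb u) (use Fb in auto)
  have ghn: "(\<lambda>n. L2_sq (\<lambda>x. g x - h n x)) \<longlonglongrightarrow> 0"
  proof (rule tendsto_sandwich[of "\<lambda>_. 0" _ _ "\<lambda>n. 1 / real (Suc n)"])
    show "(\<lambda>n. 1 / real (Suc n)) \<longlonglongrightarrow> 0" using LIMSEQ_inverse_real_of_nat by (simp add: inverse_eq_divide)
    show "\<forall>\<^sub>F n in sequentially. 0 \<le> L2_sq (\<lambda>x. g x - h n x)"
      by (intro always_eventually allI L2_sq_nonneg)
    show "\<forall>\<^sub>F n in sequentially. L2_sq (\<lambda>x. g x - h n x) \<le> 1 / real (Suc n)"
      unfolding h_def by (intro always_eventually allI less_imp_le Fb(3))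
  qed simp
  have coef: "H_fourier w (h n) \<xi> = (if \<xi> \<in> F n then b n \<xi> else 0)" if "\<xi> \<in> I" for n \<xi>
    unfolding h_def by (rule H_fourier_lin_comb[OF bi u Fb(1,2) that])
  have clim: "(\<lambda>n. H_fourier w (h n) \<xi>) \<longlonglongrightarrow> 0" if "\<xi> \<in> I" for \<xi>
  proof -
    have "(\<lambda>n. H_fourier w (\<lambda>x. g x - h n x) \<xi>) \<longlonglongrightarrow> 0"
      unfolding H_fourier_def by (intro L2_inner_tendsto_zero L2_diff g h w that ghn)
    then have "(\<lambda>n. - H_fourier w (h n) \<xi>) \<longlonglongrightarrow> 0"
      using H_fourier_diff[of g "h n" w \<xi> for n] g h w[OF that] zero[OF that] by simp
    then show ?thesis by (metis tendsto_minus_cancel_left add.inverse_neutral)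
  qed
  have pair: "(\<Sum>\<xi>\<in>F n. (cmod (H_fourier w (h n) \<xi> - H_fourier w (h k) \<xi>))\<^sup>2) \<le> (2 / real (Suc n) + 2 / real (Suc k)) / m" for n k
  proof -
    define c where "c \<xi> = H_fourier w (h n) \<xi> - H_fourier w (h k) \<xi>" for \<xi>
    let ?G = "F n \<union> F k"
    have G: "finite ?G" "?G \<subseteq> I" using Fb by auto
    have eq: "lin_comb u ?G c x = h n x - h k x" for x
    proof -
      have "lin_comb u ?G c x = (\<Sum>\<xi>\<in>?G. (if \<xi> \<in> F n then b n \<xi> else 0) * u \<xi> x) - (\<Sum>\<xi>\<in>?G. (if \<xi> \<in> F k then b k \<xi> else 0) * u \<xi> x)"
        unfolding lin_comb_def sum_subtractf[symmetric]
        using G(2) by (intro sum.cong) (auto simp: c_def coef subset_iff algebra_simps)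
      also have "(\<Sum>\<xi>\<in>?G. (if \<xi> \<in> F n then b n \<xi> else 0) * u \<xi> x) = h n x"
        unfolding h_def lin_comb_def using Fb by (intro sum.mono_neutral_cong_right) auto
      also have "(\<Sum>\<xi>\<in>?G. (if \<xi> \<in> F k then b k \<xi> else 0) * u \<xi> x) = h k x"
        unfolding h_def lin_comb_def using Fb by (intro sum.mono_neutral_cong_right) auto
      finally show ?thesis .
    qed
    have "m * (\<Sum>\<xi>\<in>F n. (cmod (c \<xi>))\<^sup>2) \<le> m * (\<Sum>\<xi>\<in>?G. (cmod (c \<xi>))\<^sup>2)"
      using m Fb by (intro mult_left_mono sum_mono2) auto
    also have "\<dots> \<le> L2_sq (lin_comb u ?G c)" using mM[OF G] by blast
    also have "\<dots> = L2_sq (\<lambda>x. h n x - h k x)" by (simp add: L2_sq_def eq)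
    also have "\<dots> \<le> 2 * L2_sq (\<lambda>x. g x - h n x) + 2 * L2_sq (\<lambda>x. g x - h k x)"
      by (rule L2_sq_diff_le[OF h h g])
    also have "\<dots> \<le> 2 * (1 / real (Suc n)) + 2 * (1 / real (Suc k))"
      using Fb(3)[of n] Fb(3)[of k] unfolding h_def by (intro add_mono mult_left_mono) auto
    finally show ?thesis unfolding c_def[symmetric] pos_le_divide_eq[OF m] by (simp add: mult.commute)
  qed
  have bn: "(\<Sum>\<xi>\<in>F n. (cmod (b n \<xi>))\<^sup>2) \<le> (2 / real (Suc n)) / m" for n
  proof -
    have "(\<lambda>k. (\<Sum>\<xi>\<in>F n. (cmod (H_fourier w (h n) \<xi> - H_fourier w (h k) \<xi>))\<^sup>2)) \<longlonglongrightarrow> (\<Sum>\<xi>\<in>F n. (cmod (H_fourier w (h n) \<xi> - 0))\<^sup>2)"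
      using Fb(2)[of n] by (intro tendsto_intros clim) auto
    moreover have "(\<lambda>k. (2 / real (Suc n) + 2 * inverse (real (Suc k))) / m) \<longlonglongrightarrow> (2 / real (Suc n) + 2 * 0) / m"
      by (intro tendsto_intros LIMSEQ_inverse_real_of_nat) (use m in auto)
    ultimately have "(\<Sum>\<xi>\<in>F n. (cmod (H_fourier w (h n) \<xi> - 0))\<^sup>2) \<le> (2 / real (Suc n) + 2 * 0) / m"
      by (rule LIMSEQ_le) (use pair[of n] in \<open>auto simp: divide_inverse\<close>)
    moreover have "(\<Sum>\<xi>\<in>F n. (cmod (H_fourier w (h n) \<xi> - 0))\<^sup>2) = (\<Sum>\<xi>\<in>F n. (cmod (b n \<xi>))\<^sup>2)"
      using Fb(2)[of n] by (intro sum.cong) (auto simp: coef subset_iff)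
    ultimately show ?thesis by simp
  qed
  have gb: "L2_sq g \<le> (4 * (\<bar>M\<bar> / m) + 2) / real (Suc n)" for n
  proof -
    have "L2_sq (h n) \<le> M * (\<Sum>\<xi>\<in>F n. (cmod (b n \<xi>))\<^sup>2)" using mM[OF Fb(1,2)] unfolding h_def by blast
    also have "\<dots> \<le> \<bar>M\<bar> * (\<Sum>\<xi>\<in>F n. (cmod (b n \<xi>))\<^sup>2)" by (intro mult_right_mono sum_nonneg) auto
    also have "\<dots> \<le> \<bar>M\<bar> * ((2 / real (Suc n)) / m)" by (intro mult_left_mono bn) auto
    finally have hn: "L2_sq (h n) \<le> \<bar>M\<bar> * ((2 / real (Suc n)) / m)" .
    have "L2_sq (\<lambda>x. g x - 0) \<le> 2 * L2_sq (\<lambda>x. h n x - g x) + 2 * L2_sq (\<lambda>x. h n x - 0)"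
      by (rule L2_sq_diff_le[OF g L2_zero h])
    also have "L2_sq (\<lambda>x. h n x - g x) = L2_sq (\<lambda>x. g x - h n x)" by (simp add: L2_sq_def norm_minus_commute)
    finally have "L2_sq g \<le> 2 * (1 / real (Suc n)) + 2 * (\<bar>M\<bar> * ((2 / real (Suc n)) / m))"
      using hn Fb(3)[of n] by (simp add: h_def)
    also have "\<dots> = (4 * (\<bar>M\<bar> / m) + 2) / real (Suc n)" by (simp add: add_divide_distrib)
    finally show ?thesis .
  qed
  have "(\<lambda>n. (4 * (\<bar>M\<bar> / m) + 2) * inverse (real (Suc n))) \<longlonglongrightarrow> (4 * (\<bar>M\<bar> / m) + 2) * 0"
    by (intro tendsto_intros LIMSEQ_inverse_real_of_nat)
  then have "L2_sq g \<le> (4 * (\<bar>M\<bar> / m) + 2) * 0"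
    by (rule LIMSEQ_le_const) (use gb in \<open>auto simp: divide_inverse\<close>)
  then have "L2_sq g = 0" using L2_sq_nonneg[of g] by simp
  then have "(LINT x|lebesgue. (cmod (g x))\<^sup>2) = 0" by (simp add: L2_sq_def)
  then have "AE x in lebesgue. (cmod (g x))\<^sup>2 = 0"
    using g by (subst (asm) integral_nonneg_eq_0_iff_AE) (auto simp: L2_def)
  then show ?thesis by eventually_elim simp
qed

lemma summable_on_small_tail:
  fixes f :: "'i \<Rightarrow> real"
  assumes f: "f summable_on I" and pos: "\<And>\<xi>. \<xi> \<in> I \<Longrightarrow> 0 \<le> f \<xi>" and e: "e > 0"
  shows "\<exists>F. finite F \<and> F \<subseteq> I \<and> (\<forall>G. finite G \<and> G \<subseteq> I \<and> G \<inter> F = {} \<longrightarrow> sum f G \<le> e)"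
proof -
  define S where "S = infsum f I"
  have "(sum f \<longlongrightarrow> S) (finite_subsets_at_top I)"
    using has_sum_infsum[OF f] by (simp add: S_def has_sum_def)
  then have "\<forall>\<^sub>F X in finite_subsets_at_top I. S - e < sum f X"
    by (rule order_tendstoD) (use e in simp)
  then obtain X where X: "finite X" "X \<subseteq> I" "S - e < sum f X"
    unfolding eventually_finite_subsets_at_top by auto
  have "sum f G \<le> e" if G: "finite G" "G \<subseteq> I" "G \<inter> X = {}" for G
  proof -
    have "sum f (G \<union> X) \<le> S"
      unfolding S_def using G X pos by (intro finite_sum_le_infsum f) auto
    moreover have "sum f (G \<union> X) = sum f G + sum f X"
      using G X by (intro sum.union_disjoint) auto
    ultimately show ?thesis using X(3) by linarith
  qed
  then show ?thesis using X(1,2) by (intro exI[of _ X]) auto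
qed

text \<open>Partial sums over finite sets \<open>F n\<close> are chosen such that consecutive differences \<open>d n\<close> have squared
norm of order \<open>8 ^ - n\<close>. Then the sum of \<open>2 ^ n * \<bar>d n\<bar>\<^sup>2\<close> is integrable, hence finite
almost everywhere, which makes the partial sums converge almost everywhere. Fatou's lemma shows
that the limit is also the limit in \<open>L\<^sup>2\<close>.\<close>

lemma riesz_fischer:
  assumes rb: "riesz_basis I u" and bi: "biorthogonal I u w"
    and c: "(\<lambda>\<xi>. (cmod (c \<xi>))\<^sup>2) summable_on I"
  obtains g where "g \<in> L2" "\<And>\<xi>. \<xi> \<in> I \<Longrightarrow> H_fourier w g \<xi> = c \<xi>"
proof -
  have u: "u \<xi> \<in> L2" if "\<xi> \<in> I" for \<xi> using rb that by (simp add: riesz_basis_def)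
  have w: "w \<xi> \<in> L2" if "\<xi> \<in> I" for \<xi> using bi that by (simp add: biorthogonal_def)
  obtain M0 where M0: "\<And>F b. finite F \<Longrightarrow> F \<subseteq> I \<Longrightarrow> L2_sq (lin_comb u F b) \<le> M0 * (\<Sum>\<xi>\<in>F. (cmod (b \<xi>))\<^sup>2)"
    using riesz_basis_bounds[OF rb] by (metis (full_types))
  define M where "M = \<bar>M0\<bar>"
  have M: "L2_sq (lin_comb u F b) \<le> M * (\<Sum>\<xi>\<in>F. (cmod (b \<xi>))\<^sup>2)" if "finite F" "F \<subseteq> I" for F b
  proof -
    have "L2_sq (lin_comb u F b) \<le> M0 * (\<Sum>\<xi>\<in>F. (cmod (b \<xi>))\<^sup>2)" using M0 that by simp
    also have "\<dots> \<le> M * (\<Sum>\<xi>\<in>F. (cmod (b \<xi>))\<^sup>2)" unfolding M_def by (intro mult_right_mono sum_nonneg) auto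
    finally show ?thesis .
  qed
  have M_nonneg: "M \<ge> 0" by (simp add: M_def)
  have "\<exists>F. finite F \<and> F \<subseteq> I \<and> (\<forall>G. finite G \<and> G \<subseteq> I \<and> G \<inter> F = {} \<longrightarrow> (\<Sum>\<xi>\<in>G. (cmod (c \<xi>))\<^sup>2) \<le> (1/8) ^ n)" for n :: nat
    by (rule summable_on_small_tail[OF c]) simp_all
  then obtain F0 where F0: "\<And>n::nat. finite (F0 n)" "\<And>n. F0 n \<subseteq> I"
    "\<And>n G. finite G \<Longrightarrow> G \<subseteq> I \<Longrightarrow> G \<inter> F0 n = {} \<Longrightarrow> (\<Sum>\<xi>\<in>G. (cmod (c \<xi>))\<^sup>2) \<le> (1/8) ^ n"
    by metis
  define F where "F n = (\<Union>k\<le>n. F0 k)" for n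
  have F: "finite (F n)" "F n \<subseteq> I" for n using F0 by (auto simp: F_def)
  have Fmono: "F n \<subseteq> F m" if "n \<le> m" for n m unfolding F_def using that by (intro UN_mono) auto
  have Ftail: "(\<Sum>\<xi>\<in>G. (cmod (c \<xi>))\<^sup>2) \<le> (1/8) ^ n" if "finite G" "G \<subseteq> I" "G \<inter> F n = {}" for G n
    using that by (intro F0(3)) (auto simp: F_def)
  define h where "h n = lin_comb u (F n) c" for n
  have h: "h n \<in> L2" for n unfolding h_def by (intro L2_sum F u) (use F in auto)
  have hdiff: "L2_sq (\<lambda>x. h m x - h n x) \<le> M * (1/8) ^ n" if "n \<le> m" for n m
  proof -
    have "h m x - h n x = lin_comb u (F m - F n) c x" for x
      unfolding h_def lin_comb_def by (rule sum_diff[OF F(1) Fmono[OF that], symmetric])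
    then have "L2_sq (\<lambda>x. h m x - h n x) = L2_sq (lin_comb u (F m - F n) c)" by (simp add: L2_sq_def)
    also have "\<dots> \<le> M * (\<Sum>\<xi>\<in>F m - F n. (cmod (c \<xi>))\<^sup>2)" using F by (intro M) auto
    also have "\<dots> \<le> M * (1/8) ^ n" using F[of m] by (intro mult_left_mono Ftail M_nonneg) auto
    finally show ?thesis .
  qed
  define d where "d n x = h (Suc n) x - h n x" for n x
  have d: "d n \<in> L2" for n unfolding d_def by (intro L2_diff h)
  have dm: "d n \<in> borel_measurable lebesgue" for n by (rule L2_measurable[OF d])
  have "(\<integral>\<^sup>+ x. (\<Sum>n. ennreal (2 ^ n * (cmod (d n x))\<^sup>2)) \<partial>lebesgue) = (\<Sum>n. \<integral>\<^sup>+ x. ennreal (2 ^ n * (cmod (d n x))\<^sup>2) \<partial>lebesgue)"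
    using dm by (intro nn_integral_suminf) simp
  also have "\<dots> = (\<Sum>n. ennreal (2 ^ n * L2_sq (d n)))"
  proof (intro suminf_cong)
    fix n
    have "(\<integral>\<^sup>+ x. ennreal (2 ^ n * (cmod (d n x))\<^sup>2) \<partial>lebesgue) = ennreal (LINT x|lebesgue. 2 ^ n * (cmod (d n x))\<^sup>2)"
      using d[of n] by (intro nn_integral_eq_integral) (auto simp: L2_def)
    then show "(\<integral>\<^sup>+ x. ennreal (2 ^ n * (cmod (d n x))\<^sup>2) \<partial>lebesgue) = ennreal (2 ^ n * L2_sq (d n))"
      by (simp add: L2_sq_def)
  qed
  also have "\<dots> < top"
  proof -
    have le: "2 ^ n * L2_sq (d n) \<le> M * (1/4) ^ n" for n
    proof -
      have "2 ^ n * L2_sq (d n) \<le> 2 ^ n * (M * (1/8) ^ n)"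
        using hdiff[of n "Suc n"] by (intro mult_left_mono) (auto simp: d_def[abs_def])
      also have "\<dots> = M * (2 * (1/8)) ^ n" unfolding power_mult_distrib by (simp only: ac_simps)
      finally show ?thesis by simp
    qed
    have "summable (\<lambda>n. 2 ^ n * L2_sq (d n))"
    proof (rule summable_comparison_test')
      show "summable (\<lambda>n. M * (1/4::real) ^ n)" by (intro summable_mult summable_geometric) simp
      show "norm (2 ^ n * L2_sq (d n)) \<le> M * (1/4) ^ n" for n using le[of n] L2_sq_nonneg[of "d n"] by simp
    qed
    then have "(\<Sum>n. ennreal (2 ^ n * L2_sq (d n))) = ennreal (\<Sum>n. 2 ^ n * L2_sq (d n))"
      by (intro suminf_ennreal2 mult_nonneg_nonneg L2_sq_nonneg) auto
    then show ?thesis by simp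
  qed
  finally have "AE x in lebesgue. (\<Sum>n. ennreal (2 ^ n * (cmod (d n x))\<^sup>2)) \<noteq> \<infinity>"
    using dm by (intro nn_integral_noteq_infinite) auto
  then have conv: "AE x in lebesgue. convergent (\<lambda>n. h n x)"
  proof eventually_elim
    case (elim x)
    have "summable (\<lambda>n. 2 ^ n * (cmod (d n x))\<^sup>2)" using elim by (intro summable_suminf_not_top) auto
    then have "Bseq (\<lambda>n. 2 ^ n * (cmod (d n x))\<^sup>2)" by (intro convergent_imp_Bseq) (auto intro: summable_LIMSEQ_zero simp: convergent_def)
    then obtain K where K: "K > 0" "\<And>n. norm (2 ^ n * (cmod (d n x))\<^sup>2) \<le> K" by (auto elim: BseqE)
    have dle: "cmod (d n x) \<le> sqrt K * (sqrt (1/2)) ^ n" for n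
    proof (rule power2_le_imp_le)
      have "2 ^ n * (cmod (d n x))\<^sup>2 \<le> K" using K(2)[of n] by simp
      then have "(cmod (d n x))\<^sup>2 \<le> K * (1/2) ^ n" by (simp add: field_simps power_divide)
      also have "\<dots> = (sqrt K * (sqrt (1/2)) ^ n)\<^sup>2"
        using K(1) by (simp add: power_mult_distrib power_mult[symmetric] mult.commute[of n] power_mult)
      finally show "(cmod (d n x))\<^sup>2 \<le> (sqrt K * (sqrt (1/2)) ^ n)\<^sup>2" .
    qed (use K in auto)
    have "sqrt (1/2::real) < 1" by simp
    then have "summable (\<lambda>n. sqrt K * (sqrt (1/2)) ^ n)" by (intro summable_mult summable_geometric) simp
    then have "summable (\<lambda>n. d n x)" by (rule summable_comparison_test') (rule dle)
    then have "convergent (\<lambda>n. \<Sum>k<n. d k x)" by (simp add: summable_iff_convergent)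
    then have "convergent (\<lambda>n. (\<Sum>k<n. d k x) + h 0 x)" by (intro convergent_add convergent_const)
    moreover have "(\<Sum>k<n. d k x) + h 0 x = h n x" for n unfolding d_def by (subst sum_lessThan_telescope) simp
    ultimately show ?case by simp
  qed
  define g where "g x = lim (\<lambda>n. h n x)" for x
  have gm: "g \<in> borel_measurable lebesgue"
    unfolding g_def[abs_def] by (rule borel_measurable_lim_metric[OF L2_measurable[OF h]])
  have fatou: "(\<integral>\<^sup>+ x. ennreal ((cmod (g x - h n x))\<^sup>2) \<partial>lebesgue) \<le> ennreal (M * (1/8) ^ n)" for n
  proof -
    have "(\<integral>\<^sup>+ x. ennreal ((cmod (g x - h n x))\<^sup>2) \<partial>lebesgue) = (\<integral>\<^sup>+ x. liminf (\<lambda>m. ennreal ((cmod (h m x - h n x))\<^sup>2)) \<partial>lebesgue)"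
    proof (rule nn_integral_cong_AE, use conv in eventually_elim)
      case (elim x)
      then have "(\<lambda>m. h m x) \<longlonglongrightarrow> g x" by (simp add: g_def convergent_LIMSEQ_iff)
      then have "(\<lambda>m. ennreal ((cmod (h m x - h n x))\<^sup>2)) \<longlonglongrightarrow> ennreal ((cmod (g x - h n x))\<^sup>2)"
        by (intro tendsto_intros)
      then show ?case by (intro lim_imp_Liminf[symmetric]) auto
    qed
    also have "\<dots> \<le> liminf (\<lambda>m. \<integral>\<^sup>+ x. ennreal ((cmod (h m x - h n x))\<^sup>2) \<partial>lebesgue)"
      using L2_measurable[OF h] by (intro nn_integral_liminf) simp
    also have "\<dots> \<le> ennreal (M * (1/8) ^ n)"
    proof (rule Liminf_le)
      show "\<forall>\<^sub>F m in sequentially. (\<integral>\<^sup>+ x. ennreal ((cmod (h m x - h n x))\<^sup>2) \<partial>lebesgue) \<le> ennreal (M * (1/8) ^ n)"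
        using eventually_ge_at_top[of n]
      proof eventually_elim
        case (elim m)
        have "(\<integral>\<^sup>+ x. ennreal ((cmod (h m x - h n x))\<^sup>2) \<partial>lebesgue) = ennreal (L2_sq (\<lambda>x. h m x - h n x))"
          unfolding L2_sq_def using L2_diff[OF h h, of m n] by (intro nn_integral_eq_integral) (auto simp: L2_def)
        then show ?case using hdiff[OF elim] by (simp add: ennreal_leI)
      qed
    qed simp
    finally show ?thesis .
  qed
  have gh: "(\<lambda>x. g x - h n x) \<in> L2" for n
  proof -
    have m: "(\<lambda>x. g x - h n x) \<in> borel_measurable lebesgue" using gm L2_measurable[OF h[of n]] by simp
    have "integrable lebesgue (\<lambda>x. (cmod (g x - h n x))\<^sup>2)"
      using m fatou[of n] by (intro integrableI_nonneg) (auto simp: less_top[symmetric] top_unique)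
    then show ?thesis using m by (simp add: L2_def)
  qed
  have ghle: "L2_sq (\<lambda>x. g x - h n x) \<le> M * (1/8) ^ n" for n
  proof -
    have "ennreal (L2_sq (\<lambda>x. g x - h n x)) = (\<integral>\<^sup>+ x. ennreal ((cmod (g x - h n x))\<^sup>2) \<partial>lebesgue)"
      unfolding L2_sq_def using gh[of n] by (intro nn_integral_eq_integral[symmetric]) (auto simp: L2_def)
    then have "ennreal (L2_sq (\<lambda>x. g x - h n x)) \<le> ennreal (M * (1/8) ^ n)" using fatou[of n] by simp
    then show ?thesis by (subst (asm) ennreal_le_iff) (simp_all add: M_nonneg)
  qed
  have gL2: "g \<in> L2" using L2_add[OF gh[of 0] h[of 0]] by simp
  have pow: "(\<lambda>n. K * (1/8::real) ^ n) \<longlonglongrightarrow> 0" for K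
    using tendsto_mult[OF tendsto_const[of K] LIMSEQ_power_zero[of "1/8::real"]] by simp
  have lim0: "(\<lambda>n. L2_sq (\<lambda>x. g x - h n x)) \<longlonglongrightarrow> 0"
    by (rule tendsto_sandwich[OF _ _ tendsto_const pow[of M]]) (intro always_eventually allI ghle L2_sq_nonneg)+
  have "H_fourier w g \<xi> = c \<xi>" if \<xi>: "\<xi> \<in> I" for \<xi>
  proof -
    have "(\<lambda>n. H_fourier w (\<lambda>x. g x - h n x) \<xi>) \<longlonglongrightarrow> 0"
      unfolding H_fourier_def by (intro L2_inner_tendsto_zero gh w \<xi> lim0)
    then have 1: "(\<lambda>n. H_fourier w g \<xi> - H_fourier w (h n) \<xi>) \<longlonglongrightarrow> 0"
      by (simp add: H_fourier_diff[where w=w and \<xi>=\<xi>] gL2 h w[OF \<xi>])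
    have sq: "(\<lambda>n. (cmod (H_fourier w (h n) \<xi> - c \<xi>))\<^sup>2) \<longlonglongrightarrow> 0"
    proof (rule tendsto_sandwich[OF _ _ tendsto_const pow[of 1]])
      have "(cmod (H_fourier w (h n) \<xi> - c \<xi>))\<^sup>2 \<le> 1 * (1/8) ^ n" for n
        using Ftail[of "{\<xi>}" n] \<xi> H_fourier_lin_comb[OF bi u F(1,2) \<xi>, of n c] unfolding h_def by (cases "\<xi> \<in> F n") auto
      then show "\<forall>\<^sub>F n in sequentially. (cmod (H_fourier w (h n) \<xi> - c \<xi>))\<^sup>2 \<le> 1 * (1/8) ^ n" by simp
    qed simp
    have "(\<lambda>n. cmod (H_fourier w (h n) \<xi> - c \<xi>)) \<longlonglongrightarrow> 0"
      using tendsto_real_sqrt[OF sq] by simp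
    then have 2: "(\<lambda>n. H_fourier w (h n) \<xi> - c \<xi>) \<longlonglongrightarrow> 0" by (rule tendsto_norm_zero_cancel)
    have "(\<lambda>n. H_fourier w g \<xi> - c \<xi>) \<longlonglongrightarrow> 0" using tendsto_add[OF 1 2] by simp
    then show ?thesis by (simp add: LIMSEQ_const_iff)
  qed
  then show thesis using that gL2 by blast
qed

section \<open>The topology of the Gevrey space\<close>

definition weighted_sq :: "'i set \<Rightarrow> ('i \<Rightarrow> real) \<Rightarrow> ('i \<Rightarrow> complex) \<Rightarrow> real" where
  "weighted_sq I \<omega> b = (\<Sum>\<^sub>\<infinity>\<xi>\<in>I. \<omega> \<xi> * (cmod (b \<xi>))\<^sup>2)"

text \<open>Summability is recorded separately since \<open>weighted_sq\<close> is 0 on divergent sums.\<close>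

definition weighted_summable :: "'i set \<Rightarrow> ('i \<Rightarrow> real) \<Rightarrow> ('i \<Rightarrow> complex) \<Rightarrow> bool" where
  "weighted_summable I \<omega> b \<longleftrightarrow> (\<lambda>\<xi>. \<omega> \<xi> * (cmod (b \<xi>))\<^sup>2) summable_on I"

definition gevrey_weight :: "('i \<Rightarrow> complex) \<Rightarrow> real \<Rightarrow> real \<Rightarrow> 'i \<Rightarrow> real" where
  "gevrey_weight lam s A \<xi> = exp (2 * A * japanese lam \<xi> powr (1 / s))"

text \<open>The weights whose seminorms are continuous on every step of the Gevrey scale.\<close>

definition admissible_weight :: "'i set \<Rightarrow> ('i \<Rightarrow> complex) \<Rightarrow> real \<Rightarrow> ('i \<Rightarrow> real) \<Rightarrow> bool" where
  "admissible_weight I lam s \<omega> \<longleftrightarrow> (\<forall>\<xi>\<in>I. 0 \<le> \<omega> \<xi>) \<and>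
     (\<forall>A>0. \<exists>C\<ge>0. \<forall>\<xi>\<in>I. \<omega> \<xi> \<le> C * gevrey_weight lam s A \<xi>)"

lemma nonneg_bounded_sums_imp_summable_on:
  fixes f :: "'i \<Rightarrow> real"
  assumes "\<And>x. x \<in> I \<Longrightarrow> 0 \<le> f x" "\<And>F. finite F \<Longrightarrow> F \<subseteq> I \<Longrightarrow> sum f F \<le> B"
  shows "f summable_on I" "infsum f I \<le> B"
proof -
  show s: "f summable_on I"
    by (rule nonneg_bdd_above_summable_on) (use assms in \<open>auto intro!: bdd_aboveI[of _ B]\<close>)
  show "infsum f I \<le> B" by (rule infsum_le_finite_sums[OF s]) (use assms in auto)
qed

lemma weighted_sq_bounded:
  assumes "\<And>\<xi>. \<xi> \<in> I \<Longrightarrow> 0 \<le> \<omega> \<xi>" "\<And>F. finite F \<Longrightarrow> F \<subseteq> I \<Longrightarrow> (\<Sum>\<xi>\<in>F. \<omega> \<xi> * (cmod (b \<xi>))\<^sup>2) \<le> B"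
  shows "weighted_summable I \<omega> b" "weighted_sq I \<omega> b \<le> B"
  unfolding weighted_summable_def weighted_sq_def
  using nonneg_bounded_sums_imp_summable_on[of I "\<lambda>\<xi>. \<omega> \<xi> * (cmod (b \<xi>))\<^sup>2" B] assms by auto

lemma finite_sum_le_weighted_sq:
  assumes "\<And>\<xi>. \<xi> \<in> I \<Longrightarrow> 0 \<le> \<omega> \<xi>" "weighted_summable I \<omega> b" "finite F" "F \<subseteq> I"
  shows "(\<Sum>\<xi>\<in>F. \<omega> \<xi> * (cmod (b \<xi>))\<^sup>2) \<le> weighted_sq I \<omega> b"
  using assms unfolding weighted_sq_def weighted_summable_def by (intro finite_sum_le_infsum) auto

lemma weighted_sq_nonneg: "(\<And>\<xi>. \<xi> \<in> I \<Longrightarrow> 0 \<le> \<omega> \<xi>) \<Longrightarrow> 0 \<le> weighted_sq I \<omega> b"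
  unfolding weighted_sq_def by (intro infsum_nonneg) auto

lemma weighted_summable_mono:
  assumes "\<And>\<xi>. \<xi> \<in> I \<Longrightarrow> 0 \<le> \<omega> \<xi>" "\<And>\<xi>. \<xi> \<in> I \<Longrightarrow> \<omega> \<xi> \<le> C * \<nu> \<xi>"
    "weighted_summable I \<nu> b"
  shows "weighted_summable I \<omega> b" "weighted_sq I \<omega> b \<le> C * weighted_sq I \<nu> b"
proof -
  have le: "\<omega> \<xi> * (cmod (b \<xi>))\<^sup>2 \<le> C * (\<nu> \<xi> * (cmod (b \<xi>))\<^sup>2)" if "\<xi> \<in> I" for \<xi>
    using mult_right_mono[OF assms(2)[OF that], of "(cmod (b \<xi>))\<^sup>2"] by (simp add: mult.assoc)
  have s: "(\<lambda>\<xi>. C * (\<nu> \<xi> * (cmod (b \<xi>))\<^sup>2)) summable_on I"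
    using assms(3) unfolding weighted_summable_def by (rule summable_on_cmult_right)
  show w: "weighted_summable I \<omega> b" unfolding weighted_summable_def
    by (rule summable_on_comparison_test[OF s]) (use le assms(1) in auto)
  have "weighted_sq I \<omega> b \<le> (\<Sum>\<^sub>\<infinity>\<xi>\<in>I. C * (\<nu> \<xi> * (cmod (b \<xi>))\<^sup>2))"
    unfolding weighted_sq_def using w le s by (intro infsum_mono) (auto simp: weighted_summable_def)
  also have "\<dots> = C * weighted_sq I \<nu> b" unfolding weighted_sq_def by (rule infsum_cmult_right')
  finally show "weighted_sq I \<omega> b \<le> C * weighted_sq I \<nu> b" .
qed

lemma cmod_lin_square_le:
  assumes "0 < \<theta>" "\<theta> < 1"
  shows "(cmod (x + y))\<^sup>2 \<le> (cmod x)\<^sup>2 / \<theta> + (cmod y)\<^sup>2 / (1 - \<theta>)"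
proof -
  have "0 \<le> ((1 - \<theta>) * cmod x - \<theta> * cmod y)\<^sup>2" by simp
  then have *: "(cmod x + cmod y)\<^sup>2 * (\<theta> * (1 - \<theta>)) \<le> (1 - \<theta>) * (cmod x)\<^sup>2 + \<theta> * (cmod y)\<^sup>2"
    by (simp add: power2_eq_square algebra_simps)
  have "(cmod (x + y))\<^sup>2 \<le> (cmod x + cmod y)\<^sup>2" by (intro power_mono norm_triangle_ineq) auto
  also have "\<dots> \<le> ((1 - \<theta>) * (cmod x)\<^sup>2 + \<theta> * (cmod y)\<^sup>2) / (\<theta> * (1 - \<theta>))"
    using * assms by (simp add: pos_le_divide_eq)
  also have "\<dots> = (cmod x)\<^sup>2 / \<theta> + (cmod y)\<^sup>2 / (1 - \<theta>)" using assms by (simp add: add_divide_distrib)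
  finally show ?thesis .
qed

text \<open>The triangle inequality for squared norms with a free parameter \<open>\<theta>\<close>. The parameter gives convexity
of balls and openness of balls with sharp radii without passing to square roots.\<close>

lemma weighted_sq_add:
  assumes \<omega>: "\<And>\<xi>. \<xi> \<in> I \<Longrightarrow> 0 \<le> \<omega> \<xi>" and b: "weighted_summable I \<omega> b" and c: "weighted_summable I \<omega> c"
    and \<theta>: "0 < \<theta>" "\<theta> < 1"
  shows "weighted_summable I \<omega> (\<lambda>\<xi>. b \<xi> + c \<xi>)"
    "weighted_sq I \<omega> (\<lambda>\<xi>. b \<xi> + c \<xi>) \<le> weighted_sq I \<omega> b / \<theta> + weighted_sq I \<omega> c / (1 - \<theta>)"
proof -
  have *: "(\<Sum>\<xi>\<in>F. \<omega> \<xi> * (cmod (b \<xi> + c \<xi>))\<^sup>2) \<le> weighted_sq I \<omega> b / \<theta> + weighted_sq I \<omega> c / (1 - \<theta>)"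
    if F: "finite F" "F \<subseteq> I" for F
  proof -
    have "(\<Sum>\<xi>\<in>F. \<omega> \<xi> * (cmod (b \<xi> + c \<xi>))\<^sup>2) \<le> (\<Sum>\<xi>\<in>F. \<omega> \<xi> * ((cmod (b \<xi>))\<^sup>2 / \<theta> + (cmod (c \<xi>))\<^sup>2 / (1 - \<theta>)))"
      using F \<omega> by (intro sum_mono mult_left_mono cmod_lin_square_le \<theta>) auto
    also have "\<dots> = (\<Sum>\<xi>\<in>F. \<omega> \<xi> * (cmod (b \<xi>))\<^sup>2) / \<theta> + (\<Sum>\<xi>\<in>F. \<omega> \<xi> * (cmod (c \<xi>))\<^sup>2) / (1 - \<theta>)"
      by (simp add: sum.distrib distrib_left sum_divide_distrib)
    also have "\<dots> \<le> weighted_sq I \<omega> b / \<theta> + weighted_sq I \<omega> c / (1 - \<theta>)"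
      using \<theta> by (intro add_mono divide_right_mono finite_sum_le_weighted_sq \<omega> b c F) auto
    finally show ?thesis .
  qed
  show "weighted_summable I \<omega> (\<lambda>\<xi>. b \<xi> + c \<xi>)" by (rule weighted_sq_bounded(1)[OF \<omega> *])
  show "weighted_sq I \<omega> (\<lambda>\<xi>. b \<xi> + c \<xi>) \<le> weighted_sq I \<omega> b / \<theta> + weighted_sq I \<omega> c / (1 - \<theta>)"
    by (rule weighted_sq_bounded(2)[OF \<omega> *])
qed

lemma weighted_sq_cmult:
  shows "weighted_summable I \<omega> b \<Longrightarrow> weighted_summable I \<omega> (\<lambda>\<xi>. k * b \<xi>)"
    "weighted_sq I \<omega> (\<lambda>\<xi>. k * b \<xi>) = (cmod k)\<^sup>2 * weighted_sq I \<omega> b"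
proof -
  have eq: "(\<lambda>\<xi>. \<omega> \<xi> * (cmod (k * b \<xi>))\<^sup>2) = (\<lambda>\<xi>. (cmod k)\<^sup>2 * (\<omega> \<xi> * (cmod (b \<xi>))\<^sup>2))"
    by (simp add: norm_mult power_mult_distrib mult.left_commute)
  show "weighted_summable I \<omega> b \<Longrightarrow> weighted_summable I \<omega> (\<lambda>\<xi>. k * b \<xi>)"
    unfolding weighted_summable_def eq by (rule summable_on_cmult_right)
  show "weighted_sq I \<omega> (\<lambda>\<xi>. k * b \<xi>) = (cmod k)\<^sup>2 * weighted_sq I \<omega> b"
    unfolding weighted_sq_def eq by (rule infsum_cmult_right')
qed

lemma weighted_cong:
  assumes "\<And>\<xi>. \<xi> \<in> I \<Longrightarrow> b \<xi> = c \<xi>"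
  shows "weighted_summable I \<omega> b \<longleftrightarrow> weighted_summable I \<omega> c" "weighted_sq I \<omega> b = weighted_sq I \<omega> c"
  unfolding weighted_summable_def weighted_sq_def using assms by (auto intro!: summable_on_cong infsum_cong)

lemma japanese_ge_1: "japanese lam \<xi> \<ge> 1"
  unfolding japanese_def by (intro ge_one_powr_ge_zero) auto

lemma gevrey_weight_pos: "0 < gevrey_weight lam s A \<xi>" by (simp add: gevrey_weight_def)

lemma gevrey_weight_mono: "A \<le> B \<Longrightarrow> gevrey_weight lam s A \<xi> \<le> gevrey_weight lam s B \<xi>"
  unfolding gevrey_weight_def by (simp add: mult_right_mono)

lemma gevrey_weight_ge_1: "A \<ge> 0 \<Longrightarrow> 1 \<le> gevrey_weight lam s A \<xi>"
  by (simp add: gevrey_weight_def)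

locale gevrey_scale =
  fixes I :: "'i set" and lam :: "'i \<Rightarrow> complex" and u w :: "'i \<Rightarrow> real^'n \<Rightarrow> complex" and s :: real
  assumes rb: "riesz_basis I u" and bi: "biorthogonal I u w"
begin

abbreviation "coef \<equiv> H_fourier w"
abbreviation "\<gamma> \<equiv> gevrey I lam w s"
abbreviation "wt \<equiv> gevrey_weight lam s"
abbreviation "adm \<equiv> admissible_weight I lam s"

lemma w_L2: "\<xi> \<in> I \<Longrightarrow> w \<xi> \<in> L2" using bi by (simp add: biorthogonal_def)

lemma coef_lin: "f \<in> L2 \<Longrightarrow> g \<in> L2 \<Longrightarrow> \<xi> \<in> I \<Longrightarrow> coef (\<lambda>x. b * f x + c * g x) \<xi> = b * coef f \<xi> + c * coef g \<xi>"
  by (intro H_fourier_lin w_L2)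

lemma coef_diff: "f \<in> L2 \<Longrightarrow> g \<in> L2 \<Longrightarrow> \<xi> \<in> I \<Longrightarrow> coef (\<lambda>x. f x - g x) \<xi> = coef f \<xi> - coef g \<xi>"
  by (intro H_fourier_diff w_L2)

lemma coef_add: "f \<in> L2 \<Longrightarrow> g \<in> L2 \<Longrightarrow> \<xi> \<in> I \<Longrightarrow> coef (\<lambda>x. f x + g x) \<xi> = coef f \<xi> + coef g \<xi>"
  by (intro H_fourier_add w_L2)

lemma gevrey_step_iff: "f \<in> gevrey_step I lam w s A \<longleftrightarrow> f \<in> L2 \<and> weighted_summable I (wt A) (coef f)"
  by (simp add: gevrey_step_def weighted_summable_def gevrey_term_def[abs_def] gevrey_weight_def)

lemma gevrey_norm_eq: "gevrey_norm I lam w s A f = sqrt (weighted_sq I (wt A) (coef f))"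
  by (simp add: gevrey_norm_def weighted_sq_def gevrey_term_def[abs_def] gevrey_weight_def)

lemma wt_nonneg: "0 \<le> wt A \<xi>" by (simp add: gevrey_weight_def)

lemma wt_summable_mono: "A \<le> B \<Longrightarrow> weighted_summable I (wt B) b \<Longrightarrow> weighted_summable I (wt A) b"
  by (rule weighted_summable_mono(1)[where C=1 and \<nu>="wt B"]) (auto simp: gevrey_weight_mono wt_nonneg)

lemma gevrey_iff: "f \<in> \<gamma> \<longleftrightarrow> f \<in> L2 \<and> (\<exists>A>0. weighted_summable I (wt A) (coef f))"
  unfolding gevrey_def by (auto simp: gevrey_step_iff)

lemma gevrey_L2: "f \<in> \<gamma> \<Longrightarrow> f \<in> L2" by (simp add: gevrey_iff)

lemma gevrey_lin:
  assumes f: "f \<in> \<gamma>" and g: "g \<in> \<gamma>" shows "(\<lambda>x. b * f x + c * g x) \<in> \<gamma>"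
proof -
  obtain A where A: "A > 0" "weighted_summable I (wt A) (coef f)" using f by (auto simp: gevrey_iff)
  obtain B where B: "B > 0" "weighted_summable I (wt B) (coef g)" using g by (auto simp: gevrey_iff)
  have "weighted_summable I (wt (min A B)) (coef f)" "weighted_summable I (wt (min A B)) (coef g)"
    by (rule wt_summable_mono[OF min.cobounded1 A(2)], rule wt_summable_mono[OF min.cobounded2 B(2)])
  then have "weighted_summable I (wt (min A B)) (\<lambda>\<xi>. b * coef f \<xi> + c * coef g \<xi>)"
    by (intro weighted_sq_add(1)[where \<theta>="1/2"] weighted_sq_cmult wt_nonneg) auto
  then have "weighted_summable I (wt (min A B)) (coef (\<lambda>x. b * f x + c * g x))"
    using weighted_cong(1)[of I "coef (\<lambda>x. b * f x + c * g x)" "\<lambda>\<xi>. b * coef f \<xi> + c * coef g \<xi>"]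
      coef_lin[OF gevrey_L2[OF f] gevrey_L2[OF g]] by blast
  then show ?thesis using A B L2_lin[OF gevrey_L2[OF f] gevrey_L2[OF g]]
    by (auto simp: gevrey_iff intro!: exI[of _ "min A B"])
qed

lemma gevrey_diff: "f \<in> \<gamma> \<Longrightarrow> g \<in> \<gamma> \<Longrightarrow> (\<lambda>x. f x - g x) \<in> \<gamma>"
  using gevrey_lin[of f g 1 "-1"] by simp

lemma gevrey_add: "f \<in> \<gamma> \<Longrightarrow> g \<in> \<gamma> \<Longrightarrow> (\<lambda>x. f x + g x) \<in> \<gamma>"
  using gevrey_lin[of f g 1 1] by simp

lemma adm_nonneg: "adm \<omega> \<Longrightarrow> \<xi> \<in> I \<Longrightarrow> 0 \<le> \<omega> \<xi>" by (simp add: admissible_weight_def)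

lemma adm_summable:
  assumes "adm \<omega>" "A > 0" "weighted_summable I (wt A) b"
  shows "weighted_summable I \<omega> b"
proof -
  obtain C where "\<forall>\<xi>\<in>I. \<omega> \<xi> \<le> C * wt A \<xi>" using assms unfolding admissible_weight_def by blast
  then show ?thesis using weighted_summable_mono(1)[where C=C and \<nu>="wt A"] adm_nonneg[OF assms(1)] assms(3) by blast
qed

lemma adm_gevrey_summable: "adm \<omega> \<Longrightarrow> f \<in> \<gamma> \<Longrightarrow> weighted_summable I \<omega> (coef f)"
  by (auto simp: gevrey_iff intro: adm_summable)

lemma gevrey_nhd_top: "gevrey_nhd I lam w s \<gamma>"
  unfolding gevrey_nhd_def
proof (intro conjI ballI allI impI)
  show "\<exists>r>0. \<forall>g\<in>gevrey_step I lam w s A. gevrey_norm I lam w s A g < r \<longrightarrow> g \<in> \<gamma>" if "A > 0" for A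
    using that by (intro exI[of _ 1]) (auto simp: gevrey_def)
qed (auto intro: gevrey_lin)

lemma topspace_gevrey: "topspace (gevrey_topology I lam w s) = \<gamma>"
proof -
  have "openin (gevrey_topology I lam w s) \<gamma>"
    unfolding openin_gevrey_topology using gevrey_nhd_top gevrey_add by blast
  moreover have "W \<subseteq> \<gamma>" if "openin (gevrey_topology I lam w s) W" for W
    using that unfolding openin_gevrey_topology by blast
  ultimately show ?thesis by (meson openin_subset openin_topspace subset_antisym)
qed

lemma weighted_ball_nhd:
  assumes \<omega>: "adm \<omega>" and r: "r > 0"
  shows "gevrey_nhd I lam w s {g \<in> \<gamma>. weighted_sq I \<omega> (coef g) < r}"
  unfolding gevrey_nhd_def
proof (intro conjI ballI allI impI)
  fix g h b c assume gh: "g \<in> {g \<in> \<gamma>. weighted_sq I \<omega> (coef g) < r}" "h \<in> {g \<in> \<gamma>. weighted_sq I \<omega> (coef g) < r}"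
    and bc: "cmod b + cmod c \<le> (1::real)"
  have wg: "weighted_summable I \<omega> (coef g)" "weighted_summable I \<omega> (coef h)" using adm_gevrey_summable[OF \<omega>] gh by auto
  \<comment> \<open>a convex weight with \<open>cmod b \<le> \<beta>\<close> and \<open>cmod c \<le> 1 - \<beta>\<close>\<close>
  define \<beta> where "\<beta> = (cmod b + 1 - cmod c) / 2"
  define x y where "x = weighted_sq I \<omega> (coef g)" and "y = weighted_sq I \<omega> (coef h)"
  have xy: "0 \<le> x" "x < r" "0 \<le> y" "y < r" using gh weighted_sq_nonneg[OF adm_nonneg[OF \<omega>]] by (auto simp: x_def y_def)
  have eq: "weighted_sq I \<omega> (coef (\<lambda>x. b * g x + c * h x)) = weighted_sq I \<omega> (\<lambda>\<xi>. b * coef g \<xi> + c * coef h \<xi>)"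
    using gh by (intro weighted_cong coef_lin gevrey_L2) auto
  have "weighted_sq I \<omega> (\<lambda>\<xi>. b * coef g \<xi> + c * coef h \<xi>) < r"
  proof (cases "c = 0 \<or> b = 0")
    case True
    have 1: "(cmod k)\<^sup>2 * z < r" if "cmod k \<le> 1" "0 \<le> z" "z < r" for k :: complex and z
    proof -
      have "(cmod k)\<^sup>2 * z \<le> 1 * z" using that by (intro mult_right_mono power_le_one) auto
      then show ?thesis using that by simp
    qed
    have "cmod b \<le> 1" "cmod c \<le> 1" using bc norm_ge_zero[of b] norm_ge_zero[of c] by linarith+
    then show ?thesis using True 1[of b x] 1[of c y] xy by (auto simp: weighted_sq_cmult(2) x_def y_def)
  next
    case False
    then have bc0: "cmod b > 0" "cmod c > 0" by auto
    have "2 * \<beta> = cmod b + 1 - cmod c" by (simp add: \<beta>_def)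
    then have \<beta>: "0 < \<beta>" "\<beta> < 1" "cmod b \<le> \<beta>" "cmod c \<le> 1 - \<beta>" using bc bc0 by linarith+
    have "weighted_sq I \<omega> (\<lambda>\<xi>. b * coef g \<xi> + c * coef h \<xi>) \<le> ((cmod b)\<^sup>2 * x) / \<beta> + ((cmod c)\<^sup>2 * y) / (1 - \<beta>)"
      unfolding x_def y_def weighted_sq_cmult(2)[symmetric]
      by (intro weighted_sq_add(2) adm_nonneg[OF \<omega>] weighted_sq_cmult wg \<beta>)
    also have "\<dots> \<le> (\<beta>\<^sup>2 * x) / \<beta> + ((1 - \<beta>)\<^sup>2 * y) / (1 - \<beta>)"
      using \<beta> xy by (intro add_mono divide_right_mono mult_right_mono power_mono) auto
    also have "\<dots> = \<beta> * x + (1 - \<beta>) * y" using \<beta> by (simp add: power2_eq_square)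
    also have "\<dots> < \<beta> * r + (1 - \<beta>) * r" using \<beta> xy by (intro add_strict_mono mult_strict_left_mono) auto
    also have "\<dots> = r" by (simp add: algebra_simps)
    finally show ?thesis .
  qed
  then show "(\<lambda>x. b * g x + c * h x) \<in> {g \<in> \<gamma>. weighted_sq I \<omega> (coef g) < r}"
    using gh by (auto simp: eq intro: gevrey_lin)
next
  fix A :: real assume A: "A > 0"
  obtain C where C: "C \<ge> 0" "\<And>\<xi>. \<xi> \<in> I \<Longrightarrow> \<omega> \<xi> \<le> C * wt A \<xi>" using \<omega> A unfolding admissible_weight_def by blast
  show "\<exists>\<rho>>0. \<forall>g\<in>gevrey_step I lam w s A. gevrey_norm I lam w s A g < \<rho> \<longrightarrow> g \<in> {g \<in> \<gamma>. weighted_sq I \<omega> (coef g) < r}"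
  proof (intro exI[of _ "sqrt (r / (C + 1))"] conjI ballI impI)
    show "0 < sqrt (r / (C + 1))" using r C by simp
    fix g assume g: "g \<in> gevrey_step I lam w s A" and n: "gevrey_norm I lam w s A g < sqrt (r / (C + 1))"
    have "weighted_sq I \<omega> (coef g) \<le> C * weighted_sq I (wt A) (coef g)"
      using g by (intro weighted_summable_mono(2) adm_nonneg[OF \<omega>] C) (auto simp: gevrey_step_iff)
    also have "\<dots> \<le> (C + 1) * weighted_sq I (wt A) (coef g)"
      by (intro mult_right_mono weighted_sq_nonneg wt_nonneg) auto
    also have "\<dots> < r" using n C by (simp add: gevrey_norm_eq pos_less_divide_eq mult.commute)
    finally show "g \<in> {g \<in> \<gamma>. weighted_sq I \<omega> (coef g) < r}" using g A by (auto simp: gevrey_iff gevrey_step_iff)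
  qed
qed auto

text \<open>Balls of a seminorm are open. The parameter \<open>\<theta>\<close> of the triangle inequality is chosen such that
\<open>x / \<theta>\<close>, where \<open>x\<close> is the squared distance of \<open>f\<close> from the centre, is still less than \<open>r\<close>.\<close>

lemma weighted_ball_open:
  assumes \<omega>: "adm \<omega>" and l: "l \<in> \<gamma>"
  shows "openin (gevrey_topology I lam w s) {g \<in> \<gamma>. weighted_sq I \<omega> (\<lambda>\<xi>. coef g \<xi> - coef l \<xi>) < r}" (is "openin _ ?O")
  unfolding openin_gevrey_topology
proof (intro conjI ballI)
  fix f assume f: "f \<in> ?O"
  define x where "x = weighted_sq I \<omega> (\<lambda>\<xi>. coef f \<xi> - coef l \<xi>)"
  have x: "0 \<le> x" "x < r" using f weighted_sq_nonneg[OF adm_nonneg[OF \<omega>]] by (auto simp: x_def)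
  define \<theta> where "\<theta> = (x + r) / (2 * r)"
  have r: "r > 0" using x by simp
  have \<theta>: "0 < \<theta>" "\<theta> < 1" using x r by (auto simp: \<theta>_def field_simps)
  have x\<theta>: "x / \<theta> < r"
  proof -
    have "r * \<theta> = (x + r) / 2" using r by (simp add: \<theta>_def)
    then have "x < r * \<theta>" using x by simp
    then show ?thesis using \<theta> by (simp add: pos_divide_less_eq)
  qed
  define \<rho> where "\<rho> = (r - x / \<theta>) * (1 - \<theta>)"
  have \<rho>: "\<rho> > 0" using x\<theta> \<theta> by (simp add: \<rho>_def)
  show "\<exists>U. gevrey_nhd I lam w s U \<and> (\<forall>g\<in>U. (\<lambda>x. f x + g x) \<in> ?O)"
  proof (intro exI conjI ballI)
    show "gevrey_nhd I lam w s {g \<in> \<gamma>. weighted_sq I \<omega> (coef g) < \<rho>}" by (rule weighted_ball_nhd[OF \<omega> \<rho>])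
    fix g assume g: "g \<in> {g \<in> \<gamma>. weighted_sq I \<omega> (coef g) < \<rho>}"
    have fl: "(\<lambda>x. f x - l x) \<in> \<gamma>" using f l by (intro gevrey_diff) auto
    have sm: "weighted_summable I \<omega> (\<lambda>\<xi>. coef f \<xi> - coef l \<xi>)"
      using adm_gevrey_summable[OF \<omega> fl] weighted_cong(1)[of I "coef (\<lambda>x. f x - l x)" "\<lambda>\<xi>. coef f \<xi> - coef l \<xi>"]
        coef_diff[of f l] f l gevrey_L2 by blast
    have "weighted_sq I \<omega> (\<lambda>\<xi>. coef (\<lambda>x. f x + g x) \<xi> - coef l \<xi>) = weighted_sq I \<omega> (\<lambda>\<xi>. (coef f \<xi> - coef l \<xi>) + coef g \<xi>)"
      using f g by (intro weighted_cong) (simp add: coef_add gevrey_L2)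
    also have "\<dots> \<le> x / \<theta> + weighted_sq I \<omega> (coef g) / (1 - \<theta>)"
      unfolding x_def using g by (intro weighted_sq_add(2) adm_nonneg[OF \<omega>] sm adm_gevrey_summable[OF \<omega>] \<theta>) auto
    also have "\<dots> < x / \<theta> + \<rho> / (1 - \<theta>)" using g \<theta> by (intro add_strict_left_mono divide_strict_right_mono) auto
    also have "\<dots> = r" using \<theta> by (simp add: \<rho>_def)
    finally show "(\<lambda>x. f x + g x) \<in> ?O" using f g by (auto intro: gevrey_add)
  qed
qed auto


text \<open>Admissible weights arise as minima of multiples of the Gevrey weights of the steps with
\<open>A = 1 / (j + 1)\<close>. As the factors tend to infinity and the Gevrey weights are at least 1, the
minimum is attained.\<close>

lemma minimal_weight:
  fixes K :: "nat \<Rightarrow> real"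
  assumes K: "\<And>j. K j \<ge> real j + 1"
  obtains \<omega> where "adm \<omega>" "\<And>\<xi> j. \<omega> \<xi> \<le> K j * wt (1 / real (Suc j)) \<xi>" "\<And>\<xi>. \<exists>j. \<omega> \<xi> = K j * wt (1 / real (Suc j)) \<xi>"
proof -
  define v where "v j \<xi> = K j * wt (1 / real (Suc j)) \<xi>" for j \<xi>
  have v: "v j \<xi> \<ge> real j + 1" for j \<xi>
  proof -
    have "(real j + 1) * 1 \<le> K j * wt (1 / real (Suc j)) \<xi>"
      using K[of j] gevrey_weight_ge_1[of "1 / real (Suc j)" lam s \<xi>] by (intro mult_mono) auto
    then show ?thesis by (simp add: v_def)
  qed
  have "\<exists>j. \<forall>k. v j \<xi> \<le> v k \<xi>" for \<xi>
  proof -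
    define n where "n = nat \<lceil>v 0 \<xi>\<rceil>"
    obtain j where j: "j \<in> {..n}" "\<And>k. k \<in> {..n} \<Longrightarrow> v j \<xi> \<le> v k \<xi>"
      using ex_min_if_finite[of "(\<lambda>k. v k \<xi>) ` {..n}"] by (force simp: not_less)
    have "v j \<xi> \<le> v k \<xi>" for k
    proof (cases "k \<le> n")
      case False
      then have "v 0 \<xi> \<le> real k" unfolding n_def by linarith
      then show ?thesis using j(2)[of 0] v[of k \<xi>] by simp
    qed (use j in auto)
    then show ?thesis by blast
  qed
  then obtain J where J: "\<And>\<xi> k. v (J \<xi>) \<xi> \<le> v k \<xi>" by metis
  define \<omega> where "\<omega> \<xi> = v (J \<xi>) \<xi>" for \<xi>
  show thesis
  proof
    show le: "\<omega> \<xi> \<le> K j * wt (1 / real (Suc j)) \<xi>" for \<xi> j using J by (simp add: \<omega>_def v_def)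
    show "\<exists>j. \<omega> \<xi> = K j * wt (1 / real (Suc j)) \<xi>" for \<xi> by (auto simp: \<omega>_def v_def)
    show "adm \<omega>"
      unfolding admissible_weight_def
    proof (intro conjI ballI allI impI)
      show "0 \<le> \<omega> \<xi>" for \<xi> using v[of "J \<xi>" \<xi>] by (simp add: \<omega>_def)
      fix A :: real assume "A > 0"
      then obtain j where "inverse (real (Suc j)) < A" using reals_Archimedean by blast
      then have j: "1 / real (Suc j) \<le> A" by (simp add: inverse_eq_divide)
      have "\<omega> \<xi> \<le> K j * wt A \<xi>" for \<xi>
        using K[of j] by (intro order_trans[OF le[of \<xi> j]] mult_left_mono gevrey_weight_mono j) auto
      then show "\<exists>C\<ge>0. \<forall>\<xi>\<in>I. \<omega> \<xi> \<le> C * wt A \<xi>" using K[of j] by (intro exI[of _ "K j"]) auto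
    qed
  qed
qed

lemma synthesize:
  assumes "weighted_summable I (wt A) b" "A > 0"
  obtains g where "g \<in> \<gamma>" "g \<in> gevrey_step I lam w s A" "\<And>\<xi>. \<xi> \<in> I \<Longrightarrow> coef g \<xi> = b \<xi>"
proof -
  have "weighted_summable I (\<lambda>_. 1) b"
    by (rule weighted_summable_mono(1)[where C=1 and \<nu>="wt A"]) (use assms gevrey_weight_ge_1[of A lam s] in auto)
  then have "(\<lambda>\<xi>. (cmod (b \<xi>))\<^sup>2) summable_on I" by (simp add: weighted_summable_def)
  then obtain g where g: "g \<in> L2" "\<And>\<xi>. \<xi> \<in> I \<Longrightarrow> coef g \<xi> = b \<xi>" using riesz_fischer[OF rb bi] by blast
  have "weighted_summable I (wt A) (coef g)" using weighted_cong(1)[of I "coef g" b] g(2) assms(1) by blast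
  then show thesis using g assms(2) by (intro that[of g]) (auto simp: gevrey_iff gevrey_step_iff)
qed

lemma coefficients_eq_imp_AE_eq:
  assumes "f \<in> L2" "g \<in> L2" "\<And>\<xi>. \<xi> \<in> I \<Longrightarrow> coef f \<xi> = coef g \<xi>"
  shows "AE x in lebesgue. f x = g x"
proof -
  have "AE x in lebesgue. f x - g x = 0"
    by (rule L2_zero_coefficients_AE[OF rb bi L2_diff[OF assms(1,2)]]) (simp add: coef_diff assms)
  then show ?thesis by eventually_elim simp
qed

text \<open>If the ball of radius \<open>r j\<close> of the \<open>j\<close>-th step lies in \<open>U\<close>, take the minimal weight with factors
\<open>K j\<close> of order \<open>(2 ^ j / r j)\<^sup>2\<close>. An element \<open>g\<close> of its unit ball is split according to the index \<open>J \<xi>\<close>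
at which the minimum is attained. The \<open>j\<close>-th part is so small in the \<open>j\<close>-th step that \<open>2 ^ (j + 2)\<close> times
it lies in \<open>U\<close>. Since \<open>g\<close> belongs to some step, the tail of the decomposition is small
there, so that \<open>g\<close> is a convex combination of finitely many parts and a tail, all in \<open>U\<close>.\<close>

lemma nhd_contains_weighted_ball:
  assumes U: "gevrey_nhd I lam w s U"
  obtains \<omega> where "adm \<omega>" "{g \<in> \<gamma>. weighted_sq I \<omega> (coef g) < 1} \<subseteq> U"
proof -
  have U_lin: "(\<lambda>x. b * g x + c * h x) \<in> U" if "g \<in> U" "h \<in> U" "cmod b + cmod c \<le> 1" for g h b c
    using U that unfolding gevrey_nhd_def by blast
  have "\<forall>j. \<exists>r>0. \<forall>g\<in>gevrey_step I lam w s (1 / real (Suc j)). gevrey_norm I lam w s (1 / real (Suc j)) g < r \<longrightarrow> g \<in> U"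
    using U unfolding gevrey_nhd_def by simp
  then obtain r where r: "\<And>j::nat. r j > 0"
    "\<And>j g. g \<in> gevrey_step I lam w s (1 / real (Suc j)) \<Longrightarrow> gevrey_norm I lam w s (1 / real (Suc j)) g < r j \<Longrightarrow> g \<in> U"
    by metis
  have rU: "g \<in> U" if "g \<in> L2" "weighted_summable I (wt (1 / real (Suc j))) (coef g)" "weighted_sq I (wt (1 / real (Suc j))) (coef g) < (r j)\<^sup>2" for g j
    using that r(1)[of j] by (intro r(2)) (auto simp: gevrey_step_iff gevrey_norm_eq real_less_lsqrt)
  define K where "K j = max (real j + 1) ((2 ^ (j + 2) / r j)\<^sup>2)" for j
  obtain \<omega> where \<omega>: "adm \<omega>" "\<And>\<xi> j. \<omega> \<xi> \<le> K j * wt (1 / real (Suc j)) \<xi>" "\<And>\<xi>. \<exists>j. \<omega> \<xi> = K j * wt (1 / real (Suc j)) \<xi>"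
    using minimal_weight[of K] by (metis K_def max.cobounded1)
  obtain J where J: "\<And>\<xi>. \<omega> \<xi> = K (J \<xi>) * wt (1 / real (Suc (J \<xi>))) \<xi>" using \<omega>(3) by metis
  have "g \<in> U" if g: "g \<in> \<gamma>" and g1: "weighted_sq I \<omega> (coef g) < 1" for g
  proof -
    define part where "part j \<xi> = (if J \<xi> = j then coef g \<xi> else 0)" for j \<xi>
    \<comment> \<open>the part of \<open>g\<close> where the minimum is attained at \<open>j\<close> is small in the \<open>j\<close>-th step\<close>
    have psmall: "weighted_summable I (wt (1 / real (Suc j))) (part j)"
       "weighted_sq I (wt (1 / real (Suc j))) (part j) \<le> 1 / K j * weighted_sq I \<omega> (coef g)" for j
    proof -
      have Kj: "K j > 0" unfolding K_def by simp
      have *: "(\<Sum>\<xi>\<in>F. wt (1 / real (Suc j)) \<xi> * (cmod (part j \<xi>))\<^sup>2) \<le> 1 / K j * weighted_sq I \<omega> (coef g)" if F: "finite F" "F \<subseteq> I" for F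
      proof -
        have "(\<Sum>\<xi>\<in>F. wt (1 / real (Suc j)) \<xi> * (cmod (part j \<xi>))\<^sup>2) \<le> (\<Sum>\<xi>\<in>F. 1 / K j * (\<omega> \<xi> * (cmod (coef g \<xi>))\<^sup>2))"
        proof (rule sum_mono)
          fix \<xi> assume "\<xi> \<in> F"
          show "wt (1 / real (Suc j)) \<xi> * (cmod (part j \<xi>))\<^sup>2 \<le> 1 / K j * (\<omega> \<xi> * (cmod (coef g \<xi>))\<^sup>2)"
          proof (cases "J \<xi> = j")
            case True then show ?thesis using Kj J[of \<xi>] by (simp add: part_def)
          next
            case False
            have "0 \<le> \<omega> \<xi>" using adm_nonneg[OF \<omega>(1)] \<open>\<xi> \<in> F\<close> F by auto
            then show ?thesis using False Kj by (simp add: part_def)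
          qed
        qed
        also have "\<dots> = 1 / K j * (\<Sum>\<xi>\<in>F. \<omega> \<xi> * (cmod (coef g \<xi>))\<^sup>2)" by (rule sum_distrib_left[symmetric])
        also have "\<dots> \<le> 1 / K j * weighted_sq I \<omega> (coef g)"
          using Kj F by (intro mult_left_mono finite_sum_le_weighted_sq adm_nonneg[OF \<omega>(1)] adm_gevrey_summable[OF \<omega>(1) g]) auto
        finally show ?thesis .
      qed
      show "weighted_summable I (wt (1 / real (Suc j))) (part j)" by (rule weighted_sq_bounded(1)[OF wt_nonneg *])
      show "weighted_sq I (wt (1 / real (Suc j))) (part j) \<le> 1 / K j * weighted_sq I \<omega> (coef g)"
        by (rule weighted_sq_bounded(2)[OF wt_nonneg *])
    qed
    have "\<exists>h. h \<in> \<gamma> \<and> (\<forall>\<xi>\<in>I. coef h \<xi> = part j \<xi>)" for j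
      using synthesize[OF psmall(1)[of j]] by (metis of_nat_0_less_iff zero_less_Suc zero_less_divide_1_iff)
    then obtain h where h: "\<And>j. h j \<in> \<gamma>" "\<And>j \<xi>. \<xi> \<in> I \<Longrightarrow> coef (h j) \<xi> = part j \<xi>" by metis
    have scale: "(\<lambda>x. 2 ^ (j + 2) * h j x) \<in> U" for j
    proof (rule rU[where j = j])
      show "(\<lambda>x. 2 ^ (j + 2) * h j x) \<in> L2" by (intro L2_mult gevrey_L2 h)
      have c: "coef (\<lambda>x. 2 ^ (j + 2) * h j x) \<xi> = 2 ^ (j + 2) * part j \<xi>" if "\<xi> \<in> I" for \<xi>
        using coef_lin[of "h j" "h j" \<xi> "2 ^ (j + 2)" 0] h(2)[OF that] that gevrey_L2[OF h(1)] by simp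
      show "weighted_summable I (wt (1 / real (Suc j))) (coef (\<lambda>x. 2 ^ (j + 2) * h j x))"
        using weighted_cong(1)[of I "coef (\<lambda>x. 2 ^ (j + 2) * h j x)" "\<lambda>\<xi>. 2 ^ (j + 2) * part j \<xi>", OF c]
          weighted_sq_cmult(1)[OF psmall(1)] by blast
      have Kr: "(2 ^ (j + 2) / r j)\<^sup>2 \<le> K j" by (simp add: K_def)
      have Kpos: "K j > 0" unfolding K_def by simp
      have "weighted_sq I (wt (1 / real (Suc j))) (coef (\<lambda>x. 2 ^ (j + 2) * h j x))
          = (cmod (2 ^ (j + 2)))\<^sup>2 * weighted_sq I (wt (1 / real (Suc j))) (part j)"
        using weighted_cong(2)[of I "coef (\<lambda>x. 2 ^ (j + 2) * h j x)" "\<lambda>\<xi>. 2 ^ (j + 2) * part j \<xi>", OF c]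
        by (simp add: weighted_sq_cmult(2))
      also have "\<dots> = (2 ^ (j + 2))\<^sup>2 * weighted_sq I (wt (1 / real (Suc j))) (part j)" by (simp add: norm_mult norm_power)
      also have "\<dots> \<le> (2 ^ (j + 2))\<^sup>2 * (1 / K j * weighted_sq I \<omega> (coef g))" by (intro mult_left_mono psmall) auto
      also have "\<dots> < (2 ^ (j + 2))\<^sup>2 * (1 / K j * 1)" using Kpos g1 by (intro mult_strict_left_mono) auto
      also have "\<dots> \<le> (r j)\<^sup>2"
        using Kr Kpos r(1)[of j] by (simp add: power_divide pos_divide_le_eq mult.commute)
      finally show "weighted_sq I (wt (1 / real (Suc j))) (coef (\<lambda>x. 2 ^ (j + 2) * h j x)) < (r j)\<^sup>2" .
    qed
    have zero: "(\<lambda>x. 0) \<in> U" using U_lin[OF scale[of 0] scale[of 0], of 0 0] by simp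
    \<comment> \<open>finite sums of the parts, by backwards recursion\<close>
    have partial: "(\<lambda>x. 2 ^ (k + 1) * (\<Sum>j=k..<k+n. h j x)) \<in> U" for k n
    proof (induction n arbitrary: k)
      case 0
      then show ?case using zero by simp
    next
      case (Suc n)
      have "(\<lambda>x. (1/2) * (2 ^ (k + 2) * h k x) + (1/2) * (2 ^ (Suc k + 1) * (\<Sum>j=Suc k..<Suc k+n. h j x))) \<in> U"
        by (rule U_lin[OF scale Suc.IH]) (simp add: norm_divide)
      moreover have "(1/2) * (2 ^ (k + 2) * h k x) + (1/2) * (2 ^ (Suc k + 1) * (\<Sum>j=Suc k..<Suc k+n. h j x))
          = 2 ^ (k + 1) * (\<Sum>j=k..<k+Suc n. h j x)" for x
      proof -
        have "(\<Sum>j=k..<k+Suc n. h j x) = h k x + (\<Sum>j=Suc k..<Suc k+n. h j x)"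
          using sum.atLeast_Suc_lessThan[of k "k + Suc n" "\<lambda>j. h j x"] by (simp only: add_Suc_shift)
        then show ?thesis by (simp only:) (simp add: distrib_left)
      qed
      ultimately show ?case by simp
    qed
    \<comment> \<open>the tail is estimated in a step to which \<open>g\<close> belongs\<close>
    obtain A where A: "A > 0" "weighted_summable I (wt A) (coef g)" using g by (auto simp: gevrey_iff)
    obtain i where "inverse (real (Suc i)) < A" using A(1) reals_Archimedean by blast
    then have i: "1 / real (Suc i) \<le> A" by (simp add: inverse_eq_divide)
    have sumi: "weighted_summable I (wt (1 / real (Suc i))) (coef g)" by (rule wt_summable_mono[OF i A(2)])
    define e where "e = (r i)\<^sup>2 / 8"
    have e: "e > 0" using r(1)[of i] by (simp add: e_def)
    obtain F where F: "finite F" "F \<subseteq> I"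
      "\<And>G. finite G \<Longrightarrow> G \<subseteq> I \<Longrightarrow> G \<inter> F = {} \<Longrightarrow> (\<Sum>\<xi>\<in>G. wt (1 / real (Suc i)) \<xi> * (cmod (coef g \<xi>))\<^sup>2) \<le> e"
      using summable_on_small_tail[OF sumi[unfolded weighted_summable_def] _ e] wt_nonneg by force
    define N where "N = Suc (Max (insert 0 (J ` F)))"
    have N: "J \<xi> < N" if "\<xi> \<in> F" for \<xi> using F(1) that by (auto simp: N_def less_Suc_eq_le)
    define tl where "tl x = g x - (\<Sum>j=0..<N. h j x)" for x
    have hs: "(\<lambda>x. \<Sum>j=0..<N. h j x) \<in> \<gamma> \<and> (\<forall>\<xi>\<in>I. coef (\<lambda>x. \<Sum>j=0..<N. h j x) \<xi> = (if J \<xi> < N then coef g \<xi> else 0))" for N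
    proof (induction N)
      case 0
      have "coef (\<lambda>x. 0) \<xi> = 0" for \<xi> by (simp add: H_fourier_def L2_inner_def)
      then show ?case using gevrey_lin[OF g g, of 0 0] by simp
    next
      case (Suc N)
      then show ?case using h(1)[of N] h(2)[of _ N]
        by (auto simp: coef_add gevrey_L2 part_def less_Suc_eq intro!: gevrey_add)
    qed
    have tl: "tl \<in> \<gamma>" unfolding tl_def[abs_def] using hs g by (intro gevrey_diff) auto
    have tlc: "coef tl \<xi> = (if J \<xi> < N then 0 else coef g \<xi>)" if "\<xi> \<in> I" for \<xi>
      unfolding tl_def[abs_def] using hs[of N] that g by (simp add: coef_diff gevrey_L2)
    have two: "(\<lambda>x. 2 * tl x) \<in> U"
    proof (rule rU[where j = i])
      show "(\<lambda>x. 2 * tl x) \<in> L2" by (intro L2_mult gevrey_L2 tl)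
      have c: "coef (\<lambda>x. 2 * tl x) \<xi> = 2 * coef tl \<xi>" if "\<xi> \<in> I" for \<xi>
        using coef_lin[of tl tl \<xi> 2 0] that gevrey_L2[OF tl] by simp
      have "(\<Sum>\<xi>\<in>G. wt (1 / real (Suc i)) \<xi> * (cmod (coef (\<lambda>x. 2 * tl x) \<xi>))\<^sup>2) \<le> 4 * e" if G: "finite G" "G \<subseteq> I" for G
      proof -
        have "(\<Sum>\<xi>\<in>G. wt (1 / real (Suc i)) \<xi> * (cmod (coef (\<lambda>x. 2 * tl x) \<xi>))\<^sup>2)
           = (\<Sum>\<xi>\<in>G. if J \<xi> < N then 0 else 4 * (wt (1 / real (Suc i)) \<xi> * (cmod (coef g \<xi>))\<^sup>2))"
          using G by (intro sum.cong) (auto simp: c tlc norm_mult power_mult_distrib subset_iff)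
        also have "\<dots> = (\<Sum>\<xi>\<in>{\<xi>\<in>G. \<not> J \<xi> < N}. 4 * (wt (1 / real (Suc i)) \<xi> * (cmod (coef g \<xi>))\<^sup>2))"
          using G by (simp add: sum.If_cases Int_def conj_commute)
        also have "\<dots> = 4 * (\<Sum>\<xi>\<in>{\<xi>\<in>G. \<not> J \<xi> < N}. wt (1 / real (Suc i)) \<xi> * (cmod (coef g \<xi>))\<^sup>2)"
          by (rule sum_distrib_left[symmetric])
        also have "\<dots> \<le> 4 * e" using G N by (intro mult_left_mono F(3)) auto
        finally show ?thesis .
      qed
      note * = weighted_sq_bounded[where I = I, OF wt_nonneg this]
      show "weighted_summable I (wt (1 / real (Suc i))) (coef (\<lambda>x. 2 * tl x))" by (rule *(1))
      have "4 * e < (r i)\<^sup>2" using r(1)[of i] by (simp add: e_def)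
      then show "weighted_sq I (wt (1 / real (Suc i))) (coef (\<lambda>x. 2 * tl x)) < (r i)\<^sup>2" using *(2) by linarith
    qed
    have "(\<lambda>x. (1/2) * (2 ^ (0 + 1) * (\<Sum>j=0..<0+N. h j x)) + (1/2) * (2 * tl x)) \<in> U"
      by (rule U_lin[OF partial two]) (simp add: norm_divide)
    moreover have "(1/2) * (2 ^ (0 + 1) * (\<Sum>j=0..<0+N. h j x)) + (1/2) * (2 * tl x) = g x" for x
      by (simp add: tl_def diff_divide_distrib)
    ultimately show "g \<in> U" by simp
  qed
  then show thesis using that \<omega>(1) by blast
qed

end

lemma has_vector_derivative_of_complex_quotient:
  fixes y :: "real \<Rightarrow> complex"
  assumes "((\<lambda>r. (y r - y t) / complex_of_real (r - t)) \<longlongrightarrow> D) (at t within S)"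
  shows "(y has_vector_derivative D) (at t within S)"
  unfolding has_vector_derivative_complex_iff has_field_derivative_iff
  using tendsto_Re[OF assms] tendsto_Im[OF assms] by (simp add: Re_divide_of_real Im_divide_of_real del: of_real_diff)

context gevrey_scale begin

abbreviation "X \<equiv> gevrey_topology I lam w s"

text \<open>Together with the converse that follows, this reduces all limits in the Gevrey space to limits of
weighted sums.\<close>

lemma limitin_gevreyI:
  assumes l: "l \<in> \<gamma>" and ev: "\<forall>\<^sub>F r in F. h r \<in> \<gamma>"
    and lim: "\<And>\<omega>. adm \<omega> \<Longrightarrow> ((\<lambda>r. weighted_sq I \<omega> (\<lambda>\<xi>. coef (h r) \<xi> - coef l \<xi>)) \<longlongrightarrow> 0) F"
  shows "limitin X h l F"
  unfolding limitin_def topspace_gevrey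
proof (intro conjI allI impI l)
  fix W assume W: "openin X W \<and> l \<in> W"
  then obtain U where U: "gevrey_nhd I lam w s U" "\<And>g. g \<in> U \<Longrightarrow> (\<lambda>x. l x + g x) \<in> W"
    unfolding openin_gevrey_topology by blast
  obtain \<omega> where \<omega>: "adm \<omega>" "{g \<in> \<gamma>. weighted_sq I \<omega> (coef g) < 1} \<subseteq> U"
    using nhd_contains_weighted_ball[OF U(1)] by blast
  have "\<forall>\<^sub>F r in F. weighted_sq I \<omega> (\<lambda>\<xi>. coef (h r) \<xi> - coef l \<xi>) < 1"
    by (rule order_tendstoD(2)[OF lim[OF \<omega>(1)]]) simp
  with ev show "\<forall>\<^sub>F r in F. h r \<in> W"
  proof eventually_elim
    case (elim r)
    have "weighted_sq I \<omega> (coef (\<lambda>x. h r x - l x)) < 1"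
      using elim l by (simp add: coef_diff gevrey_L2 cong: weighted_cong(2))
    then have "(\<lambda>x. h r x - l x) \<in> U" using \<omega>(2) gevrey_diff[OF elim(1) l] by blast
    then have "(\<lambda>x. l x + (h r x - l x)) \<in> W" by (rule U(2))
    then show ?case by simp
  qed
qed

lemma limitin_gevreyD:
  assumes lim: "limitin X h l F"
  shows "l \<in> \<gamma>" "\<forall>\<^sub>F r in F. h r \<in> \<gamma>"
    "adm \<omega> \<Longrightarrow> ((\<lambda>r. weighted_sq I \<omega> (\<lambda>\<xi>. coef (h r) \<xi> - coef l \<xi>)) \<longlongrightarrow> 0) F"
proof -
  show l: "l \<in> \<gamma>" using lim by (simp add: limitin_def topspace_gevrey)
  show "\<forall>\<^sub>F r in F. h r \<in> \<gamma>" using lim openin_topspace[of X] l unfolding limitin_def topspace_gevrey by blast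
  assume \<omega>: "adm \<omega>"
  show "((\<lambda>r. weighted_sq I \<omega> (\<lambda>\<xi>. coef (h r) \<xi> - coef l \<xi>)) \<longlongrightarrow> 0) F"
  proof (rule tendstoI)
    fix e :: real assume e: "e > 0"
    let ?O = "{g \<in> \<gamma>. weighted_sq I \<omega> (\<lambda>\<xi>. coef g \<xi> - coef l \<xi>) < e}"
    have "openin X ?O" by (rule weighted_ball_open[OF \<omega> l])
    moreover have "l \<in> ?O" using l e by (simp add: weighted_sq_def)
    ultimately have "\<forall>\<^sub>F r in F. h r \<in> ?O" using lim unfolding limitin_def by blast
    then show "\<forall>\<^sub>F r in F. dist (weighted_sq I \<omega> (\<lambda>\<xi>. coef (h r) \<xi> - coef l \<xi>)) 0 < e"
    proof eventually_elim
      case (elim r)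
      then show ?case using weighted_sq_nonneg[where I=I and \<omega>=\<omega> and b="\<lambda>\<xi>. coef (h r) \<xi> - coef l \<xi>"] adm_nonneg[OF \<omega>] by (simp add: dist_real_def)
    qed
  qed
qed

lemma C0_into_iff:
  "C0_into T X v \<longleftrightarrow> (\<forall>t\<in>{0..T}. v t \<in> \<gamma>) \<and>
     (\<forall>t\<in>{0..T}. \<forall>\<omega>. adm \<omega> \<longrightarrow> ((\<lambda>r. weighted_sq I \<omega> (\<lambda>\<xi>. coef (v r) \<xi> - coef (v t) \<xi>)) \<longlongrightarrow> 0) (at t within {0..T}))"
  (is "_ \<longleftrightarrow> ?A \<and> ?B")
proof -
  have atin: "atin (top_of_set {0..T}) t = at t within {0..T}" if "t \<in> {0..T}" for t
  proof -
    have "eventually P (atin_within euclidean t {0..T}) \<longleftrightarrow> eventually P (at t within {0..T})" for P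
      unfolding eventually_atin_within eventually_at_topological
      by (rule iffI) (auto intro: exI)
    then have "atin_within euclidean t {0..T} = at t within {0..T}" by (simp add: filter_eq_iff)
    then show ?thesis using that by (simp add: atin_subtopology_within)
  qed
  have *: "C0_into T X v \<longleftrightarrow> (\<forall>t\<in>{0..T}. limitin X v (v t) (at t within {0..T}))"
    unfolding C0_into_def continuous_map_atin using atin by simp
  show ?thesis
  proof
    assume "C0_into T X v"
    then show "?A \<and> ?B" unfolding * using limitin_gevreyD(1,3) by blast
  next
    assume AB: "?A \<and> ?B"
    show "C0_into T X v" unfolding *
    proof
      fix t assume t: "t \<in> {0..T}"
      show "limitin X v (v t) (at t within {0..T})"
        by (rule limitin_gevreyI) (use AB t in \<open>auto simp: eventually_at_filter\<close>)
    qed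
  qed
qed

text \<open>Coordinate functionals are among the seminorms, so limits in the Gevrey space can be
taken coefficientwise.\<close>

lemma indicator_adm: "\<xi>0 \<in> I \<Longrightarrow> adm (\<lambda>\<xi>. if \<xi> = \<xi>0 then 1 else 0)"
  unfolding admissible_weight_def
  by (auto intro!: exI[of _ 1] simp: gevrey_weight_ge_1 wt_nonneg less_imp_le)

lemma weighted_sq_indicator:
  assumes "\<xi>0 \<in> I"
  shows "weighted_sq I (\<lambda>\<xi>. if \<xi> = \<xi>0 then 1 else 0) b = (cmod (b \<xi>0))\<^sup>2"
proof -
  have "weighted_sq I (\<lambda>\<xi>. if \<xi> = \<xi>0 then 1 else 0) b = infsum (\<lambda>\<xi>. (if \<xi> = \<xi>0 then 1 else 0) * (cmod (b \<xi>))\<^sup>2) {\<xi>0}"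
    unfolding weighted_sq_def using assms by (intro infsum_cong_neutral) auto
  then show ?thesis by simp
qed

lemma coef_tendsto:
  assumes lim: "limitin X h l F" and \<xi>: "\<xi> \<in> I"
  shows "((\<lambda>r. coef (h r) \<xi>) \<longlongrightarrow> coef l \<xi>) F"
proof -
  have "((\<lambda>r. (cmod (coef (h r) \<xi> - coef l \<xi>))\<^sup>2) \<longlongrightarrow> 0) F"
    using limitin_gevreyD(3)[OF lim indicator_adm[OF \<xi>]] by (simp add: weighted_sq_indicator[OF \<xi>])
  then have "((\<lambda>r. cmod (coef (h r) \<xi> - coef l \<xi>)) \<longlongrightarrow> 0) F"
    using tendsto_real_sqrt[of _ 0] by fastforce
  then show ?thesis by (rule LIM_zero_cancel[OF tendsto_norm_zero_cancel])
qed

lemma C0_into_coef_continuous: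
  assumes "C0_into T X v" "\<xi> \<in> I" shows "continuous_on {0..T} (\<lambda>t. coef (v t) \<xi>)"
  unfolding continuous_on_def
proof
  fix t assume t: "t \<in> {0..T}"
  have "limitin X v (v t) (at t within {0..T})"
    by (rule limitin_gevreyI) (use assms(1) t in \<open>auto simp: C0_into_iff eventually_at_filter\<close>)
  then show "((\<lambda>t. coef (v t) \<xi>) \<longlongrightarrow> coef (v t) \<xi>) (at t within {0..T})" by (rule coef_tendsto[OF _ assms(2)])
qed

lemma deriv_into_coef:
  assumes d: "deriv_into T X v v'" and v: "\<And>t. t \<in> {0..T} \<Longrightarrow> v t \<in> L2" and \<xi>: "\<xi> \<in> I" and t: "t \<in> {0..T}"
  shows "((\<lambda>r. coef (v r) \<xi>) has_vector_derivative coef (v' t) \<xi>) (at t within {0..T})"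
proof -
  have "((\<lambda>r. coef (\<lambda>x. (v r x - v t x) / complex_of_real (r - t)) \<xi>) \<longlongrightarrow> coef (v' t) \<xi>) (at t within {0..T})"
    by (rule coef_tendsto[OF _ \<xi>]) (use d t in \<open>auto simp: deriv_into_def\<close>)
  then have "((\<lambda>r. (coef (v r) \<xi> - coef (v t) \<xi>) / complex_of_real (r - t)) \<longlongrightarrow> coef (v' t) \<xi>) (at t within {0..T})"
  proof (rule Lim_transform_eventually)
    show "\<forall>\<^sub>F r in at t within {0..T}. coef (\<lambda>x. (v r x - v t x) / complex_of_real (r - t)) \<xi> = (coef (v r) \<xi> - coef (v t) \<xi>) / complex_of_real (r - t)"
      unfolding eventually_at_filter
    proof (intro always_eventually allI impI)
      fix r assume r: "r \<noteq> t" "r \<in> {0..T}"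
      have "coef (\<lambda>x. (v r x - v t x) / complex_of_real (r - t)) \<xi>
        = coef (\<lambda>x. inverse (complex_of_real (r - t)) * v r x + (- inverse (complex_of_real (r - t))) * v t x) \<xi>"
        by (simp add: divide_inverse algebra_simps)
      also have "\<dots> = inverse (complex_of_real (r - t)) * coef (v r) \<xi> + (- inverse (complex_of_real (r - t))) * coef (v t) \<xi>"
        by (intro coef_lin v r t \<xi>)
      finally show "coef (\<lambda>x. (v r x - v t x) / complex_of_real (r - t)) \<xi> = (coef (v r) \<xi> - coef (v t) \<xi>) / complex_of_real (r - t)"
        by (simp add: divide_inverse algebra_simps)
    qed
  qed
  then show ?thesis by (rule has_vector_derivative_of_complex_quotient)
qed


lemma C0_into_gevrey: "C0_into T X v \<Longrightarrow> t \<in> {0..T} \<Longrightarrow> v t \<in> \<gamma>"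
  by (simp add: C0_into_iff)

lemma C0_into_near:
  assumes v: "C0_into T X v" and \<omega>: "adm \<omega>" and t: "t \<in> {0..T}" and e: "e > 0"
  obtains \<delta> where "\<delta> > 0" "\<And>r. r \<in> {0..T} \<Longrightarrow> \<bar>r - t\<bar> < \<delta> \<Longrightarrow> weighted_sq I \<omega> (\<lambda>\<xi>. coef (v r) \<xi> - coef (v t) \<xi>) < e"
proof -
  have "((\<lambda>r. weighted_sq I \<omega> (\<lambda>\<xi>. coef (v r) \<xi> - coef (v t) \<xi>)) \<longlongrightarrow> 0) (at t within {0..T})"
    using v \<omega> t by (simp add: C0_into_iff)
  then have "\<forall>\<^sub>F r in at t within {0..T}. weighted_sq I \<omega> (\<lambda>\<xi>. coef (v r) \<xi> - coef (v t) \<xi>) < e"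
    by (rule order_tendstoD) (rule e)
  then obtain \<delta> where \<delta>: "\<delta> > 0" "\<And>r. r \<in> {0..T} \<Longrightarrow> r \<noteq> t \<Longrightarrow> dist r t < \<delta> \<Longrightarrow> weighted_sq I \<omega> (\<lambda>\<xi>. coef (v r) \<xi> - coef (v t) \<xi>) < e"
    unfolding eventually_at by auto
  have "weighted_sq I \<omega> (\<lambda>\<xi>. coef (v r) \<xi> - coef (v t) \<xi>) < e" if "r \<in> {0..T}" "\<bar>r - t\<bar> < \<delta>" for r
    using \<delta>(2)[of r] that e by (cases "r = t") (auto simp: dist_real_def weighted_sq_def)
  then show thesis using that \<delta>(1) by blast
qed

lemma C0_intoI:
  assumes v: "\<And>t. t \<in> {0..T} \<Longrightarrow> v t \<in> \<gamma>"
    and near: "\<And>t \<omega> e. t \<in> {0..T} \<Longrightarrow> adm \<omega> \<Longrightarrow> e > 0 \<Longrightarrow> \<exists>\<delta>>0. \<forall>r\<in>{0..T}. \<bar>r - t\<bar> < \<delta> \<longrightarrow> weighted_sq I \<omega> (\<lambda>\<xi>. coef (v r) \<xi> - coef (v t) \<xi>) \<le> e"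
  shows "C0_into T X v"
  unfolding C0_into_iff
proof (intro conjI ballI allI impI v)
  fix t \<omega> assume t: "t \<in> {0..T}" and \<omega>: "adm \<omega>"
  show "((\<lambda>r. weighted_sq I \<omega> (\<lambda>\<xi>. coef (v r) \<xi> - coef (v t) \<xi>)) \<longlongrightarrow> 0) (at t within {0..T})"
  proof (rule tendstoI)
    fix e :: real assume e: "e > 0"
    obtain \<delta> where \<delta>: "\<delta> > 0" "\<And>r. r\<in>{0..T} \<Longrightarrow> \<bar>r - t\<bar> < \<delta> \<Longrightarrow> weighted_sq I \<omega> (\<lambda>\<xi>. coef (v r) \<xi> - coef (v t) \<xi>) \<le> e / 2"
      using near[OF t \<omega>, of "e/2"] e by auto
    show "\<forall>\<^sub>F r in at t within {0..T}. dist (weighted_sq I \<omega> (\<lambda>\<xi>. coef (v r) \<xi> - coef (v t) \<xi>)) 0 < e"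
      unfolding eventually_at
    proof (intro exI[of _ \<delta>] conjI ballI impI \<delta>(1))
      fix r assume r: "r \<in> {0..T}" "r \<noteq> t \<and> dist r t < \<delta>"
      have "weighted_sq I \<omega> (\<lambda>\<xi>. coef (v r) \<xi> - coef (v t) \<xi>) \<le> e / 2" using r by (intro \<delta>(2)) (auto simp: dist_real_def)
      moreover have "0 \<le> weighted_sq I \<omega> (\<lambda>\<xi>. coef (v r) \<xi> - coef (v t) \<xi>)"
        by (rule weighted_sq_nonneg) (rule adm_nonneg[OF \<omega>])
      ultimately show "dist (weighted_sq I \<omega> (\<lambda>\<xi>. coef (v r) \<xi> - coef (v t) \<xi>)) 0 < e" using e by (simp add: dist_real_def)
    qed
  qed
qed

lemma adm_diff_summable: "adm \<omega> \<Longrightarrow> f \<in> \<gamma> \<Longrightarrow> g \<in> \<gamma> \<Longrightarrow> weighted_summable I \<omega> (\<lambda>\<xi>. coef f \<xi> - coef g \<xi>)"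
  using adm_gevrey_summable[of \<omega> "\<lambda>x. f x - g x"] gevrey_diff[of f g]
    weighted_cong(1)[of I "coef (\<lambda>x. f x - g x)" "\<lambda>\<xi>. coef f \<xi> - coef g \<xi>"] coef_diff[of f g] gevrey_L2 by blast

text \<open>Differentiability in the Gevrey space follows from differentiability of the coefficients, provided
that the derivative is continuous in the Gevrey space: the mean value inequality bounds the
difference quotient minus \<open>v' t\<close> by an increment of \<open>v'\<close>, in every seminorm.\<close>

lemma deriv_intoI:
  assumes v: "\<And>t. t \<in> {0..T} \<Longrightarrow> v t \<in> \<gamma>" and v': "C0_into T X v'"
    and d: "\<And>t \<xi>. t \<in> {0..T} \<Longrightarrow> \<xi> \<in> I \<Longrightarrow> ((\<lambda>r. coef (v r) \<xi>) has_vector_derivative coef (v' t) \<xi>) (at t within {0..T})"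
  shows "deriv_into T X v v'"
  unfolding deriv_into_def
proof
  fix t assume t: "t \<in> {0..T}"
  define quot where "quot r x = (v r x - v t x) / complex_of_real (r - t)" for r x
  have quot_lin: "quot r = (\<lambda>x. inverse (complex_of_real (r - t)) * v r x + (- inverse (complex_of_real (r - t))) * v t x)" for r
    by (rule ext) (simp add: quot_def divide_inverse algebra_simps)
  have quot_\<gamma>: "quot r \<in> \<gamma>" if "r \<in> {0..T}" for r
    unfolding quot_lin by (intro gevrey_lin v that t)
  have quot_coef: "coef (quot r) \<xi> = (coef (v r) \<xi> - coef (v t) \<xi>) / complex_of_real (r - t)" if "r \<in> {0..T}" "\<xi> \<in> I" for r \<xi>
    unfolding quot_lin by (subst coef_lin) (use that t gevrey_L2[OF v] in \<open>auto simp: divide_inverse algebra_simps\<close>)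
  have "limitin X quot (v' t) (at t within {0..T})"
  proof (rule limitin_gevreyI)
    show vt: "v' t \<in> \<gamma>" by (rule C0_into_gevrey[OF v' t])
    show "\<forall>\<^sub>F r in at t within {0..T}. quot r \<in> \<gamma>" using quot_\<gamma> by (auto simp: eventually_at_filter)
    fix \<omega> assume \<omega>: "adm \<omega>"
    show "((\<lambda>r. weighted_sq I \<omega> (\<lambda>\<xi>. coef (quot r) \<xi> - coef (v' t) \<xi>)) \<longlongrightarrow> 0) (at t within {0..T})"
    proof (rule tendstoI)
      fix e :: real assume e: "e > 0"
      obtain \<delta> where \<delta>: "\<delta> > 0" "\<And>r. r \<in> {0..T} \<Longrightarrow> \<bar>r - t\<bar> < \<delta> \<Longrightarrow> weighted_sq I \<omega> (\<lambda>\<xi>. coef (v' r) \<xi> - coef (v' t) \<xi>) < e / 2"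
        using C0_into_near[OF v' \<omega> t, of "e/2"] e by auto
      have bound: "weighted_sq I \<omega> (\<lambda>\<xi>. coef (quot r) \<xi> - coef (v' t) \<xi>) \<le> e / 2" if r: "r \<in> {0..T}" "r \<noteq> t" "\<bar>r - t\<bar> < \<delta>" for r
      proof (rule weighted_sq_bounded(2)[OF adm_nonneg[OF \<omega>]])
        fix F assume F: "finite F" "F \<subseteq> I"
        \<comment> \<open>subtracting the tangent makes the derivative an increment of \<open>v'\<close>\<close>
        define Y where "Y \<xi> \<tau> = coef (v \<tau>) \<xi> - complex_of_real (\<tau> - t) * coef (v' t) \<xi>" for \<xi> \<tau>
        have dY: "(Y \<xi> has_vector_derivative coef (v' \<tau>) \<xi> - coef (v' t) \<xi>) (at \<tau> within {0..T})" if "\<xi> \<in> F" "\<tau> \<in> {0..T}" for \<xi> \<tau>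
        proof -
          have "((\<lambda>\<tau>. complex_of_real (\<tau> - t) * coef (v' t) \<xi>) has_vector_derivative coef (v' t) \<xi>) (at \<tau> within {0..T})"
            by (auto intro!: derivative_eq_intros)
          then show ?thesis unfolding Y_def using that F by (intro has_vector_derivative_diff d) auto
        qed
        obtain z where z: "z \<in> closed_segment t r" "(\<Sum>\<xi>\<in>F. \<omega> \<xi> * (cmod (Y \<xi> r - Y \<xi> t))\<^sup>2)
            \<le> (r - t)\<^sup>2 * (\<Sum>\<xi>\<in>F. \<omega> \<xi> * (cmod (coef (v' z) \<xi> - coef (v' t) \<xi>))\<^sup>2)"
          by (rule weighted_mean_value[of F \<omega> 0 T Y "\<lambda>\<xi> \<tau>. coef (v' \<tau>) \<xi> - coef (v' t) \<xi>" t r, OF _ dY t r(1)])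
            (use F adm_nonneg[OF \<omega>] in auto)
        have zT: "z \<in> {0..T}" "\<bar>z - t\<bar> < \<delta>" using closed_segment_within[OF z(1) t r(1)] r(3) by auto
        have rt: "(r - t)\<^sup>2 > 0" using r(2) by simp
        have "(r - t)\<^sup>2 * (\<Sum>\<xi>\<in>F. \<omega> \<xi> * (cmod (coef (quot r) \<xi> - coef (v' t) \<xi>))\<^sup>2) = (\<Sum>\<xi>\<in>F. \<omega> \<xi> * (cmod (Y \<xi> r - Y \<xi> t))\<^sup>2)"
          unfolding sum_distrib_left
        proof (rule sum.cong[OF refl])
          fix \<xi> assume "\<xi> \<in> F"
          then have \<xi>: "\<xi> \<in> I" using F by auto
          have "Y \<xi> r - Y \<xi> t = complex_of_real (r - t) * (coef (quot r) \<xi> - coef (v' t) \<xi>)"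
            unfolding Y_def quot_coef[OF r(1) \<xi>] right_diff_distrib using r(2) by (simp del: of_real_diff)
          then show "(r - t)\<^sup>2 * (\<omega> \<xi> * (cmod (coef (quot r) \<xi> - coef (v' t) \<xi>))\<^sup>2) = \<omega> \<xi> * (cmod (Y \<xi> r - Y \<xi> t))\<^sup>2"
            by (simp add: norm_mult power_mult_distrib del: of_real_diff)
        qed
        with z(2) have "(r - t)\<^sup>2 * (\<Sum>\<xi>\<in>F. \<omega> \<xi> * (cmod (coef (quot r) \<xi> - coef (v' t) \<xi>))\<^sup>2)
            \<le> (r - t)\<^sup>2 * (\<Sum>\<xi>\<in>F. \<omega> \<xi> * (cmod (coef (v' z) \<xi> - coef (v' t) \<xi>))\<^sup>2)" by simp
        then have "(\<Sum>\<xi>\<in>F. \<omega> \<xi> * (cmod (coef (quot r) \<xi> - coef (v' t) \<xi>))\<^sup>2) \<le> (\<Sum>\<xi>\<in>F. \<omega> \<xi> * (cmod (coef (v' z) \<xi> - coef (v' t) \<xi>))\<^sup>2)"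
          by (rule mult_left_le_imp_le[OF _ rt])
        also have "\<dots> \<le> weighted_sq I \<omega> (\<lambda>\<xi>. coef (v' z) \<xi> - coef (v' t) \<xi>)"
          by (intro finite_sum_le_weighted_sq adm_nonneg[OF \<omega>] adm_diff_summable[OF \<omega>] C0_into_gevrey[OF v'] zT t F)
        also have "\<dots> \<le> e / 2" using \<delta>(2)[OF zT] by simp
        finally show "(\<Sum>\<xi>\<in>F. \<omega> \<xi> * (cmod (coef (quot r) \<xi> - coef (v' t) \<xi>))\<^sup>2) \<le> e / 2" .
      qed
      show "\<forall>\<^sub>F r in at t within {0..T}. dist (weighted_sq I \<omega> (\<lambda>\<xi>. coef (quot r) \<xi> - coef (v' t) \<xi>)) 0 < e"
        unfolding eventually_at
      proof (intro exI[of _ \<delta>] conjI ballI impI \<delta>(1))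
        fix r assume r: "r \<in> {0..T}" "r \<noteq> t \<and> dist r t < \<delta>"
        have "weighted_sq I \<omega> (\<lambda>\<xi>. coef (quot r) \<xi> - coef (v' t) \<xi>) \<le> e / 2" using r by (intro bound) (auto simp: dist_real_def)
        moreover have "0 \<le> weighted_sq I \<omega> (\<lambda>\<xi>. coef (quot r) \<xi> - coef (v' t) \<xi>)"
          by (rule weighted_sq_nonneg) (rule adm_nonneg[OF \<omega>])
        ultimately show "dist (weighted_sq I \<omega> (\<lambda>\<xi>. coef (quot r) \<xi> - coef (v' t) \<xi>)) 0 < e" using e by (simp add: dist_real_def)
      qed
    qed
  qed
  then show "limitin X (\<lambda>r x. (v r x - v t x) / complex_of_real (r - t)) (v' t) (at t within {0..T})"
    by (simp add: quot_def[abs_def])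
qed

text \<open>Otherwise for every \<open>j\<close> some \<open>f (t j)\<close> has norm more than \<open>j\<close> in the \<open>j\<close>-th step, which is already
visible on a finite set \<open>F j\<close>. The factors \<open>K j\<close> are chosen such that the minimal weight dominates
the \<open>k\<close>-th Gevrey weight on \<open>F k\<close> for every \<open>k\<close>; finiteness of the sets makes this possible. The seminorm of
this single weight is then unbounded on the compact set of values of \<open>f\<close>.\<close>

lemma C0_into_bounded_in_step:
  assumes f: "C0_into T X f"
  obtains A M where "A > 0" "\<And>t. t \<in> {0..T} \<Longrightarrow> weighted_summable I (wt A) (coef (f t)) \<and> weighted_sq I (wt A) (coef (f t)) \<le> M"
proof (rule ccontr)
  assume contr: "\<not> thesis"
  have "\<exists>t F. t \<in> {0..T} \<and> finite F \<and> F \<subseteq> I \<and> real j < (\<Sum>\<xi>\<in>F. wt (1 / real (Suc j)) \<xi> * (cmod (coef (f t) \<xi>))\<^sup>2)" for j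
  proof (rule ccontr)
    assume no: "\<nexists>t F. t \<in> {0..T} \<and> finite F \<and> F \<subseteq> I \<and> real j < (\<Sum>\<xi>\<in>F. wt (1 / real (Suc j)) \<xi> * (cmod (coef (f t) \<xi>))\<^sup>2)"
    have "weighted_summable I (wt (1 / real (Suc j))) (coef (f t)) \<and> weighted_sq I (wt (1 / real (Suc j))) (coef (f t)) \<le> real j"
      if "t \<in> {0..T}" for t
    proof -
      have *: "(\<Sum>\<xi>\<in>F. wt (1 / real (Suc j)) \<xi> * (cmod (coef (f t) \<xi>))\<^sup>2) \<le> real j" if "finite F" "F \<subseteq> I" for F
        using no that \<open>t \<in> {0..T}\<close> by (meson not_le)
      show ?thesis using weighted_sq_bounded[where I = I, OF wt_nonneg *] by blast
    qed
    then show False using contr that[of "1 / real (Suc j)" "real j"] by simp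
  qed
  then have "\<forall>j. \<exists>p. fst (p) \<in> {0..T} \<and> finite (snd (p)) \<and> snd (p) \<subseteq> I \<and> real j < (\<Sum>\<xi>\<in>snd (p). wt (1 / real (Suc j)) \<xi> * (cmod (coef (f (fst (p))) \<xi>))\<^sup>2)" by (simp add: split_paired_Ex)
  then obtain p where p: "\<forall>j. fst (p j) \<in> {0..T} \<and> finite (snd (p j)) \<and> snd (p j) \<subseteq> I \<and> real j < (\<Sum>\<xi>\<in>snd (p j). wt (1 / real (Suc j)) \<xi> * (cmod (coef (f (fst (p j))) \<xi>))\<^sup>2)" by (rule choice[THEN exE])
  define t F where "t j = fst (p j)" and "F j = snd (p j)" for j
  have t: "t j \<in> {0..T}" and F: "finite (F j)" "F j \<subseteq> I"
    and big: "real j < (\<Sum>\<xi>\<in>F j. wt (1 / real (Suc j)) \<xi> * (cmod (coef (f (t j)) \<xi>))\<^sup>2)" for j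
    using p unfolding t_def F_def by blast+
  define K where "K j = real j + 1 + (\<Sum>k<j. \<Sum>\<xi>\<in>F k. wt (1 / real (Suc k)) \<xi> / wt (1 / real (Suc j)) \<xi>)" for j
  have ratio: "0 \<le> wt a \<xi> / wt b \<xi>" for a b \<xi> by (simp add: wt_nonneg)
  have K: "K j \<ge> real j + 1" for j unfolding K_def by (simp add: sum_nonneg ratio)
  obtain \<omega> where \<omega>: "adm \<omega>" "\<And>\<xi>. \<exists>j. \<omega> \<xi> = K j * wt (1 / real (Suc j)) \<xi>"
    using minimal_weight[OF K] by metis
  have dom: "wt (1 / real (Suc k)) \<xi> \<le> \<omega> \<xi>" if \<xi>: "\<xi> \<in> F k" for k \<xi>
  proof -
    obtain j where j: "\<omega> \<xi> = K j * wt (1 / real (Suc j)) \<xi>" using \<omega>(2) by blast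
    show ?thesis
    proof (cases "j \<le> k")
      case True
      then have "1 / real (Suc k) \<le> 1 / real (Suc j)" by (intro divide_left_mono) auto
      then have "1 * wt (1 / real (Suc k)) \<xi> \<le> K j * wt (1 / real (Suc j)) \<xi>"
        using K[of j] wt_nonneg by (intro mult_mono gevrey_weight_mono) auto
      then show ?thesis by (simp add: j)
    next
      case False
      have "wt (1 / real (Suc k)) \<xi> / wt (1 / real (Suc j)) \<xi> \<le> (\<Sum>\<xi>\<in>F k. wt (1 / real (Suc k)) \<xi> / wt (1 / real (Suc j)) \<xi>)"
        using \<xi> F(1) ratio by (intro member_le_sum) auto
      also have "\<dots> \<le> (\<Sum>k<j. \<Sum>\<xi>\<in>F k. wt (1 / real (Suc k)) \<xi> / wt (1 / real (Suc j)) \<xi>)"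
        using False ratio by (intro member_le_sum[of k "{..<j}" "\<lambda>k. \<Sum>\<xi>\<in>F k. wt (1 / real (Suc k)) \<xi> / wt (1 / real (Suc j)) \<xi>"] sum_nonneg) auto
      also have "\<dots> \<le> K j" by (simp add: K_def)
      finally show ?thesis using gevrey_weight_pos[of lam s "1 / real (Suc j)" \<xi>] by (simp add: j pos_divide_le_eq)
    qed
  qed
  have large: "real j < weighted_sq I \<omega> (coef (f (t j)))" for j
  proof -
    have "real j < (\<Sum>\<xi>\<in>F j. \<omega> \<xi> * (cmod (coef (f (t j)) \<xi>))\<^sup>2)"
      by (rule less_le_trans[OF big]) (intro sum_mono mult_right_mono dom, auto)
    also have "\<dots> \<le> weighted_sq I \<omega> (coef (f (t j)))"
      by (intro finite_sum_le_weighted_sq adm_nonneg[OF \<omega>(1)] adm_gevrey_summable[OF \<omega>(1)] C0_into_gevrey[OF f] t F)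
    finally show ?thesis .
  qed
  obtain \<tau> \<sigma> where \<tau>: "\<tau> \<in> {0..T}" "strict_mono \<sigma>" "(t \<circ> \<sigma>) \<longlonglongrightarrow> \<tau>"
    using compact_Icc[of 0 T] t unfolding compact_def by metis
  obtain \<delta> where \<delta>: "\<delta> > 0" "\<And>r. r \<in> {0..T} \<Longrightarrow> \<bar>r - \<tau>\<bar> < \<delta> \<Longrightarrow> weighted_sq I \<omega> (\<lambda>\<xi>. coef (f r) \<xi> - coef (f \<tau>) \<xi>) < 1"
    using C0_into_near[OF f \<omega>(1) \<tau>(1), of 1] by auto
  have "\<forall>\<^sub>F k in sequentially. dist ((t \<circ> \<sigma>) k) \<tau> < \<delta>" using \<tau>(3) \<delta>(1) by (rule tendstoD)
  then obtain k0 where k0: "\<And>k. k \<ge> k0 \<Longrightarrow> dist (t (\<sigma> k)) \<tau> < \<delta>" by (auto simp: eventually_sequentially)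
  define B where "B = 2 * weighted_sq I \<omega> (coef (f \<tau>)) + 2"
  obtain k1 where k1: "B < real k1" using reals_Archimedean2 by blast
  define k where "k = max k0 k1"
  have "weighted_sq I \<omega> (coef (f (t (\<sigma> k)))) = weighted_sq I \<omega> (\<lambda>\<xi>. coef (f \<tau>) \<xi> + (coef (f (t (\<sigma> k))) \<xi> - coef (f \<tau>) \<xi>))" by simp
  also have "\<dots> \<le> weighted_sq I \<omega> (coef (f \<tau>)) / (1/2) + weighted_sq I \<omega> (\<lambda>\<xi>. coef (f (t (\<sigma> k))) \<xi> - coef (f \<tau>) \<xi>) / (1 - 1/2)"
    by (intro weighted_sq_add(2) adm_nonneg[OF \<omega>(1)] adm_gevrey_summable[OF \<omega>(1)] adm_diff_summable[OF \<omega>(1)] C0_into_gevrey[OF f] t \<tau>) auto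
  also have "\<dots> \<le> B" using \<delta>(2)[OF t[of "\<sigma> k"]] k0[of k] by (simp add: B_def k_def dist_real_def)
  finally have "weighted_sq I \<omega> (coef (f (t (\<sigma> k)))) \<le> B" .
  moreover have "real k \<le> real (\<sigma> k)" using seq_suble[OF \<tau>(2), of k] by simp
  moreover have "real k1 \<le> real k" by (simp add: k_def)
  ultimately show False using large[of "\<sigma> k"] k1 by linarith
qed

end

section \<open>Families of coefficients depending on time\<close>

context gevrey_scale begin

lemma adm_bound_step:
  assumes \<omega>: "adm \<omega>" and A: "A > 0"
  obtains C where "C \<ge> 0"
    "\<And>b S. (\<And>F. finite F \<Longrightarrow> F \<subseteq> I \<Longrightarrow> (\<Sum>\<xi>\<in>F. wt A \<xi> * (cmod (b \<xi>))\<^sup>2) \<le> S) \<Longrightarrow> weighted_sq I \<omega> b \<le> C * S"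
proof -
  obtain C where C: "C \<ge> 0" "\<And>\<xi>. \<xi> \<in> I \<Longrightarrow> \<omega> \<xi> \<le> C * wt A \<xi>" using \<omega> A unfolding admissible_weight_def by blast
  have "weighted_sq I \<omega> b \<le> C * S" if S: "\<And>F. finite F \<Longrightarrow> F \<subseteq> I \<Longrightarrow> (\<Sum>\<xi>\<in>F. wt A \<xi> * (cmod (b \<xi>))\<^sup>2) \<le> S" for b S
  proof -
    have s: "weighted_summable I (wt A) b" by (rule weighted_sq_bounded(1)[OF wt_nonneg S])
    have "weighted_sq I \<omega> b \<le> C * weighted_sq I (wt A) b"
      by (intro weighted_summable_mono(2) adm_nonneg[OF \<omega>] C(2) s)
    also have "\<dots> \<le> C * S" by (intro mult_left_mono weighted_sq_bounded(2)[OF wt_nonneg S] C(1))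
    finally show ?thesis .
  qed
  then show thesis using that C(1) by blast
qed

text \<open>Increments estimated in a single step of the scale are estimated in every seminorm.\<close>

lemma C0_into_of_modulus:
  fixes \<eta> :: "real \<Rightarrow> real \<Rightarrow> real"
  assumes A: "A > 0" and v: "\<And>t. t \<in> {0..T} \<Longrightarrow> v t \<in> \<gamma>"
    and mod: "\<And>F t r. finite F \<Longrightarrow> F \<subseteq> I \<Longrightarrow> t \<in> {0..T} \<Longrightarrow> r \<in> {0..T} \<Longrightarrow>
       (\<Sum>\<xi>\<in>F. wt A \<xi> * (cmod (coef (v r) \<xi> - coef (v t) \<xi>))\<^sup>2) \<le> \<eta> t r"
    and lim: "\<And>t. t \<in> {0..T} \<Longrightarrow> (\<eta> t \<longlongrightarrow> 0) (at t within {0..T})"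
  shows "C0_into T X v"
proof (rule C0_intoI[OF v])
  fix t \<omega> and e :: real assume t: "t \<in> {0..T}" and \<omega>: "adm \<omega>" and e: "e > 0"
  obtain C where C: "C \<ge> 0" "\<And>b S. (\<And>F. finite F \<Longrightarrow> F \<subseteq> I \<Longrightarrow> (\<Sum>\<xi>\<in>F. wt A \<xi> * (cmod (b \<xi>))\<^sup>2) \<le> S) \<Longrightarrow> weighted_sq I \<omega> b \<le> C * S"
    using adm_bound_step[OF \<omega> A] by blast
  have "\<forall>\<^sub>F r in at t within {0..T}. \<eta> t r < e / (C + 1)"
    by (rule order_tendstoD(2)[OF lim[OF t]]) (use e C in simp)
  then obtain \<delta> where \<delta>: "\<delta> > 0" "\<And>r. r \<in> {0..T} \<Longrightarrow> r \<noteq> t \<Longrightarrow> dist r t < \<delta> \<Longrightarrow> \<eta> t r < e / (C + 1)"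
    unfolding eventually_at by auto
  have "weighted_sq I \<omega> (\<lambda>\<xi>. coef (v r) \<xi> - coef (v t) \<xi>) \<le> e" if r: "r \<in> {0..T}" "\<bar>r - t\<bar> < \<delta>" for r
  proof (cases "r = t")
    case True then show ?thesis using e by (simp add: weighted_sq_def)
  next
    case False
    have "weighted_sq I \<omega> (\<lambda>\<xi>. coef (v r) \<xi> - coef (v t) \<xi>) \<le> C * \<eta> t r" by (rule C(2)) (rule mod[OF _ _ t r(1)])
    also have "\<dots> \<le> C * (e / (C + 1))" using \<delta>(2)[OF r(1) False] r(2) C(1) by (intro mult_left_mono) (auto simp: dist_real_def)
    also have "\<dots> \<le> e" using e C(1) by (simp add: field_simps)
    finally show ?thesis .
  qed
  then show "\<exists>\<delta>>0. \<forall>r\<in>{0..T}. \<bar>r - t\<bar> < \<delta> \<longrightarrow> weighted_sq I \<omega> (\<lambda>\<xi>. coef (v r) \<xi> - coef (v t) \<xi>) \<le> e"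
    using \<delta>(1) by blast
qed

lemma C0_into_diff:
  assumes f: "C0_into T X f" and h: "C0_into T X h"
  shows "C0_into T X (\<lambda>t x. f t x - h t x)"
proof (rule C0_intoI)
  show "(\<lambda>x. f t x - h t x) \<in> \<gamma>" if "t \<in> {0..T}" for t
    using C0_into_gevrey[OF f that] C0_into_gevrey[OF h that] by (rule gevrey_diff)
  fix t \<omega> and e :: real assume t: "t \<in> {0..T}" and \<omega>: "adm \<omega>" and e: "e > 0"
  obtain d1 where d1: "d1 > 0" "\<And>r. r \<in> {0..T} \<Longrightarrow> \<bar>r - t\<bar> < d1 \<Longrightarrow> weighted_sq I \<omega> (\<lambda>\<xi>. coef (f r) \<xi> - coef (f t) \<xi>) < e / 4"
    using C0_into_near[OF f \<omega> t, of "e/4"] e by auto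
  obtain d2 where d2: "d2 > 0" "\<And>r. r \<in> {0..T} \<Longrightarrow> \<bar>r - t\<bar> < d2 \<Longrightarrow> weighted_sq I \<omega> (\<lambda>\<xi>. coef (h r) \<xi> - coef (h t) \<xi>) < e / 4"
    using C0_into_near[OF h \<omega> t, of "e/4"] e by auto
  have "weighted_sq I \<omega> (\<lambda>\<xi>. coef (\<lambda>x. f r x - h r x) \<xi> - coef (\<lambda>x. f t x - h t x) \<xi>) \<le> e"
    if r: "r \<in> {0..T}" "\<bar>r - t\<bar> < min d1 d2" for r
  proof -
    note \<gamma>s = C0_into_gevrey[OF f r(1)] C0_into_gevrey[OF f t] C0_into_gevrey[OF h r(1)] C0_into_gevrey[OF h t]
    have "weighted_sq I \<omega> (\<lambda>\<xi>. coef (\<lambda>x. f r x - h r x) \<xi> - coef (\<lambda>x. f t x - h t x) \<xi>)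
       = weighted_sq I \<omega> (\<lambda>\<xi>. (coef (f r) \<xi> - coef (f t) \<xi>) + (- 1) * (coef (h r) \<xi> - coef (h t) \<xi>))"
      using \<gamma>s[THEN gevrey_L2] by (intro weighted_cong) (simp add: coef_diff)
    also have "\<dots> \<le> weighted_sq I \<omega> (\<lambda>\<xi>. coef (f r) \<xi> - coef (f t) \<xi>) / (1/2) + weighted_sq I \<omega> (\<lambda>\<xi>. (- 1) * (coef (h r) \<xi> - coef (h t) \<xi>)) / (1 - 1/2)"
      by (intro weighted_sq_add(2) adm_nonneg[OF \<omega>] weighted_sq_cmult(1) adm_diff_summable[OF \<omega>] \<gamma>s) auto
    also have "\<dots> \<le> e" unfolding weighted_sq_cmult(2) using d1(2)[of r] d2(2)[of r] r by simp
    finally show ?thesis .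
  qed
  then show "\<exists>\<delta>>0. \<forall>r\<in>{0..T}. \<bar>r - t\<bar> < \<delta> \<longrightarrow>
      weighted_sq I \<omega> (\<lambda>\<xi>. coef (\<lambda>x. f r x - h r x) \<xi> - coef (\<lambda>x. f t x - h t x) \<xi>) \<le> e"
    using d1(1) d2(1) by (intro exI[of _ "min d1 d2"]) auto
qed

lemma synthesize_family:
  assumes A: "A > 0" and y: "\<And>F t. finite F \<Longrightarrow> F \<subseteq> I \<Longrightarrow> t \<in> {0..T} \<Longrightarrow> (\<Sum>\<xi>\<in>F. wt A \<xi> * (cmod (y \<xi> t))\<^sup>2) \<le> S"
  shows "\<exists>v. \<forall>t. t \<in> {0..T} \<longrightarrow> v t \<in> \<gamma> \<and> (\<forall>\<xi>\<in>I. coef (v t) \<xi> = y \<xi> t)"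
proof -
  have "\<exists>g. t \<in> {0..T} \<longrightarrow> g \<in> \<gamma> \<and> (\<forall>\<xi>\<in>I. coef g \<xi> = y \<xi> t)" for t
  proof (cases "t \<in> {0..T}")
    case True
    have "weighted_summable I (wt A) (\<lambda>\<xi>. y \<xi> t)"
      by (rule weighted_sq_bounded(1)[OF wt_nonneg]) (use y True in blast)+
    then show ?thesis using synthesize[OF _ A] by metis
  qed auto
  then show ?thesis by (intro choice allI)
qed

text \<open>The hypotheses concern finite sums of coefficients only; they are the form in which the energy
estimates are available.\<close>

lemma gevrey_W2infI:
  assumes T: "T \<ge> 0" and A: "A > 0" and L: "L \<ge> 0"
    and v: "\<And>t. t \<in> {0..T} \<Longrightarrow> v t \<in> \<gamma>" and v': "\<And>t. t \<in> {0..T} \<Longrightarrow> v' t \<in> \<gamma>"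
    and d: "\<And>t \<xi>. t \<in> {0..T} \<Longrightarrow> \<xi> \<in> I \<Longrightarrow> ((\<lambda>r. coef (v r) \<xi>) has_vector_derivative coef (v' t) \<xi>) (at t within {0..T})"
    and bd: "\<And>F t. finite F \<Longrightarrow> F \<subseteq> I \<Longrightarrow> t \<in> {0..T} \<Longrightarrow> (\<Sum>\<xi>\<in>F. wt A \<xi> * (cmod (coef (v' t) \<xi>))\<^sup>2) \<le> S"
    and lip: "\<And>F t r. finite F \<Longrightarrow> F \<subseteq> I \<Longrightarrow> t \<in> {0..T} \<Longrightarrow> r \<in> {0..T} \<Longrightarrow>
      (\<Sum>\<xi>\<in>F. wt A \<xi> * (cmod (coef (v' r) \<xi> - coef (v' t) \<xi>))\<^sup>2) \<le> (L * \<bar>r - t\<bar>)\<^sup>2"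
  shows "C0_into T X v" "C0_into T X v'" "deriv_into T X v v'" "gevrey_W2inf I lam w s T v"
proof -
  show v0: "C0_into T X v"
  proof (rule C0_into_of_modulus[OF A v, where \<eta> = "\<lambda>t r. (r - t)\<^sup>2 * S"])
    fix F t r assume F: "finite F" "F \<subseteq> I" and t: "t \<in> {0..T}" and r: "r \<in> {0..T}"
    have dd: "((\<lambda>r. coef (v r) \<xi>) has_vector_derivative coef (v' \<tau>) \<xi>) (at \<tau> within {0..T})" if "\<xi> \<in> F" "\<tau> \<in> {0..T}" for \<xi> \<tau>
      using that F by (intro d) auto
    obtain z where z: "z \<in> closed_segment t r"
      "(\<Sum>\<xi>\<in>F. wt A \<xi> * (cmod (coef (v r) \<xi> - coef (v t) \<xi>))\<^sup>2) \<le> (r - t)\<^sup>2 * (\<Sum>\<xi>\<in>F. wt A \<xi> * (cmod (coef (v' z) \<xi>))\<^sup>2)"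
      by (rule weighted_mean_value[of F "wt A" 0 T "\<lambda>\<xi> r. coef (v r) \<xi>" "\<lambda>\<xi> r. coef (v' r) \<xi>" t r, OF wt_nonneg dd t r])
    note z(2)
    also have "(r - t)\<^sup>2 * (\<Sum>\<xi>\<in>F. wt A \<xi> * (cmod (coef (v' z) \<xi>))\<^sup>2) \<le> (r - t)\<^sup>2 * S"
      using closed_segment_within(1)[OF z(1) t r] by (intro mult_left_mono bd F) auto
    finally show "(\<Sum>\<xi>\<in>F. wt A \<xi> * (cmod (coef (v r) \<xi> - coef (v t) \<xi>))\<^sup>2) \<le> (r - t)\<^sup>2 * S" .
  next
    fix t
    have "((\<lambda>r. (r - t)\<^sup>2 * S) \<longlongrightarrow> (t - t)\<^sup>2 * S) (at t within {0..T})" by (intro tendsto_intros)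
    then show "((\<lambda>r. (r - t)\<^sup>2 * S) \<longlongrightarrow> 0) (at t within {0..T})" by simp
  qed
  show v1: "C0_into T X v'"
  proof (rule C0_into_of_modulus[OF A v' lip])
    fix t
    have "((\<lambda>r. (L * \<bar>r - t\<bar>)\<^sup>2) \<longlongrightarrow> (L * \<bar>t - t\<bar>)\<^sup>2) (at t within {0..T})" by (intro tendsto_intros)
    then show "((\<lambda>r. (L * \<bar>r - t\<bar>)\<^sup>2) \<longlongrightarrow> 0) (at t within {0..T})" by simp
  qed
  show dv: "deriv_into T X v v'" by (rule deriv_intoI[OF v v1 d])
  have step: "(\<lambda>x. v' t x - v' r x) \<in> gevrey_step I lam w s A \<and> gevrey_norm I lam w s A (\<lambda>x. v' t x - v' r x) \<le> L * \<bar>t - r\<bar>"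
    if t: "t \<in> {0..T}" and r: "r \<in> {0..T}" for t r
  proof -
    have c: "coef (\<lambda>x. v' t x - v' r x) \<xi> = coef (v' t) \<xi> - coef (v' r) \<xi>" if "\<xi> \<in> I" for \<xi>
      using v'[OF t] v'[OF r] that by (intro coef_diff gevrey_L2)
    have b: "(\<Sum>\<xi>\<in>F. wt A \<xi> * (cmod (coef (\<lambda>x. v' t x - v' r x) \<xi>))\<^sup>2) \<le> (L * \<bar>t - r\<bar>)\<^sup>2" if F: "finite F" "F \<subseteq> I" for F
    proof -
      have "(\<Sum>\<xi>\<in>F. wt A \<xi> * (cmod (coef (\<lambda>x. v' t x - v' r x) \<xi>))\<^sup>2) = (\<Sum>\<xi>\<in>F. wt A \<xi> * (cmod (coef (v' t) \<xi> - coef (v' r) \<xi>))\<^sup>2)"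
        using F by (intro sum.cong refl) (simp add: c subset_iff)
      then show ?thesis using lip[OF F r t] by simp
    qed
    note w = weighted_sq_bounded[where I = I, OF wt_nonneg b]
    have "sqrt (weighted_sq I (wt A) (coef (\<lambda>x. v' t x - v' r x))) \<le> L * \<bar>t - r\<bar>"
      using L by (intro real_le_lsqrt w(2)) (auto intro: weighted_sq_nonneg wt_nonneg)
    then show ?thesis using w(1) L2_diff[OF gevrey_L2[OF v'[OF t]] gevrey_L2[OF v'[OF r]]]
      by (simp add: gevrey_step_iff gevrey_norm_eq)
  qed
  show "gevrey_W2inf I lam w s T v"
    unfolding gevrey_W2inf_def
    by (intro exI[of _ v'] conjI v0 v1 dv) (use step A in blast)
qed

text \<open>Both notions of regularity in the uniqueness statement give the same information on a single
coefficient.\<close>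

lemma coef_derivative_lipschitz:
  assumes T: "T > 0" and z: "gevrey_W2inf I lam w s T z \<or> C2_into T X z" and \<xi>: "\<xi> \<in> I"
    and d: "\<And>t. t \<in> {0..T} \<Longrightarrow> ((\<lambda>r. coef (z r) \<xi>) has_vector_derivative y1 t) (at t within {0..T})"
  obtains L where "\<And>t r. t \<in> {0..T} \<Longrightarrow> r \<in> {0..T} \<Longrightarrow> cmod (y1 t - y1 r) \<le> L * \<bar>t - r\<bar>"
proof -
  have unique: "y1 t = coef (z' t) \<xi>" if z0: "C0_into T X z" and z': "deriv_into T X z z'" and t: "t \<in> {0..T}" for z' t
  proof (rule vector_derivative_unique_within)
    show "at t within {0..T} \<noteq> bot" using T t by (simp add: trivial_limit_within islimpt_Icc)
    show "((\<lambda>r. coef (z r) \<xi>) has_vector_derivative coef (z' t) \<xi>) (at t within {0..T})"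
      by (intro deriv_into_coef[OF z' _ \<xi> t] gevrey_L2 C0_into_gevrey[OF z0])
  qed (rule d[OF t])
  from z show thesis
  proof
    assume "gevrey_W2inf I lam w s T z"
    then obtain z' A L where z': "C0_into T X z" "C0_into T X z'" "deriv_into T X z z'" "A > 0"
      and lip: "\<And>t r. t \<in> {0..T} \<Longrightarrow> r \<in> {0..T} \<Longrightarrow> (\<lambda>x. z' t x - z' r x) \<in> gevrey_step I lam w s A \<and>
        gevrey_norm I lam w s A (\<lambda>x. z' t x - z' r x) \<le> L * \<bar>t - r\<bar>"
      unfolding gevrey_W2inf_def by blast
    show thesis
    proof (rule that[of L])
      fix t r assume t: "t \<in> {0..T}" and r: "r \<in> {0..T}"
      have "(cmod (coef (\<lambda>x. z' t x - z' r x) \<xi>))\<^sup>2 \<le> wt A \<xi> * (cmod (coef (\<lambda>x. z' t x - z' r x) \<xi>))\<^sup>2"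
        using gevrey_weight_ge_1[of A lam s \<xi>] z'(4) mult_right_mono[of 1 "wt A \<xi>" "(cmod (coef (\<lambda>x. z' t x - z' r x) \<xi>))\<^sup>2"] by simp
      also have "\<dots> \<le> weighted_sq I (wt A) (coef (\<lambda>x. z' t x - z' r x))"
        using finite_sum_le_weighted_sq[where I = I and \<omega> = "wt A" and F = "{\<xi>}" and b = "coef (\<lambda>x. z' t x - z' r x)"]
          wt_nonneg lip[OF t r] \<xi> by (simp add: gevrey_step_iff)
      finally have "cmod (coef (\<lambda>x. z' t x - z' r x) \<xi>) \<le> gevrey_norm I lam w s A (\<lambda>x. z' t x - z' r x)"
        unfolding gevrey_norm_eq by (rule real_le_rsqrt)
      also have "\<dots> \<le> L * \<bar>t - r\<bar>" using lip[OF t r] by blast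
      also have "coef (\<lambda>x. z' t x - z' r x) \<xi> = y1 t - y1 r"
        using C0_into_gevrey[OF z'(2) t] C0_into_gevrey[OF z'(2) r] \<xi>
        by (simp add: coef_diff gevrey_L2 unique[OF z'(1,3) t] unique[OF z'(1,3) r])
      finally show "cmod (y1 t - y1 r) \<le> L * \<bar>t - r\<bar>" .
    qed
  next
    assume "C2_into T X z"
    then obtain z' z'' where z': "C0_into T X z" "C0_into T X z'" "C0_into T X z''" "deriv_into T X z z'" "deriv_into T X z' z''"
      unfolding C2_into_def by blast
    have "continuous_on {0..T} (\<lambda>t. cmod (coef (z'' t) \<xi>))"
      by (intro continuous_intros C0_into_coef_continuous[OF z'(3) \<xi>])
    then obtain B where B: "\<And>t. t \<in> {0..T} \<Longrightarrow> \<bar>cmod (coef (z'' t) \<xi>)\<bar> \<le> B" using continuous_on_Icc_bounded by blast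
    show thesis
    proof (rule that[of B])
      fix t r assume t: "t \<in> {0..T}" and r: "r \<in> {0..T}"
      have "cmod (coef (z' t) \<xi> - coef (z' r) \<xi>) \<le> B * \<bar>t - r\<bar>"
      proof (rule vector_derivative_bound_imp_lipschitz[of "{0..T}" "\<lambda>t. coef (z' t) \<xi>" "\<lambda>t. coef (z'' t) \<xi>" B t r, OF _ _ _ t r])
        show "((\<lambda>t. coef (z' t) \<xi>) has_vector_derivative coef (z'' \<tau>) \<xi>) (at \<tau> within {0..T})" if "\<tau> \<in> {0..T}" for \<tau>
          by (intro deriv_into_coef[OF z'(5) _ \<xi> that] gevrey_L2 C0_into_gevrey[OF z'(2)])
        show "cmod (coef (z'' \<tau>) \<xi>) \<le> B" if "\<tau> \<in> {0..T}" for \<tau> using B[OF that] by simp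
      qed simp
      then show "cmod (y1 t - y1 r) \<le> B * \<bar>t - r\<bar>" by (simp add: unique[OF z'(1,4) t] unique[OF z'(1,4) r])
    qed
  qed
qed

lemma solution_unique:
  assumes T: "T > 0" and a: "continuous_on {0..T} a" and q: "L_infinity T q"
    and v: "gevrey_W2inf I lam w s T v \<or> C2_into T X v" "solves_cauchy I mu w T a q f v0 v1 v"
    and z: "gevrey_W2inf I lam w s T z \<or> C2_into T X z" "solves_cauchy I mu w T a q f v0 v1 z"
    and t: "t \<in> {0..T}"
  shows "AE x in lebesgue. z t x = v t x"
proof -
  have reg: "h t \<in> \<gamma>" if "gevrey_W2inf I lam w s T h \<or> C2_into T X h" for h
    using that t C0_into_gevrey unfolding gevrey_W2inf_def C2_into_def by blast
  have "coef (z t) \<xi> = coef (v t) \<xi>" if \<xi>: "\<xi> \<in> I" for \<xi>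
  proof -
    have lem: "{0..T} \<in> sets lebesgue" by simp
    obtain y1 where y1: "\<And>t. t \<in> {0..T} \<Longrightarrow> ((\<lambda>r. coef (v r) \<xi>) has_vector_derivative y1 t) (at t within {0..T})"
       "coef (v 0) \<xi> = coef v0 \<xi>" "y1 0 = coef v1 \<xi>"
       "AE t in lebesgue_on {0..T}. \<exists>y2. (y1 has_vector_derivative y2) (at t within {0..T}) \<and>
        y2 + complex_of_real (a t * mu \<xi>) * coef (v t) \<xi> + complex_of_real (q t) * coef (v t) \<xi> = coef (f t) \<xi>"
      using v(2) \<xi> unfolding solves_cauchy_def by blast
    obtain x1 where x1: "\<And>t. t \<in> {0..T} \<Longrightarrow> ((\<lambda>r. coef (z r) \<xi>) has_vector_derivative x1 t) (at t within {0..T})"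
       "coef (z 0) \<xi> = coef v0 \<xi>" "x1 0 = coef v1 \<xi>"
       "AE t in lebesgue_on {0..T}. \<exists>y2. (x1 has_vector_derivative y2) (at t within {0..T}) \<and>
        y2 + complex_of_real (a t * mu \<xi>) * coef (z t) \<xi> + complex_of_real (q t) * coef (z t) \<xi> = coef (f t) \<xi>"
      using z(2) \<xi> unfolding solves_cauchy_def by blast
    obtain L1 where L1: "\<And>t r. t \<in> {0..T} \<Longrightarrow> r \<in> {0..T} \<Longrightarrow> cmod (y1 t - y1 r) \<le> L1 * \<bar>t - r\<bar>"
      using coef_derivative_lipschitz[OF T v(1) \<xi> y1(1)] by blast
    obtain L2 where L2: "\<And>t r. t \<in> {0..T} \<Longrightarrow> r \<in> {0..T} \<Longrightarrow> cmod (x1 t - x1 r) \<le> L2 * \<bar>t - r\<bar>"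
      using coef_derivative_lipschitz[OF T z(1) \<xi> x1(1)] by blast
    obtain N1 where N1: "negligible N1" "\<And>t. t \<in> {0..T} - N1 \<Longrightarrow> \<exists>y2. (y1 has_vector_derivative y2) (at t within {0..T}) \<and>
        y2 + complex_of_real (a t * mu \<xi>) * coef (v t) \<xi> + complex_of_real (q t) * coef (v t) \<xi> = coef (f t) \<xi>"
      using y1(4) unfolding AE_lebesgue_on_negligible[OF lem] by blast
    obtain N2 where N2: "negligible N2" "\<And>t. t \<in> {0..T} - N2 \<Longrightarrow> \<exists>y2. (x1 has_vector_derivative y2) (at t within {0..T}) \<and>
        y2 + complex_of_real (a t * mu \<xi>) * coef (z t) \<xi> + complex_of_real (q t) * coef (z t) \<xi> = coef (f t) \<xi>"
      using x1(4) unfolding AE_lebesgue_on_negligible[OF lem] by blast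
    obtain M where "AE t in lebesgue_on {0..T}. \<bar>q t\<bar> \<le> M" using q unfolding L_infinity_def by blast
    then obtain N3 where N3: "negligible N3" "\<And>t. t \<in> {0..T} - N3 \<Longrightarrow> \<bar>q t\<bar> \<le> M"
      unfolding AE_lebesgue_on_negligible[OF lem] by blast
    obtain Ba where Ba: "\<And>t. t \<in> {0..T} \<Longrightarrow> \<bar>a t\<bar> \<le> Ba" using continuous_on_Icc_bounded[OF a] by blast
    have "coef (z t) \<xi> - coef (v t) \<xi> = 0"
    proof (rule second_order_uniqueness[where d = "\<lambda>t. coef (z t) \<xi> - coef (v t) \<xi>" and ?d1.0 = "\<lambda>t. x1 t - y1 t" and p = "\<lambda>t. a t * mu \<xi> + q t"
          and T = T and N = "N1 \<union> N2 \<union> N3" and L = "L1 + L2" and P = "Ba * \<bar>mu \<xi>\<bar> + M"])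
      show "((\<lambda>t. coef (z t) \<xi> - coef (v t) \<xi>) has_vector_derivative x1 t - y1 t) (at t within {0..T})" if "t \<in> {0..T}" for t
        by (intro has_vector_derivative_diff x1(1) y1(1) that)
      show "cmod ((x1 s - y1 s) - (x1 t - y1 t)) \<le> (L1 + L2) * \<bar>s - t\<bar>" if "s \<in> {0..T}" "t \<in> {0..T}" for s t
      proof -
        have "(x1 s - y1 s) - (x1 t - y1 t) = (x1 s - x1 t) - (y1 s - y1 t)" by simp
        then have "cmod ((x1 s - y1 s) - (x1 t - y1 t)) \<le> cmod (x1 s - x1 t) + cmod (y1 s - y1 t)" by (metis norm_triangle_ineq4)
        then show ?thesis using L1[OF that] L2[OF that] by (simp add: distrib_right)
      qed
      fix t assume t: "t \<in> {0..T} - (N1 \<union> N2 \<union> N3)"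
      obtain y2 where y2: "(y1 has_vector_derivative y2) (at t within {0..T})"
        "y2 + complex_of_real (a t * mu \<xi>) * coef (v t) \<xi> + complex_of_real (q t) * coef (v t) \<xi> = coef (f t) \<xi>" using N1(2)[of t] t by blast
      obtain x2 where x2: "(x1 has_vector_derivative x2) (at t within {0..T})"
        "x2 + complex_of_real (a t * mu \<xi>) * coef (z t) \<xi> + complex_of_real (q t) * coef (z t) \<xi> = coef (f t) \<xi>" using N2(2)[of t] t by blast
      have "x2 - y2 = - of_real (a t * mu \<xi> + q t) * (coef (z t) \<xi> - coef (v t) \<xi>)"
      proof -
        have "x2 = coef (f t) \<xi> - complex_of_real (a t * mu \<xi>) * coef (z t) \<xi> - complex_of_real (q t) * coef (z t) \<xi>"
          using x2(2) by (simp only: eq_diff_eq ac_simps)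
        moreover have "y2 = coef (f t) \<xi> - complex_of_real (a t * mu \<xi>) * coef (v t) \<xi> - complex_of_real (q t) * coef (v t) \<xi>"
          using y2(2) by (simp only: eq_diff_eq ac_simps)
        ultimately have "x2 - y2 = (coef (f t) \<xi> - complex_of_real (a t * mu \<xi>) * coef (z t) \<xi> - complex_of_real (q t) * coef (z t) \<xi>)
          - (coef (f t) \<xi> - complex_of_real (a t * mu \<xi>) * coef (v t) \<xi> - complex_of_real (q t) * coef (v t) \<xi>)" by (simp only:)
        then show ?thesis by (simp add: algebra_simps)
      qed
      then have "((\<lambda>t. x1 t - y1 t) has_vector_derivative - of_real (a t * mu \<xi> + q t) * (coef (z t) \<xi> - coef (v t) \<xi>)) (at t within {0..T})"
        using has_vector_derivative_diff[OF x2(1) y2(1)] by simp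
      moreover have "\<bar>a t * mu \<xi> + q t\<bar> \<le> Ba * \<bar>mu \<xi>\<bar> + M"
      proof -
        have "\<bar>a t * mu \<xi> + q t\<bar> \<le> \<bar>a t\<bar> * \<bar>mu \<xi>\<bar> + \<bar>q t\<bar>" using abs_triangle_ineq[of "a t * mu \<xi>" "q t"] by (simp add: abs_mult)
        also have "\<dots> \<le> Ba * \<bar>mu \<xi>\<bar> + M" using Ba[of t] N3(2)[of t] t by (intro add_mono mult_right_mono) auto
        finally show ?thesis .
      qed
      ultimately show "((\<lambda>t. x1 t - y1 t) has_vector_derivative - of_real (a t * mu \<xi> + q t) * (coef (z t) \<xi> - coef (v t) \<xi>)) (at t within {0..T}) \<and>
          \<bar>a t * mu \<xi> + q t\<bar> \<le> Ba * \<bar>mu \<xi>\<bar> + M" by blast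
    qed (use T N1 N2 N3 x1 y1 t in \<open>auto intro!: negligible_Un\<close>)
    then show ?thesis by simp
  qed
  then show ?thesis using coefficients_eq_imp_AE_eq[OF gevrey_L2[OF reg[OF z(1)]] gevrey_L2[OF reg[OF v(1)]]] by blast
qed

end

section \<open>The Cauchy problem\<close>

lemma C_alpha_continuous:
  assumes "0 < \<alpha>" "C_alpha \<alpha> T a" shows "continuous_on {0..T} a"
proof (cases "\<alpha> \<le> 1")
  case True
  then obtain M where M: "M > 0" "\<And>t t'. t \<in> {0..T} \<Longrightarrow> t' \<in> {0..T} \<Longrightarrow> \<bar>a t - a t'\<bar> \<le> M * \<bar>t - t'\<bar> powr \<alpha>"
    using assms(2) unfolding C_alpha_def holder_on_def by auto
  show ?thesis by (rule holder_modulus_continuous[OF assms(1) M(2)])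
next
  case False
  then obtain a' where "\<forall>t\<in>{0..T}. (a has_real_derivative a' t) (at t within {0..T})"
    using assms(2) unfolding C_alpha_def by (auto simp only: if_False)
  then show ?thesis by (intro DERIV_continuous_on) blast
qed

lemma H_eigenvalue_bounds:
  assumes "c > 0"
  shows "0 \<le> H_eigenvalue c I lam \<xi>" "H_eigenvalue c I lam \<xi> \<le> (1 + c) * (japanese lam \<xi>)\<^sup>2"
proof -
  have J: "(japanese lam \<xi>)\<^sup>2 = 1 + cmod (lam \<xi>)"
    by (simp add: japanese_def power2_eq_square powr_add[symmetric])
  have "0 \<le> c * cmod (lam \<xi>)" using assms by simp
  then show "H_eigenvalue c I lam \<xi> \<le> (1 + c) * (japanese lam \<xi>)\<^sup>2"
    unfolding J H_eigenvalue_def using assms by (auto simp: algebra_simps)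
  show "0 \<le> H_eigenvalue c I lam \<xi>" using assms by (simp add: H_eigenvalue_def)
qed

context gevrey_scale begin

text \<open>All coefficient equations are solved, and the energy estimates are summed. The
bound \<open>\<rho>\<close> of a coefficient may be multiplied by \<open>J ^ 4\<close>, to make room for a factor
\<open>\<mu>\<close> in \<open>y''\<close>, because the exponential absorption of powers of \<open>J\<close> costs only half of the exponent \<open>A\<close>.\<close>

lemma coefficient_family:
  assumes T: "T > 0" and al: "0 < \<alpha>" "\<alpha> < 2" and a: "C_alpha \<alpha> T a" and pos: "\<forall>t\<in>{0..T}. a t \<ge> 0"
    and s: "1 \<le> s" "s < 1 + \<alpha> / 2" and c: "c \<ge> 0"
    and Qc: "continuous_on {0..T} Q" and QB: "\<And>t. t \<in> {0..T} \<Longrightarrow> \<bar>Q t\<bar> \<le> B"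
    and mu: "\<And>\<xi>. \<xi> \<in> I \<Longrightarrow> 0 \<le> mu \<xi>" "\<And>\<xi>. \<xi> \<in> I \<Longrightarrow> mu \<xi> \<le> c * (japanese lam \<xi>)\<^sup>2"
    and f: "C0_into T X f" and v0: "v0 \<in> \<gamma>" and v1: "v1 \<in> \<gamma>"
  obtains y z \<rho> A S where "A > 0" "S \<ge> 0"
    "\<And>\<xi>. \<xi> \<in> I \<Longrightarrow> y \<xi> 0 = coef v0 \<xi>" "\<And>\<xi>. \<xi> \<in> I \<Longrightarrow> z \<xi> 0 = coef v1 \<xi>"
    "\<And>\<xi>. \<xi> \<in> I \<Longrightarrow> quasi_solution T a Q (mu \<xi>) (\<lambda>t. coef (f t) \<xi>) (y \<xi>) (z \<xi>)"
    "\<And>\<xi>. \<xi> \<in> I \<Longrightarrow> 0 \<le> \<rho> \<xi>"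
    "\<And>\<xi> t. \<xi> \<in> I \<Longrightarrow> t \<in> {0..T} \<Longrightarrow> (cmod (z \<xi> t))\<^sup>2 + (cmod (y \<xi> t))\<^sup>2 \<le> \<rho> \<xi>"
    "\<And>F. finite F \<Longrightarrow> F \<subseteq> I \<Longrightarrow> (\<Sum>\<xi>\<in>F. wt A \<xi> * ((japanese lam \<xi>) ^ 4 * \<rho> \<xi>)) \<le> S"
    "\<And>F t. finite F \<Longrightarrow> F \<subseteq> I \<Longrightarrow> t \<in> {0..T} \<Longrightarrow> (\<Sum>\<xi>\<in>F. wt A \<xi> * (cmod (coef (f t) \<xi>))\<^sup>2) \<le> S"
proof -
  have ac: "continuous_on {0..T} a" by (rule C_alpha_continuous[OF al(1) a])
  have fc: "continuous_on {0..T} (\<lambda>t. coef (f t) \<xi>)" if "\<xi> \<in> I" for \<xi> by (rule C0_into_coef_continuous[OF f that])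
  have "\<forall>\<xi>. \<exists>p. \<xi> \<in> I \<longrightarrow> fst p 0 = coef v0 \<xi> \<and> snd p 0 = coef v1 \<xi> \<and>
    quasi_solution T a Q (mu \<xi>) (\<lambda>t. coef (f t) \<xi>) (fst p) (snd p)"
  proof
    fix \<xi>
    show "\<exists>p. \<xi> \<in> I \<longrightarrow> fst p 0 = coef v0 \<xi> \<and> snd p 0 = coef v1 \<xi> \<and>
      quasi_solution T a Q (mu \<xi>) (\<lambda>t. coef (f t) \<xi>) (fst p) (snd p)"
    proof (cases "\<xi> \<in> I")
      case True
      obtain y z where "y 0 = coef v0 \<xi>" "z 0 = coef v1 \<xi>" "quasi_solution T a Q (mu \<xi>) (\<lambda>t. coef (f t) \<xi>) y z"
        using quasi_derivative_system_exists[OF less_imp_le[OF T] ac Qc fc[OF True]] by blast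
      then show ?thesis by (intro exI[of _ "(y, z)"]) simp
    qed auto
  qed
  then obtain p where p: "\<forall>\<xi>. \<xi> \<in> I \<longrightarrow> fst (p \<xi>) 0 = coef v0 \<xi> \<and> snd (p \<xi>) 0 = coef v1 \<xi> \<and>
    quasi_solution T a Q (mu \<xi>) (\<lambda>t. coef (f t) \<xi>) (fst (p \<xi>)) (snd (p \<xi>))"
    by (rule choice[THEN exE])
  define y z where "y \<xi> = fst (p \<xi>)" and "z \<xi> = snd (p \<xi>)" for \<xi>
  have yz: "y \<xi> 0 = coef v0 \<xi>" "z \<xi> 0 = coef v1 \<xi>" and qs: "quasi_solution T a Q (mu \<xi>) (\<lambda>t. coef (f t) \<xi>) (y \<xi>) (z \<xi>)"
    if "\<xi> \<in> I" for \<xi> using p that unfolding y_def z_def by blast+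
  obtain C K where CK: "C > 0" "K \<ge> 0"
    and grow: "\<forall>J\<ge>1. \<forall>\<mu>. \<forall>y z f. 0 \<le> \<mu> \<and> \<mu> \<le> c * J\<^sup>2 \<and> continuous_on {0..T} f \<and> quasi_solution T a Q \<mu> f y z \<longrightarrow>
      (\<forall>t\<in>{0..T}. (cmod (z t))\<^sup>2 + (cmod (y t))\<^sup>2 \<le> C * J\<^sup>2 * exp (K * J powr (2 / (2 + \<alpha>))) *
        ((cmod (z 0))\<^sup>2 + (cmod (y 0))\<^sup>2 + integral {0..T} (\<lambda>r. (cmod (f r))\<^sup>2)))"
    using coefficient_growth[where Q = Q and B = B, OF T al a pos _ c] QB by blast
  define D where "D \<xi> = (cmod (coef v1 \<xi>))\<^sup>2 + (cmod (coef v0 \<xi>))\<^sup>2 + integral {0..T} (\<lambda>r. (cmod (coef (f r) \<xi>))\<^sup>2)" for \<xi>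
  have f2: "(\<lambda>r. (cmod (coef (f r) \<xi>))\<^sup>2) integrable_on {0..T}" if "\<xi> \<in> I" for \<xi>
    by (intro integrable_continuous_interval continuous_intros fc that)
  have fw: "(\<lambda>r. wt A \<xi> * (cmod (coef (f r) \<xi>))\<^sup>2) integrable_on {0..T}" if "\<xi> \<in> I" for A \<xi>
    by (intro integrable_continuous_interval continuous_intros fc that)
  have D: "D \<xi> \<ge> 0" if "\<xi> \<in> I" for \<xi> unfolding D_def by (intro add_nonneg_nonneg integral_nonneg f2 that) auto
  define \<rho> where "\<rho> \<xi> = C * (japanese lam \<xi>)\<^sup>2 * exp (K * japanese lam \<xi> powr (2 / (2 + \<alpha>))) * D \<xi>" for \<xi>
  \<comment> \<open>a common step of the scale for all data\<close>
  obtain Av0 where Av0: "Av0 > 0" "weighted_summable I (wt Av0) (coef v0)" using v0 by (auto simp: gevrey_iff)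
  obtain Av1 where Av1: "Av1 > 0" "weighted_summable I (wt Av1) (coef v1)" using v1 by (auto simp: gevrey_iff)
  obtain Af Mf where Af: "Af > 0" "\<And>t. t \<in> {0..T} \<Longrightarrow> weighted_summable I (wt Af) (coef (f t)) \<and> weighted_sq I (wt Af) (coef (f t)) \<le> Mf"
    using C0_into_bounded_in_step[OF f] by blast
  define A where "A = min (min Av0 Av1) Af"
  have A: "A > 0" "A \<le> Av0" "A \<le> Av1" "A \<le> Af" using Av0 Av1 Af by (auto simp: A_def)
  have sum0: "(\<Sum>\<xi>\<in>F. wt A \<xi> * (cmod (coef v0 \<xi>))\<^sup>2) \<le> weighted_sq I (wt A) (coef v0)" if "finite F" "F \<subseteq> I" for F
    by (intro finite_sum_le_weighted_sq wt_nonneg wt_summable_mono[OF A(2) Av0(2)] that)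
  have sum1: "(\<Sum>\<xi>\<in>F. wt A \<xi> * (cmod (coef v1 \<xi>))\<^sup>2) \<le> weighted_sq I (wt A) (coef v1)" if "finite F" "F \<subseteq> I" for F
    by (intro finite_sum_le_weighted_sq wt_nonneg wt_summable_mono[OF A(3) Av1(2)] that)
  have sumf: "(\<Sum>\<xi>\<in>F. wt A \<xi> * (cmod (coef (f t) \<xi>))\<^sup>2) \<le> Mf" if F: "finite F" "F \<subseteq> I" and t: "t \<in> {0..T}" for F t
  proof -
    have "(\<Sum>\<xi>\<in>F. wt A \<xi> * (cmod (coef (f t) \<xi>))\<^sup>2) \<le> (\<Sum>\<xi>\<in>F. wt Af \<xi> * (cmod (coef (f t) \<xi>))\<^sup>2)"
      by (intro sum_mono mult_right_mono gevrey_weight_mono A) auto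
    also have "\<dots> \<le> weighted_sq I (wt Af) (coef (f t))"
      using Af(2)[OF t] by (intro finite_sum_le_weighted_sq wt_nonneg F) blast
    also have "\<dots> \<le> Mf" using Af(2)[OF t] by blast
    finally show ?thesis .
  qed
  have Mf: "Mf \<ge> 0" using sumf[of "{}" 0] T by simp
  define S0 where "S0 = weighted_sq I (wt A) (coef v1) + weighted_sq I (wt A) (coef v0) + T * Mf"
  have S0: "S0 \<ge> 0" unfolding S0_def using Mf T by (intro add_nonneg_nonneg weighted_sq_nonneg wt_nonneg) auto
  have sumD: "(\<Sum>\<xi>\<in>F. wt A \<xi> * D \<xi>) \<le> S0" if F: "finite F" "F \<subseteq> I" for F
  proof -
    have "(\<Sum>\<xi>\<in>F. wt A \<xi> * integral {0..T} (\<lambda>r. (cmod (coef (f r) \<xi>))\<^sup>2)) = integral {0..T} (\<lambda>r. \<Sum>\<xi>\<in>F. wt A \<xi> * (cmod (coef (f r) \<xi>))\<^sup>2)"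
      using F fw by (subst integral_sum) auto
    also have "\<dots> \<le> integral {0..T} (\<lambda>r. Mf)"
      using F fw by (intro integral_le integrable_sum sumf) auto
    also have "\<dots> = T * Mf" using T by simp
    finally show ?thesis unfolding D_def S0_def using sum0[OF F] sum1[OF F]
      by (simp add: distrib_left sum.distrib)
  qed
  have "2 / (2 + \<alpha>) < 1 / s" using al s by (simp add: field_simps)
  then obtain C2 where C2: "C2 > 0" "\<And>J::real. J \<ge> 1 \<Longrightarrow> J ^ 6 * exp (K * J powr (2 / (2 + \<alpha>))) \<le> C2 * exp (A * J powr (1 / s))"
    using exp_powr_absorb[of "2 / (2 + \<alpha>)" "1 / s" A K 6] al A(1) CK(2) by auto
  define S where "S = C * C2 * S0 + Mf"
  show thesis
  proof (rule that[of "A / 2" S y z \<rho>])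
    show "A / 2 > 0" using A by simp
    show "S \<ge> 0" using CK C2 S0 Mf by (simp add: S_def)
    show "0 \<le> \<rho> \<xi>" if "\<xi> \<in> I" for \<xi> using D[OF that] CK by (simp add: \<rho>_def)
    show "(cmod (z \<xi> t))\<^sup>2 + (cmod (y \<xi> t))\<^sup>2 \<le> \<rho> \<xi>" if \<xi>: "\<xi> \<in> I" and t: "t \<in> {0..T}" for \<xi> t
      using grow[rule_format, OF japanese_ge_1 conjI[OF mu(1)[OF \<xi>] conjI[OF mu(2)[OF \<xi>] conjI[OF fc[OF \<xi>] qs[OF \<xi>]]]] t]
      by (simp add: \<rho>_def D_def yz[OF \<xi>])
    fix F assume F: "finite F" "F \<subseteq> I"
    have "(\<Sum>\<xi>\<in>F. wt (A / 2) \<xi> * ((japanese lam \<xi>) ^ 4 * \<rho> \<xi>)) \<le> (\<Sum>\<xi>\<in>F. C * C2 * (wt A \<xi> * D \<xi>))"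
    proof (rule sum_mono)
      fix \<xi> assume "\<xi> \<in> F"
      then have \<xi>: "\<xi> \<in> I" using F by auto
      let ?J = "japanese lam \<xi>"
      have "wt (A / 2) \<xi> * (?J ^ 4 * \<rho> \<xi>) = C * D \<xi> * (exp (A * ?J powr (1 / s)) * (?J ^ 6 * exp (K * ?J powr (2 / (2 + \<alpha>)))))"
        by (simp add: \<rho>_def gevrey_weight_def power_add[symmetric] mult_ac power2_eq_square eval_nat_numeral)
      also have "\<dots> \<le> C * D \<xi> * (exp (A * ?J powr (1 / s)) * (C2 * exp (A * ?J powr (1 / s))))"
        using CK D[OF \<xi>] by (intro mult_left_mono C2(2) japanese_ge_1) auto
      also have "\<dots> = C * C2 * (wt A \<xi> * D \<xi>)"
        by (simp add: gevrey_weight_def exp_add[symmetric] mult_ac)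
      finally show "wt (A / 2) \<xi> * (?J ^ 4 * \<rho> \<xi>) \<le> C * C2 * (wt A \<xi> * D \<xi>)" .
    qed
    also have "\<dots> = C * C2 * (\<Sum>\<xi>\<in>F. wt A \<xi> * D \<xi>)" by (rule sum_distrib_left[symmetric])
    also have "\<dots> \<le> C * C2 * S0" using CK C2 by (intro mult_left_mono sumD F) auto
    also have "\<dots> \<le> S" using Mf by (simp add: S_def)
    finally show "(\<Sum>\<xi>\<in>F. wt (A / 2) \<xi> * ((japanese lam \<xi>) ^ 4 * \<rho> \<xi>)) \<le> S" .
    fix t assume t: "t \<in> {0..T}"
    have "(\<Sum>\<xi>\<in>F. wt (A / 2) \<xi> * (cmod (coef (f t) \<xi>))\<^sup>2) \<le> (\<Sum>\<xi>\<in>F. wt A \<xi> * (cmod (coef (f t) \<xi>))\<^sup>2)"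
      using A by (intro sum_mono mult_right_mono gevrey_weight_mono) auto
    also have "\<dots> \<le> Mf" by (rule sumf[OF F t])
    also have "\<dots> \<le> S" using CK C2 S0 by (simp add: S_def)
    finally show "(\<Sum>\<xi>\<in>F. wt (A / 2) \<xi> * (cmod (coef (f t) \<xi>))\<^sup>2) \<le> S" .
  qed (fact yz qs)+
qed


text \<open>The coefficients of \<open>v\<close> and \<open>v'\<close> are \<open>y\<close> and \<open>y1 = z - Q y\<close>. The derivative of \<open>y1\<close> is
\<open>f\<close> plus terms bounded by \<open>J\<^sup>2 * sqrt \<rho>\<close>. Coefficientwise suprema of \<open>f\<close> over time need not be
summable, so the contribution of \<open>f\<close> to the Lipschitz constant of \<open>v'\<close> is estimated by the mean value
inequality with a common intermediate time, and only the remainder coefficient by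
coefficient. If \<open>q\<close> is continuous, then \<open>v''\<close> is the difference of \<open>f\<close> and a function with coefficients
\<open>(a \<mu> + q) y\<close>.\<close>

lemma solution_exists:
  assumes T: "T > 0" and al: "0 < \<alpha>" "\<alpha> < 2" and a: "C_alpha \<alpha> T a" and pos: "\<forall>t\<in>{0..T}. a t \<ge> 0"
    and s: "1 \<le> s" "s < 1 + \<alpha> / 2" and c: "c \<ge> 0" and q: "L_infinity T q"
    and mu: "\<And>\<xi>. \<xi> \<in> I \<Longrightarrow> 0 \<le> mu \<xi>" "\<And>\<xi>. \<xi> \<in> I \<Longrightarrow> mu \<xi> \<le> c * (japanese lam \<xi>)\<^sup>2"
    and f: "C0_into T X f" and v0: "v0 \<in> \<gamma>" and v1: "v1 \<in> \<gamma>"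
  shows "\<exists>v. gevrey_W2inf I lam w s T v \<and> (has_continuous_representative T q \<longrightarrow> C2_into T X v) \<and>
    solves_cauchy I mu w T a q f v0 v1 v"
proof -
  obtain p M N where p: "integrable lebesgue p" "\<And>t. \<bar>p t\<bar> \<le> M" "negligible N" "\<And>t. t \<in> {0..T} - N \<Longrightarrow> p t = q t"
    using L_infinity_bounded_representative[OF q] by blast
  define Q where "Q = primitive p"
  have M: "M \<ge> 0" using p(2)[of 0] by linarith
  have Qlip: "\<bar>Q t - Q r\<bar> \<le> M * \<bar>t - r\<bar>" if "t \<in> {0..T}" "r \<in> {0..T}" for t r
    unfolding Q_def using that by (intro primitive_lipschitz[OF p(1,2)]) auto
  have Q0: "Q 0 = 0"
    unfolding Q_def by (rule primitive_zero)
  define B where "B = M * T"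
  have QB: "\<bar>Q t\<bar> \<le> B" if "t \<in> {0..T}" for t
  proof -
    have "\<bar>Q t\<bar> \<le> M * \<bar>t - 0\<bar>" using Qlip[OF that, of 0] T Q0 by simp
    also have "\<dots> \<le> B" unfolding B_def using that M by (intro mult_left_mono) auto
    finally show ?thesis .
  qed
  have B: "B \<ge> 0" using M T by (simp add: B_def)
  have Qc: "continuous_on {0..T} Q"
    by (rule lipschitz_on_continuous_on[of M]) (use Qlip M in \<open>auto simp: lipschitz_on_def dist_real_def\<close>)
  have ac: "continuous_on {0..T} a" by (rule C_alpha_continuous[OF al(1) a])
  obtain Ba where Ba: "Ba \<ge> 0" "\<And>t. t \<in> {0..T} \<Longrightarrow> \<bar>a t\<bar> \<le> Ba" using continuous_on_Icc_bounded[OF ac] by blast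
  obtain y z \<rho> A S where A: "A > 0" and S: "S \<ge> 0"
    and init: "\<And>\<xi>. \<xi> \<in> I \<Longrightarrow> y \<xi> 0 = coef v0 \<xi>" "\<And>\<xi>. \<xi> \<in> I \<Longrightarrow> z \<xi> 0 = coef v1 \<xi>"
    and qs: "\<And>\<xi>. \<xi> \<in> I \<Longrightarrow> quasi_solution T a Q (mu \<xi>) (\<lambda>t. coef (f t) \<xi>) (y \<xi>) (z \<xi>)"
    and \<rho>0: "\<And>\<xi>. \<xi> \<in> I \<Longrightarrow> 0 \<le> \<rho> \<xi>"
    and \<rho>: "\<And>\<xi> t. \<xi> \<in> I \<Longrightarrow> t \<in> {0..T} \<Longrightarrow> (cmod (z \<xi> t))\<^sup>2 + (cmod (y \<xi> t))\<^sup>2 \<le> \<rho> \<xi>"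
    and sum\<rho>: "\<And>F. finite F \<Longrightarrow> F \<subseteq> I \<Longrightarrow> (\<Sum>\<xi>\<in>F. wt A \<xi> * ((japanese lam \<xi>) ^ 4 * \<rho> \<xi>)) \<le> S"
    and sumf: "\<And>F t. finite F \<Longrightarrow> F \<subseteq> I \<Longrightarrow> t \<in> {0..T} \<Longrightarrow> (\<Sum>\<xi>\<in>F. wt A \<xi> * (cmod (coef (f t) \<xi>))\<^sup>2) \<le> S"
    by (rule coefficient_family[where Q = Q and B = B and mu = mu, OF T al a pos s c Qc _ _ _ f v0 v1]) (use QB mu in blast)+
  have dy: "(y \<xi> has_vector_derivative z \<xi> t - of_real (Q t) * y \<xi> t) (at t within {0..T})"
    and dz: "(z \<xi> has_vector_derivative
        coef (f t) \<xi> - of_real (a t * mu \<xi>) * y \<xi> t + of_real (Q t) * z \<xi> t - of_real ((Q t)\<^sup>2) * y \<xi> t) (at t within {0..T})"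
    if "\<xi> \<in> I" "t \<in> {0..T}" for \<xi> t using qs[OF that(1)] that(2) unfolding quasi_solution_def by blast+
  define y1 where "y1 \<xi> t = z \<xi> t - of_real (Q t) * y \<xi> t" for \<xi> t
  define J where "J \<xi> = japanese lam \<xi>" for \<xi>
  have J: "J \<xi> \<ge> 1" "1 \<le> (J \<xi>)\<^sup>2" for \<xi> using japanese_ge_1[of lam \<xi>] by (auto simp: J_def one_le_power)
  have yb: "cmod (y \<xi> t) \<le> sqrt (\<rho> \<xi>)" and zb: "cmod (z \<xi> t) \<le> sqrt (\<rho> \<xi>)" if "\<xi> \<in> I" "t \<in> {0..T}" for \<xi> t
  proof -
    have "(cmod (y \<xi> t))\<^sup>2 \<le> \<rho> \<xi>" "(cmod (z \<xi> t))\<^sup>2 \<le> \<rho> \<xi>"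
      using \<rho>[OF that] zero_le_power2[of "cmod (z \<xi> t)"] zero_le_power2[of "cmod (y \<xi> t)"] by linarith+
    then show "cmod (y \<xi> t) \<le> sqrt (\<rho> \<xi>)" "cmod (z \<xi> t) \<le> sqrt (\<rho> \<xi>)" by (auto intro: real_le_rsqrt)
  qed
  have y1b: "cmod (y1 \<xi> t) \<le> (1 + B) * sqrt (\<rho> \<xi>)" if "\<xi> \<in> I" "t \<in> {0..T}" for \<xi> t
  proof -
    have "cmod (y1 \<xi> t) \<le> cmod (z \<xi> t) + \<bar>Q t\<bar> * cmod (y \<xi> t)"
      unfolding y1_def using norm_triangle_ineq4[of "z \<xi> t" "of_real (Q t) * y \<xi> t"] by (simp add: norm_mult)
    also have "\<dots> \<le> sqrt (\<rho> \<xi>) + B * sqrt (\<rho> \<xi>)"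
      using yb[OF that] zb[OF that] QB[OF that(2)] B by (intro add_mono mult_mono) auto
    finally show ?thesis by (simp add: distrib_right)
  qed
  \<comment> \<open>every family bounded by a multiple of \<open>J\<^sup>2 * sqrt \<rho>\<close> stays in the step \<open>A\<close>\<close>
  have family: "(\<Sum>\<xi>\<in>F. wt A \<xi> * (cmod (b \<xi>))\<^sup>2) \<le> k\<^sup>2 * S"
    if F: "finite F" "F \<subseteq> I" and b: "\<And>\<xi>. \<xi> \<in> I \<Longrightarrow> cmod (b \<xi>) \<le> k * ((J \<xi>)\<^sup>2 * sqrt (\<rho> \<xi>))" for F b k
  proof -
    have "(\<Sum>\<xi>\<in>F. wt A \<xi> * (cmod (b \<xi>))\<^sup>2) \<le> (\<Sum>\<xi>\<in>F. k\<^sup>2 * (wt A \<xi> * ((japanese lam \<xi>) ^ 4 * \<rho> \<xi>)))"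
    proof (rule sum_mono)
      fix \<xi> assume "\<xi> \<in> F"
      then have \<xi>: "\<xi> \<in> I" using F by auto
      have "(cmod (b \<xi>))\<^sup>2 \<le> (k * ((J \<xi>)\<^sup>2 * sqrt (\<rho> \<xi>)))\<^sup>2" by (intro power_mono b \<xi>) auto
      also have "\<dots> = k\<^sup>2 * ((japanese lam \<xi>) ^ 4 * \<rho> \<xi>)"
        using \<rho>0[OF \<xi>] by (simp add: power_mult_distrib J_def power_mult[symmetric])
      finally have "wt A \<xi> * (cmod (b \<xi>))\<^sup>2 \<le> wt A \<xi> * (k\<^sup>2 * ((japanese lam \<xi>) ^ 4 * \<rho> \<xi>))" by (intro mult_left_mono wt_nonneg)
      then show "wt A \<xi> * (cmod (b \<xi>))\<^sup>2 \<le> k\<^sup>2 * (wt A \<xi> * ((japanese lam \<xi>) ^ 4 * \<rho> \<xi>))" by (simp add: mult_ac)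
    qed
    also have "\<dots> = k\<^sup>2 * (\<Sum>\<xi>\<in>F. wt A \<xi> * ((japanese lam \<xi>) ^ 4 * \<rho> \<xi>))" by (rule sum_distrib_left[symmetric])
    also have "\<dots> \<le> k\<^sup>2 * S" by (intro mult_left_mono sum\<rho> F) auto
    finally show ?thesis .
  qed
  have Jsq: "x \<le> (J \<xi>)\<^sup>2 * x" if "0 \<le> x" for x \<xi> using mult_right_mono[OF J(2) that] by simp
  have yfam: "(\<Sum>\<xi>\<in>F. wt A \<xi> * (cmod (y \<xi> t))\<^sup>2) \<le> 1\<^sup>2 * S" if "finite F" "F \<subseteq> I" "t \<in> {0..T}" for F t
  proof (rule family[OF that(1,2)])
    fix \<xi> assume \<xi>: "\<xi> \<in> I"
    show "cmod (y \<xi> t) \<le> 1 * ((J \<xi>)\<^sup>2 * sqrt (\<rho> \<xi>))" using yb[OF \<xi> that(3)] Jsq[of "sqrt (\<rho> \<xi>)" \<xi>] \<rho>0[OF \<xi>] by simp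
  qed
  have y1fam: "(\<Sum>\<xi>\<in>F. wt A \<xi> * (cmod (y1 \<xi> t))\<^sup>2) \<le> (1 + B)\<^sup>2 * S" if "finite F" "F \<subseteq> I" "t \<in> {0..T}" for F t
  proof (rule family[OF that(1,2)])
    fix \<xi> assume \<xi>: "\<xi> \<in> I"
    have "(1 + B) * sqrt (\<rho> \<xi>) \<le> (1 + B) * ((J \<xi>)\<^sup>2 * sqrt (\<rho> \<xi>))" using B \<rho>0[OF \<xi>] by (intro mult_left_mono Jsq) auto
    then show "cmod (y1 \<xi> t) \<le> (1 + B) * ((J \<xi>)\<^sup>2 * sqrt (\<rho> \<xi>))" using y1b[OF \<xi> that(3)] by simp
  qed
  have "\<exists>g. \<forall>t. t \<in> {0..T} \<longrightarrow> g t \<in> \<gamma> \<and> (\<forall>\<xi>\<in>I. coef (g t) \<xi> = y \<xi> t)"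
    by (rule synthesize_family[OF A yfam])
  then obtain v where v: "\<And>t. t \<in> {0..T} \<Longrightarrow> v t \<in> \<gamma>" "\<And>t \<xi>. t \<in> {0..T} \<Longrightarrow> \<xi> \<in> I \<Longrightarrow> coef (v t) \<xi> = y \<xi> t"
    by blast
  have "\<exists>g. \<forall>t. t \<in> {0..T} \<longrightarrow> g t \<in> \<gamma> \<and> (\<forall>\<xi>\<in>I. coef (g t) \<xi> = y1 \<xi> t)"
    by (rule synthesize_family[OF A y1fam])
  then obtain v' where v': "\<And>t. t \<in> {0..T} \<Longrightarrow> v' t \<in> \<gamma>" "\<And>t \<xi>. t \<in> {0..T} \<Longrightarrow> \<xi> \<in> I \<Longrightarrow> coef (v' t) \<xi> = y1 \<xi> t"
    by blast
  have dv: "((\<lambda>r. coef (v r) \<xi>) has_vector_derivative coef (v' t) \<xi>) (at t within {0..T})" if t: "t \<in> {0..T}" and \<xi>: "\<xi> \<in> I" for t \<xi>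
  proof (rule has_vector_derivative_transform[OF t])
    show "coef (v r) \<xi> = y \<xi> r" if "r \<in> {0..T}" for r by (rule v(2)[OF that \<xi>])
    show "(y \<xi> has_vector_derivative coef (v' t) \<xi>) (at t within {0..T})" using dy[OF \<xi> t] by (simp add: v'(2)[OF t \<xi>] y1_def)
  qed
  \<comment> \<open>\<open>y1\<close> is the primitive of \<open>f\<close> plus a remainder with a summable Lipschitz constant\<close>
  define \<phi> where "\<phi> \<xi> t = integral {0..t} (\<lambda>r. coef (f r) \<xi>)" for \<xi> t
  have d\<phi>: "(\<phi> \<xi> has_vector_derivative coef (f t) \<xi>) (at t within {0..T})" if "\<xi> \<in> I" "t \<in> {0..T}" for \<xi> t
    unfolding \<phi>_def by (rule integral_has_vector_derivative[OF C0_into_coef_continuous[OF f that(1)] that(2)])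
  define k where "k = Ba * c + B * (1 + B) + M + B * (1 + B)"
  have k: "k \<ge> 0" using Ba B M c by (simp add: k_def)
  have rem: "cmod ((y1 \<xi> r - \<phi> \<xi> r) - (y1 \<xi> t - \<phi> \<xi> t)) \<le> (k * \<bar>r - t\<bar>) * ((J \<xi>)\<^sup>2 * sqrt (\<rho> \<xi>))"
    if \<xi>: "\<xi> \<in> I" and t: "t \<in> {0..T}" and r: "r \<in> {0..T}" for \<xi> t r
  proof -
    define R where "R = (J \<xi>)\<^sup>2 * sqrt (\<rho> \<xi>)"
    have sR: "0 \<le> sqrt (\<rho> \<xi>)" "sqrt (\<rho> \<xi>) \<le> R" using Jsq[of "sqrt (\<rho> \<xi>)" \<xi>] \<rho>0[OF \<xi>] by (auto simp: R_def)
    have 1: "cmod ((z \<xi> r - \<phi> \<xi> r) - (z \<xi> t - \<phi> \<xi> t)) \<le> ((Ba * c + B * (1 + B)) * R) * \<bar>r - t\<bar>"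
    proof (rule vector_derivative_bound_imp_lipschitz[of "{0..T}" "\<lambda>t. z \<xi> t - \<phi> \<xi> t" "\<lambda>t. - of_real (a t * mu \<xi>) * y \<xi> t + of_real (Q t) * y1 \<xi> t", OF _ _ _ r t])
      fix \<tau> assume \<tau>: "\<tau> \<in> {0..T}"
      show "((\<lambda>t. z \<xi> t - \<phi> \<xi> t) has_vector_derivative - of_real (a \<tau> * mu \<xi>) * y \<xi> \<tau> + of_real (Q \<tau>) * y1 \<xi> \<tau>) (at \<tau> within {0..T})"
        using has_vector_derivative_diff[OF dz[OF \<xi> \<tau>] d\<phi>[OF \<xi> \<tau>]]
        by (rule has_vector_derivative_eq_rhs) (simp add: y1_def algebra_simps power2_eq_square)
      have "cmod (- of_real (a \<tau> * mu \<xi>) * y \<xi> \<tau> + of_real (Q \<tau>) * y1 \<xi> \<tau>) \<le> \<bar>a \<tau>\<bar> * mu \<xi> * cmod (y \<xi> \<tau>) + \<bar>Q \<tau>\<bar> * cmod (y1 \<xi> \<tau>)"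
        using norm_triangle_ineq[of "- of_real (a \<tau> * mu \<xi>) * y \<xi> \<tau>" "of_real (Q \<tau>) * y1 \<xi> \<tau>"] mu(1)[OF \<xi>]
        by (simp add: norm_mult abs_mult)
      also have "\<dots> \<le> Ba * (c * (J \<xi>)\<^sup>2) * sqrt (\<rho> \<xi>) + B * ((1 + B) * sqrt (\<rho> \<xi>))"
        using Ba(1) Ba(2)[OF \<tau>] mu[OF \<xi>] yb[OF \<xi> \<tau>] y1b[OF \<xi> \<tau>] QB[OF \<tau>] B c
        by (intro add_mono mult_mono) (auto simp: J_def)
      also have "\<dots> \<le> Ba * c * R + B * ((1 + B) * R)"
        using sR B by (intro add_mono mult_left_mono) (auto simp: R_def mult_ac)
      finally show "cmod (- of_real (a \<tau> * mu \<xi>) * y \<xi> \<tau> + of_real (Q \<tau>) * y1 \<xi> \<tau>) \<le> (Ba * c + B * (1 + B)) * R"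
        by (simp add: algebra_simps)
    qed simp
    have 2: "cmod (of_real (Q r) * y \<xi> r - of_real (Q t) * y \<xi> t) \<le> ((M + B * (1 + B)) * R) * \<bar>r - t\<bar>"
    proof -
      have yl: "cmod (y \<xi> r - y \<xi> t) \<le> ((1 + B) * sqrt (\<rho> \<xi>)) * \<bar>r - t\<bar>"
        by (rule vector_derivative_bound_imp_lipschitz[of "{0..T}" "y \<xi>" "y1 \<xi>", OF _ _ _ r t]) (use dy[OF \<xi>] y1b[OF \<xi>] in \<open>auto simp: y1_def\<close>)
      have "of_real (Q r) * y \<xi> r - of_real (Q t) * y \<xi> t = of_real (Q r - Q t) * y \<xi> r + of_real (Q t) * (y \<xi> r - y \<xi> t)"
        by (simp add: algebra_simps)
      then have "cmod (of_real (Q r) * y \<xi> r - of_real (Q t) * y \<xi> t) \<le> \<bar>Q r - Q t\<bar> * cmod (y \<xi> r) + \<bar>Q t\<bar> * cmod (y \<xi> r - y \<xi> t)"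
        using norm_triangle_ineq[of "of_real (Q r - Q t) * y \<xi> r" "of_real (Q t) * (y \<xi> r - y \<xi> t)"] by (simp add: norm_mult del: of_real_diff)
      also have "\<dots> \<le> (M * \<bar>r - t\<bar>) * R + B * (((1 + B) * R) * \<bar>r - t\<bar>)"
      proof (intro add_mono mult_mono)
        show "cmod (y \<xi> r) \<le> R" using yb[OF \<xi> r] sR by simp
        show "cmod (y \<xi> r - y \<xi> t) \<le> (1 + B) * R * \<bar>r - t\<bar>"
          by (rule order_trans[OF yl], intro mult_right_mono mult_left_mono sR) (use B in auto)
      qed (use Qlip[OF r t] QB[OF t] M B sR in auto)
      finally show ?thesis by (simp add: algebra_simps)
    qed
    have "(y1 \<xi> r - \<phi> \<xi> r) - (y1 \<xi> t - \<phi> \<xi> t) = ((z \<xi> r - \<phi> \<xi> r) - (z \<xi> t - \<phi> \<xi> t)) - (of_real (Q r) * y \<xi> r - of_real (Q t) * y \<xi> t)"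
      by (simp add: y1_def)
    then have "cmod ((y1 \<xi> r - \<phi> \<xi> r) - (y1 \<xi> t - \<phi> \<xi> t)) \<le> ((Ba * c + B * (1 + B)) * R) * \<bar>r - t\<bar> + ((M + B * (1 + B)) * R) * \<bar>r - t\<bar>"
      by (simp only:) (rule order_trans[OF norm_triangle_ineq4 add_mono[OF 1 2]])
    then show ?thesis by (simp add: k_def R_def algebra_simps)
  qed
  have \<phi>lip: "(\<Sum>\<xi>\<in>F. wt A \<xi> * (cmod (\<phi> \<xi> r - \<phi> \<xi> t))\<^sup>2) \<le> (r - t)\<^sup>2 * S"
    if F: "finite F" "F \<subseteq> I" and t: "t \<in> {0..T}" and r: "r \<in> {0..T}" for F t r
  proof -
    have d: "(\<phi> \<xi> has_vector_derivative coef (f \<tau>) \<xi>) (at \<tau> within {0..T})" if "\<xi> \<in> F" "\<tau> \<in> {0..T}" for \<xi> \<tau>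
      using that F by (intro d\<phi>) auto
    obtain x where x: "x \<in> closed_segment t r"
      "(\<Sum>\<xi>\<in>F. wt A \<xi> * (cmod (\<phi> \<xi> r - \<phi> \<xi> t))\<^sup>2) \<le> (r - t)\<^sup>2 * (\<Sum>\<xi>\<in>F. wt A \<xi> * (cmod (coef (f x) \<xi>))\<^sup>2)"
      by (rule weighted_mean_value[of F "wt A" 0 T \<phi> "\<lambda>\<xi> t. coef (f t) \<xi>" t r, OF wt_nonneg d t r])
    have "(r - t)\<^sup>2 * (\<Sum>\<xi>\<in>F. wt A \<xi> * (cmod (coef (f x) \<xi>))\<^sup>2) \<le> (r - t)\<^sup>2 * S"
      using closed_segment_within(1)[OF x(1) t r] by (intro mult_left_mono sumf F) auto
    with x(2) show ?thesis by linarith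
  qed
  define L where "L = sqrt (2 * S + 2 * (k\<^sup>2 * S))"
  have L: "L \<ge> 0" "L\<^sup>2 = 2 * S + 2 * (k\<^sup>2 * S)" using S by (auto simp: L_def)
  have lip: "(\<Sum>\<xi>\<in>F. wt A \<xi> * (cmod (coef (v' r) \<xi> - coef (v' t) \<xi>))\<^sup>2) \<le> (L * \<bar>r - t\<bar>)\<^sup>2"
    if F: "finite F" "F \<subseteq> I" and t: "t \<in> {0..T}" and r: "r \<in> {0..T}" for F t r
  proof -
    have "(\<Sum>\<xi>\<in>F. wt A \<xi> * (cmod (coef (v' r) \<xi> - coef (v' t) \<xi>))\<^sup>2)
      \<le> (\<Sum>\<xi>\<in>F. 2 * (wt A \<xi> * (cmod (\<phi> \<xi> r - \<phi> \<xi> t))\<^sup>2) + 2 * (wt A \<xi> * (cmod ((y1 \<xi> r - \<phi> \<xi> r) - (y1 \<xi> t - \<phi> \<xi> t)))\<^sup>2))"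
    proof (rule sum_mono)
      fix \<xi> assume "\<xi> \<in> F"
      then have \<xi>: "\<xi> \<in> I" using F by auto
      have "(cmod (coef (v' r) \<xi> - coef (v' t) \<xi>))\<^sup>2 \<le> 2 * (cmod (\<phi> \<xi> r - \<phi> \<xi> t))\<^sup>2 + 2 * (cmod ((y1 \<xi> r - \<phi> \<xi> r) - (y1 \<xi> t - \<phi> \<xi> t)))\<^sup>2"
        using cmod_add_square_le[of "\<phi> \<xi> r - \<phi> \<xi> t" "(y1 \<xi> r - \<phi> \<xi> r) - (y1 \<xi> t - \<phi> \<xi> t)"] by (simp add: v'(2)[OF r \<xi>] v'(2)[OF t \<xi>])
      then have "wt A \<xi> * (cmod (coef (v' r) \<xi> - coef (v' t) \<xi>))\<^sup>2 \<le> wt A \<xi> * (2 * (cmod (\<phi> \<xi> r - \<phi> \<xi> t))\<^sup>2 + 2 * (cmod ((y1 \<xi> r - \<phi> \<xi> r) - (y1 \<xi> t - \<phi> \<xi> t)))\<^sup>2)"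
        by (intro mult_left_mono wt_nonneg)
      then show "wt A \<xi> * (cmod (coef (v' r) \<xi> - coef (v' t) \<xi>))\<^sup>2 \<le> 2 * (wt A \<xi> * (cmod (\<phi> \<xi> r - \<phi> \<xi> t))\<^sup>2) + 2 * (wt A \<xi> * (cmod ((y1 \<xi> r - \<phi> \<xi> r) - (y1 \<xi> t - \<phi> \<xi> t)))\<^sup>2)"
        by (simp add: distrib_left mult_ac)
    qed
    also have "\<dots> = 2 * (\<Sum>\<xi>\<in>F. wt A \<xi> * (cmod (\<phi> \<xi> r - \<phi> \<xi> t))\<^sup>2) + 2 * (\<Sum>\<xi>\<in>F. wt A \<xi> * (cmod ((y1 \<xi> r - \<phi> \<xi> r) - (y1 \<xi> t - \<phi> \<xi> t)))\<^sup>2)"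
      by (simp only: sum.distrib sum_distrib_left)
    also have "\<dots> \<le> 2 * ((r - t)\<^sup>2 * S) + 2 * ((k * \<bar>r - t\<bar>)\<^sup>2 * S)"
      by (intro add_mono mult_left_mono \<phi>lip[OF F t r] family[OF F] rem t r) auto
    also have "\<dots> = (L * \<bar>r - t\<bar>)\<^sup>2" by (simp add: power_mult_distrib L(2) algebra_simps)
    finally show ?thesis .
  qed
  have bd: "(\<Sum>\<xi>\<in>F. wt A \<xi> * (cmod (coef (v' t) \<xi>))\<^sup>2) \<le> (1 + B)\<^sup>2 * S" if F: "finite F" "F \<subseteq> I" and t: "t \<in> {0..T}" for F t
  proof -
    have "(\<Sum>\<xi>\<in>F. wt A \<xi> * (cmod (coef (v' t) \<xi>))\<^sup>2) = (\<Sum>\<xi>\<in>F. wt A \<xi> * (cmod (y1 \<xi> t))\<^sup>2)"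
      using F by (intro sum.cong refl) (simp add: v'(2)[OF t] subset_iff)
    then show ?thesis using y1fam[OF F t] by simp
  qed
  have W: "C0_into T X v" "C0_into T X v'" "deriv_into T X v v'" "gevrey_W2inf I lam w s T v"
    by (rule gevrey_W2infI[OF less_imp_le[OF T] A L(1) v(1) v'(1) dv bd lip]; assumption)+
  have second: "(y1 \<xi> has_vector_derivative coef (f t) \<xi> - of_real (a t * mu \<xi>) * y \<xi> t - of_real d * y \<xi> t) (at t within {0..T})"
    if \<xi>: "\<xi> \<in> I" and t: "t \<in> {0..T}" and d: "(Q has_real_derivative d) (at t within {0..T})" for \<xi> t d
    unfolding y1_def by (rule quasi_derivative_gives_second_derivative[OF dy[OF \<xi> t] dz[OF \<xi> t] d])
  have sol: "solves_cauchy I mu w T a q f v0 v1 v"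
    unfolding solves_cauchy_def
  proof
    fix \<xi> assume \<xi>: "\<xi> \<in> I"
    have T0: "0 \<in> {0..T}" using T by simp
    obtain N' where N': "negligible N'" "\<And>t. t \<in> {0..T} - N' \<Longrightarrow> (Q has_real_derivative p t) (at t within {0..T})"
      unfolding Q_def using bounded_AE_deriv_primitive[OF p(1,2)] by blast
    have Tm: "{0..T} \<in> sets lebesgue" by simp
    have "AE t in lebesgue_on {0..T}. \<exists>y2. (y1 \<xi> has_vector_derivative y2) (at t within {0..T}) \<and>
        y2 + complex_of_real (a t * mu \<xi>) * coef (v t) \<xi> + complex_of_real (q t) * coef (v t) \<xi> = coef (f t) \<xi>"
      unfolding AE_lebesgue_on_negligible[OF Tm]
    proof (intro exI[of _ "N \<union> N'"] conjI ballI)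
      show "negligible (N \<union> N')" using p(3) N'(1) by simp
      fix t assume t: "t \<in> {0..T} - (N \<union> N')"
      then have tT: "t \<in> {0..T}" and pq: "p t = q t" using p(4) by auto
      have "(y1 \<xi> has_vector_derivative coef (f t) \<xi> - of_real (a t * mu \<xi>) * y \<xi> t - of_real (q t) * y \<xi> t) (at t within {0..T})"
        using second[OF \<xi> tT N'(2)[of t]] t pq by simp
      then show "\<exists>y2. (y1 \<xi> has_vector_derivative y2) (at t within {0..T}) \<and>
        y2 + complex_of_real (a t * mu \<xi>) * coef (v t) \<xi> + complex_of_real (q t) * coef (v t) \<xi> = coef (f t) \<xi>"
        by (intro exI conjI) (assumption, simp add: v(2)[OF tT \<xi>])
    qed
    then show "\<exists>y1. (\<forall>t\<in>{0..T}. ((\<lambda>r. coef (v r) \<xi>) has_vector_derivative y1 t) (at t within {0..T})) \<and>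
     coef (v 0) \<xi> = coef v0 \<xi> \<and> y1 0 = coef v1 \<xi> \<and>
     (AE t in lebesgue_on {0..T}. \<exists>y2. (y1 has_vector_derivative y2) (at t within {0..T}) \<and>
        y2 + complex_of_real (a t * mu \<xi>) * coef (v t) \<xi> + complex_of_real (q t) * coef (v t) \<xi> = coef (f t) \<xi>)"
      using dv[OF _ \<xi>] by (intro exI[of _ "y1 \<xi>"]) (auto simp: v(2)[OF T0 \<xi>] init[OF \<xi>] v'(2)[OF _ \<xi>] y1_def Q0)
  qed
  have C2: "C2_into T X v" if rep: "has_continuous_representative T q"
  proof -
    have Tm: "{0..T} \<in> sets lebesgue" by simp
    obtain e N1 where e: "continuous_on {0..T} e" "negligible N1" "\<And>t. t \<in> {0..T} - N1 \<Longrightarrow> q t = e t"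
      using rep unfolding has_continuous_representative_def AE_lebesgue_on_negligible[OF Tm] by blast
    have Qe: "(Q has_real_derivative e t) (at t within {0..T})" if t: "t \<in> {0..T}" for t
    proof -
      have "Q r = integral {0..r} e" if r: "r \<in> {0..T}" for r
      proof -
        have "set_integrable lebesgue {0..r} p" using integrable_mult_indicator[OF _ p(1), of "{0..r}"] by (simp add: set_integrable_def)
        then have "Q r = integral {0..r} p" unfolding Q_def primitive_def by (rule set_lebesgue_integral_eq_integral(2))
        also have "\<dots> = integral {0..r} e"
          by (rule integral_spike[of "N \<union> N1"]) (use p(3,4) e(2,3) r in auto)
        finally show ?thesis .
      qed
      then show ?thesis
        unfolding has_real_derivative_iff_has_vector_derivative
        by (intro has_vector_derivative_transform[OF t _ integral_has_vector_derivative[OF e(1) t]])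
    qed
    obtain P where P: "P \<ge> 0" "\<And>t. t \<in> {0..T} \<Longrightarrow> \<bar>e t\<bar> \<le> P" using continuous_on_Icc_bounded[OF e(1)] by blast
    define hc where "hc \<xi> t = of_real (a t * mu \<xi> + e t) * y \<xi> t" for \<xi> t
    have coefb: "\<bar>a t * mu \<xi> + e t\<bar> \<le> (Ba * c + P) * (J \<xi>)\<^sup>2" if \<xi>: "\<xi> \<in> I" and t: "t \<in> {0..T}" for \<xi> t
    proof -
      have "\<bar>a t * mu \<xi> + e t\<bar> \<le> \<bar>a t\<bar> * mu \<xi> + \<bar>e t\<bar>" using abs_triangle_ineq[of "a t * mu \<xi>" "e t"] mu(1)[OF \<xi>] by (simp add: abs_mult)
      also have "\<dots> \<le> Ba * (c * (J \<xi>)\<^sup>2) + P" using Ba(1) Ba(2)[OF t] P(2)[OF t] mu[OF \<xi>] by (intro add_mono mult_mono) (auto simp: J_def)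
      also have "\<dots> \<le> Ba * (c * (J \<xi>)\<^sup>2) + (J \<xi>)\<^sup>2 * P" using Jsq[OF P(1)] by simp
      finally show ?thesis by (simp add: algebra_simps)
    qed
    have hfam: "(\<Sum>\<xi>\<in>F. wt A \<xi> * (cmod (hc \<xi> t))\<^sup>2) \<le> (Ba * c + P)\<^sup>2 * S" if F: "finite F" "F \<subseteq> I" and t: "t \<in> {0..T}" for F t
    proof (rule family[OF F])
      fix \<xi> assume \<xi>: "\<xi> \<in> I"
      have "cmod (hc \<xi> t) = \<bar>a t * mu \<xi> + e t\<bar> * cmod (y \<xi> t)" by (simp add: hc_def norm_mult del: of_real_add of_real_mult)
      also have "\<dots> \<le> ((Ba * c + P) * (J \<xi>)\<^sup>2) * sqrt (\<rho> \<xi>)"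
        using coefb[OF \<xi> t] yb[OF \<xi> t] Ba P c by (intro mult_mono) auto
      finally show "cmod (hc \<xi> t) \<le> (Ba * c + P) * ((J \<xi>)\<^sup>2 * sqrt (\<rho> \<xi>))" by (simp add: mult.assoc)
    qed
    have "\<exists>g. \<forall>t. t \<in> {0..T} \<longrightarrow> g t \<in> \<gamma> \<and> (\<forall>\<xi>\<in>I. coef (g t) \<xi> = hc \<xi> t)"
      by (rule synthesize_family[OF A hfam])
    then obtain h where h: "\<And>t. t \<in> {0..T} \<Longrightarrow> h t \<in> \<gamma>" "\<And>t \<xi>. t \<in> {0..T} \<Longrightarrow> \<xi> \<in> I \<Longrightarrow> coef (h t) \<xi> = hc \<xi> t"
      by blast
    \<comment> \<open>a modulus of continuity common to all coefficients of \<open>h\<close>\<close>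
    define osc where "osc t r = c * \<bar>a r - a t\<bar> + \<bar>e r - e t\<bar> + (Ba * c + P) * (1 + B) * \<bar>r - t\<bar>" for t r
    have h0: "C0_into T X h"
    proof (rule C0_into_of_modulus[OF A h(1), where \<eta> = "\<lambda>t r. (osc t r)\<^sup>2 * S"])
      fix F t r assume F: "finite F" "F \<subseteq> I" and t: "t \<in> {0..T}" and r: "r \<in> {0..T}"
      show "(\<Sum>\<xi>\<in>F. wt A \<xi> * (cmod (coef (h r) \<xi> - coef (h t) \<xi>))\<^sup>2) \<le> (osc t r)\<^sup>2 * S"
      proof (rule family[OF F])
        fix \<xi> assume \<xi>: "\<xi> \<in> I"
        have yl: "cmod (y \<xi> r - y \<xi> t) \<le> ((1 + B) * sqrt (\<rho> \<xi>)) * \<bar>r - t\<bar>"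
          by (rule vector_derivative_bound_imp_lipschitz[of "{0..T}" "y \<xi>" "y1 \<xi>", OF _ _ _ r t]) (use dy[OF \<xi>] y1b[OF \<xi>] in \<open>auto simp: y1_def\<close>)
        have "coef (h r) \<xi> - coef (h t) \<xi> = of_real ((a r - a t) * mu \<xi> + (e r - e t)) * y \<xi> r + of_real (a t * mu \<xi> + e t) * (y \<xi> r - y \<xi> t)"
          by (simp add: h(2)[OF r \<xi>] h(2)[OF t \<xi>] hc_def algebra_simps)
        then have "cmod (coef (h r) \<xi> - coef (h t) \<xi>) \<le> \<bar>(a r - a t) * mu \<xi> + (e r - e t)\<bar> * cmod (y \<xi> r) + \<bar>a t * mu \<xi> + e t\<bar> * cmod (y \<xi> r - y \<xi> t)"
          using norm_triangle_ineq[of "of_real ((a r - a t) * mu \<xi> + (e r - e t)) * y \<xi> r" "of_real (a t * mu \<xi> + e t) * (y \<xi> r - y \<xi> t)"]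
          by (simp add: norm_mult del: of_real_add of_real_mult of_real_diff)
        also have "\<dots> \<le> ((c * \<bar>a r - a t\<bar> + \<bar>e r - e t\<bar>) * (J \<xi>)\<^sup>2) * sqrt (\<rho> \<xi>) + ((Ba * c + P) * (J \<xi>)\<^sup>2) * (((1 + B) * sqrt (\<rho> \<xi>)) * \<bar>r - t\<bar>)"
        proof (intro add_mono mult_mono)
          have "\<bar>(a r - a t) * mu \<xi> + (e r - e t)\<bar> \<le> \<bar>a r - a t\<bar> * mu \<xi> + \<bar>e r - e t\<bar>"
            using abs_triangle_ineq[of "(a r - a t) * mu \<xi>" "e r - e t"] mu(1)[OF \<xi>] by (simp add: abs_mult)
          also have "\<dots> \<le> \<bar>a r - a t\<bar> * (c * (J \<xi>)\<^sup>2) + (J \<xi>)\<^sup>2 * \<bar>e r - e t\<bar>"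
            using mu(2)[OF \<xi>] by (intro add_mono mult_left_mono Jsq) (auto simp: J_def)
          finally show "\<bar>(a r - a t) * mu \<xi> + (e r - e t)\<bar> \<le> (c * \<bar>a r - a t\<bar> + \<bar>e r - e t\<bar>) * (J \<xi>)\<^sup>2" by (simp add: algebra_simps)
        qed (use coefb[OF \<xi> t] yb[OF \<xi> r] yl \<rho>0[OF \<xi>] Ba(1) P(1) c B in auto)
        also have "\<dots> = osc t r * ((J \<xi>)\<^sup>2 * sqrt (\<rho> \<xi>))" by (simp add: osc_def algebra_simps)
        finally show "cmod (coef (h r) \<xi> - coef (h t) \<xi>) \<le> osc t r * ((J \<xi>)\<^sup>2 * sqrt (\<rho> \<xi>))" .
      qed
    next
      fix t assume t: "t \<in> {0..T}"
      have "(a \<longlongrightarrow> a t) (at t within {0..T})" "(e \<longlongrightarrow> e t) (at t within {0..T})"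
        using ac e(1) t by (auto simp: continuous_on_def)
      then have "((\<lambda>r. (osc t r)\<^sup>2 * S) \<longlongrightarrow> (osc t t)\<^sup>2 * S) (at t within {0..T})"
        unfolding osc_def by (intro tendsto_intros)
      then show "((\<lambda>r. (osc t r)\<^sup>2 * S) \<longlongrightarrow> 0) (at t within {0..T})" by (simp add: osc_def)
    qed
    define v'' where "v'' t x = f t x - h t x" for t x
    have v2: "C0_into T X v''" unfolding v''_def[abs_def] by (rule C0_into_diff[OF f h0])
    have "deriv_into T X v' v''"
    proof (rule deriv_intoI[OF v'(1) v2])
      fix t \<xi> assume t: "t \<in> {0..T}" and \<xi>: "\<xi> \<in> I"
      have "coef (v'' t) \<xi> = coef (f t) \<xi> - hc \<xi> t"
        unfolding v''_def[abs_def] using C0_into_gevrey[OF f t] h(1)[OF t] \<xi> by (simp add: coef_diff gevrey_L2 h(2)[OF t \<xi>])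
      also have "\<dots> = coef (f t) \<xi> - of_real (a t * mu \<xi>) * y \<xi> t - of_real (e t) * y \<xi> t" by (simp add: hc_def algebra_simps)
      finally have eq: "coef (v'' t) \<xi> = \<dots>" .
      show "((\<lambda>r. coef (v' r) \<xi>) has_vector_derivative coef (v'' t) \<xi>) (at t within {0..T})"
        unfolding eq by (rule has_vector_derivative_transform[OF t _ second[OF \<xi> t Qe[OF t]]]) (rule v'(2)[OF _ \<xi>])
    qed
    then show ?thesis unfolding C2_into_def using W(1,2,3) v2 by blast
  qed
  show ?thesis using W(4) C2 sol by blast
qed

end

theorem theorem2p4:
  fixes V :: "real^'n \<Rightarrow> complex" and D :: "(real^'n \<Rightarrow> complex) set"
    and I :: "'i::linorder set" and lam :: "'i \<Rightarrow> complex"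
    and u w :: "'i \<Rightarrow> real^'n \<Rightarrow> complex"
    and c T s \<alpha> :: real and a q :: "real \<Rightarrow> real"
    and f :: "real \<Rightarrow> real^'n \<Rightarrow> complex" and v0 v1 :: "real^'n \<Rightarrow> complex"
  assumes "schrodinger_riesz V D I lam u w"
    and "c > 0" and "T > 0"
    and "0 < \<alpha>" and "\<alpha> < 2" and "C_alpha \<alpha> T a" and "\<forall>t\<in>{0..T}. a t \<ge> 0"
    and "L_infinity T q"
    and "1 \<le> s" and "s < 1 + \<alpha> / 2"
    and "C0_into T (gevrey_topology I lam w s) f"
    and "v0 \<in> gevrey I lam w s" and "v1 \<in> gevrey I lam w s"
  shows "\<exists>v. gevrey_W2inf I lam w s T v \<and>
             (has_continuous_representative T q \<longrightarrow> C2_into T (gevrey_topology I lam w s) v) \<and>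
             solves_cauchy I (H_eigenvalue c I lam) w T a q f v0 v1 v \<and>
             (\<forall>z. (gevrey_W2inf I lam w s T z \<or> C2_into T (gevrey_topology I lam w s) z) \<and>
                  solves_cauchy I (H_eigenvalue c I lam) w T a q f v0 v1 z \<longrightarrow>
                  (\<forall>t\<in>{0..T}. AE x in lebesgue. z t x = v t x))"
proof -
  interpret gevrey_scale I lam u w s
    using assms(1) unfolding schrodinger_riesz_def by unfold_locales auto
  have c: "0 \<le> 1 + c" using assms(2) by simp
  have ac: "continuous_on {0..T} a" by (rule C_alpha_continuous[OF assms(4,6)])
  obtain v where v: "gevrey_W2inf I lam w s T v" "has_continuous_representative T q \<longrightarrow> C2_into T X v"
    "solves_cauchy I (H_eigenvalue c I lam) w T a q f v0 v1 v"
    using solution_exists[where mu = "H_eigenvalue c I lam", OF assms(3-7,9,10) c assms(8)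
        H_eigenvalue_bounds[OF assms(2)] assms(11-13)] by blast
  have "AE x in lebesgue. z t x = v t x"
    if "gevrey_W2inf I lam w s T z \<or> C2_into T X z" "solves_cauchy I (H_eigenvalue c I lam) w T a q f v0 v1 z" "t \<in> {0..T}" for z t
    by (rule solution_unique[OF assms(3) ac assms(8) disjI1[OF v(1)] v(3) that])
  then show ?thesis using v by blast
qed

end
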